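(* Let $d\ge 2$ be an integer and $D=d^2-1$. Let $E$ be a $D$-dimensional real Euclidean space written as an orthogonal direct sum $E=W_1\oplus\cdots\oplus W_{d+1}$ of subspaces each of dimension $d-1$. In each $W_r$ take the $d$ vertices of a regular simplex centered at the origin with circumradius $\sqrt{(d-1)/d}$ (equivalently, $d$ vectors $v_{r,1},\dots,v_{r,d}\in W_r$ with $\langle v_{r,j},v_{r,k}\rangle=-1/d$ for $j\ne k$ and $\|v_{r,j}\|^2=1-1/d$). Let $\mathcal{P}_d$ be the convex hull of all $d(d+1)$ points $v_{r,j}$ (the complementarity polytope). For $\varepsilon\ge0$ let $\mathcal{P}_{d,\varepsilon}$ be the set of points of $E$ at distance at most $\varepsilon$ from $\mathcal{P}_d$, and write $\mathrm{vol}_D(\mathcal{P}_{d,\varepsilon})=\sum_{k=0}^{D}a_k\varepsilon^k$; define the unnormalized intrinsic volumes $\widetilde{V}_{D-k}(\mathcal{P}_d)=a_k$. Set $\alpha=\arccos\big(1-\frac{d}{d^2-1}\big)$ and $\beta=\arccos\big(1-\frac{2d}{d^2-1}\big)$. Then $$\widetilde{V}_{D-2}(\mathcal{P}_d)=\frac{\sqrt{2d^2-d-2}\,(d^2-1)\,d^{d/2+1}}{4\,(d^2-3)!}\,\alpha,$$ and $$\widetilde{V}_{D-3}(\mathcal{P}_d)=\frac{2\sqrt{3d^2-2d-3}\,(d^2-1)(d-2)\,d^{d/2+1}}{9\,(d^2-4)!}\arctan\sqrt{\tan\tfrac{3\alpha}{4}\,\tan^3\tfrac{\alpha}{4}}\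;+\;\frac{2\sqrt{d^2-d-1}\,(d^2-1)(d-1)\,d^{d/2+2}}{3\,(d^2-4)!}\arctan\sqrt{\tan\!\big(\tfrac{\alpha}{2}+\tfrac{\beta}{4}\big)\tan\!\big(\tfrac{\alpha}{2}-\tfrac{\beta}{4}\big)\tan^2\!\big(\tfrac{\beta}{4}\big)}.$$
   Context: $\mathrm{vol}_D$ denotes $D$-dimensional Lebesgue measure in $E$. The polytope $\mathcal{P}_d$ is determined up to isometry by the stated configuration; it is the polytope whose vertices have the pairwise distances of the rank-one projectors of a complete system of $d+1$ mutually unbiased bases in $\mathbb{C}^d$ (distance $\sqrt2$ within a basis, $\sqrt{2-2/d}$ between different bases) under the Hilbert–Schmidt metric. *)

theory Defs
  imports "HOL-Analysis.Analysis"
begin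

definition parallel_body :: "'a::euclidean_space set \<Rightarrow> real \<Rightarrow> 'a set" where
  "parallel_body P eps = {x. infdist x P \<le> eps}"

definition compl_polytope :: "nat \<Rightarrow> (nat \<Rightarrow> nat \<Rightarrow> 'a::euclidean_space) \<Rightarrow> 'a set" where
  "compl_polytope d v = convex hull {v r j | r j. r \<in> {1..d+1} \<and> j \<in> {1..d}}"

end

theory Submission
  imports Defs
begin

text \<open>
  The polytope is simplicial: a proper face arises by deleting from every column \<open>r\<close> a nonempty set
  \<open>C r\<close> of vertices. By nearest-point projection the parallel body is the disjoint union of the
  polytope and the sets \<open>F + (N\<^sub>F \<inter> ball)\<close>, where \<open>F\<close> runs through the relatively open faces and
  \<open>N\<^sub>F\<close> is the normal cone without its apex. Such a set has volume proportional to \<open>\<epsilon> ^ codim F\<close>,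
  which gives the Steiner polynomial; in codimension 2 or 3 its volume is that of \<open>F\<close> times a planar
  or solid angle. In codimension 2 the normal cone is spanned by two facet normals at angle \<alpha>. In
  codimension 3 it is the cone over an equilateral spherical triangle of side \<alpha> (three vertices
  deleted in one column) or over a spherical square of side \<alpha> and diagonal \<beta> (two vertices deleted
  in each of two columns). Solid angles come from Girard's theorem, rewritten by l'Huilier's formula;
  volumes of faces come from a Gram determinant.
\<close>

section \<open>Products of simplices and balls\<close>

text \<open>The linear relations among the vertices come from the zero sums of the columns: a
  combination determines its coefficients up to one constant per column, and a deleted vertex fixes
  that constant. So the vertices of a face are linearly independent, and each of its relatively
  interior points determines it. A column with nothing deleted cannot occur on the boundary, because
  its vertices sum to 0. A facet deletes one vertex per column; its outer normal is minus the sum of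
  these vertices. All such normals have squared length \<open>(d^2 - 1) / d\<close>, and each column
  in which two of them differ lowers their inner product by 1: hence \<alpha> (one column) and
  \<beta> (two columns). Angles are found without polar coordinates. The cylinder over a face,
  centred at the point of its affine hull nearest to the origin, is invariant under rotations of the
  normal space, and a rotation-invariant additive measure of wedges is linear in the angle. Volumes
  of faces are read off from vertices instead of edges: the Gram determinant of the vertices factors
  over the columns, and dividing it by the squared distance of the hull from the origin gives that
  of the edges.\<close>

lemma emeasure_simplex_times_ball:
  fixes S :: "'a::euclidean_space set"
  assumes S: "S \<subseteq> Basis"
  shows "emeasure lborel {x::'a. (\<forall>b\<in>Basis - S. 0 \<le> x \<bullet> b) \<and> (\<Sum>b\<in>Basis - S. x \<bullet> b) \<le> 1 \<and>
                    sqrt (\<Sum>b\<in>S. (x \<bullet> b)\<^sup>2) \<le> 1}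
       = ennreal (unit_ball_vol (card S) / fact (DIM('a) - card S))"
proof -
  interpret product_sigma_finite "\<lambda>_::'a. lborel :: real measure"
    by standard
  define A where "A = Basis - S"
  have fin: "finite A" "finite S" and AS: "A \<inter> S = {}" "A \<union> S = Basis"
    using S finite_subset[OF S] by (auto simp: A_def)
  have cardA: "card A = DIM('a) - card S"
    unfolding A_def using S fin by (simp add: card_Diff_subset)
  let ?M = "\<lambda>A::'a set. Pi\<^sub>M A (\<lambda>_. lborel :: real measure)"
  define X1 where "X1 = {x. (\<forall>i\<in>A. 0 \<le> x i) \<and> sum x A \<le> 1} \<inter> space (?M A)"
  define X2 where "X2 = {x. sqrt (\<Sum>i\<in>S. (x i)\<^sup>2) \<le> 1} \<inter> space (?M S)"
  let ?X = "{x::'a. (\<forall>b\<in>A. 0 \<le> x \<bullet> b) \<and> (\<Sum>b\<in>A. x \<bullet> b) \<le> 1 \<and> sqrt (\<Sum>b\<in>S. (x \<bullet> b)\<^sup>2) \<le> 1}"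
  let ?Y = "{y. (\<forall>b\<in>A. 0 \<le> y b) \<and> (\<Sum>b\<in>A. y b) \<le> 1 \<and> sqrt (\<Sum>b\<in>S. (y b)\<^sup>2) \<le> 1} \<inter> space (?M (A \<union> S))"
  have mX1: "X1 \<in> sets (?M A)" and mX2: "X2 \<in> sets (?M S)"
    unfolding X1_def X2_def using fin by measurable
  have mY: "?Y \<in> sets (?M (A \<union> S))"
    using fin by measurable
  have mX: "?X \<in> sets borel"
    using fin by measurable
  have coord: "(\<Sum>c\<in>Basis. y c *\<^sub>R c) \<bullet> b = y b" if "b \<in> Basis" for y and b :: 'a
    using that by simp
  have "emeasure lborel ?X = emeasure (distr (?M Basis) borel (\<lambda>f. \<Sum>b\<in>Basis. f b *\<^sub>R b)) ?X"
    by (subst lborel_eq) simp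
  also have "\<dots> = emeasure (?M Basis) ((\<lambda>f. \<Sum>b\<in>Basis. f b *\<^sub>R b) -` ?X \<inter> space (?M Basis))"
    using mX by (subst emeasure_distr) auto
  also have "(\<lambda>f. \<Sum>b\<in>Basis. f b *\<^sub>R b) -` ?X \<inter> space (?M Basis) = ?Y"
  proof -
    have "b \<in> Basis" if "b \<in> A \<or> b \<in> S" for b using that AS by auto
    then have e: "(\<forall>b\<in>A. 0 \<le> (\<Sum>c\<in>Basis. y c *\<^sub>R c) \<bullet> b) = (\<forall>b\<in>A. 0 \<le> y b)"
      "(\<Sum>b\<in>A. (\<Sum>c\<in>Basis. y c *\<^sub>R c) \<bullet> b) = sum y A"
      "(\<Sum>b\<in>S. ((\<Sum>c\<in>Basis. y c *\<^sub>R c) \<bullet> b)\<^sup>2) = (\<Sum>b\<in>S. (y b)\<^sup>2)" for y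
      by (auto intro!: sum.cong simp: coord simp del: inner_sum_left_Basis)
    show ?thesis unfolding AS(2) by (auto simp: e simp del: inner_sum_left_Basis)
  qed
  also have "emeasure (?M Basis) ?Y = emeasure (?M (A \<union> S)) ?Y"
    by (simp add: AS)
  \<comment> \<open>Splitting the coordinates into \<open>A\<close> and \<open>S\<close> makes the
    measure a product, and the set becomes the rectangle \<open>X1 \<times> X2\<close> of a standard
    simplex and a unit ball.\<close>
  also have "\<dots> = emeasure (distr (?M A \<Otimes>\<^sub>M ?M S) (?M (A \<union> S)) (merge A S)) ?Y"
    by (subst distr_merge) (use fin AS in auto)
  also have "\<dots> = emeasure (?M A \<Otimes>\<^sub>M ?M S) (merge A S -` ?Y \<inter> space (?M A \<Otimes>\<^sub>M ?M S))"
    using mY by (subst emeasure_distr) auto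
  also have "merge A S -` ?Y \<inter> space (?M A \<Otimes>\<^sub>M ?M S) = X1 \<times> X2"
  proof -
    have S': "merge A S (f, g) b = g b" if "b \<in> S" for f g :: "'a \<Rightarrow> real" and b
      using that AS by (auto simp: merge_def)
    have A': "merge A S (f, g) b = f b" if "b \<in> A" for f g :: "'a \<Rightarrow> real" and b
      using that AS by (auto simp: merge_def)
    have e: "(\<forall>b\<in>A. 0 \<le> merge A S (f,g) b) = (\<forall>b\<in>A. 0 \<le> f b)"
      "(\<Sum>b\<in>A. merge A S (f,g) b) = sum f A"
      "(\<Sum>b\<in>S. (merge A S (f,g) b)\<^sup>2) = (\<Sum>b\<in>S. (g b)\<^sup>2)" for f g :: "'a \<Rightarrow> real"
      by (auto intro!: sum.cong simp: A' S')
    have sp: "merge A S x \<in> space (?M (A \<union> S))" if "x \<in> space (?M A \<Otimes>\<^sub>M ?M S)" for x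
      using measurable_space[OF measurable_merge that] .
    show ?thesis
      using sp by (auto simp: X1_def X2_def space_pair_measure e A')
  qed
  also have "emeasure (?M A \<Otimes>\<^sub>M ?M S) (X1 \<times> X2) = emeasure (?M A) X1 * emeasure (?M S) X2"
  proof -
    interpret sigma_finite_measure "?M S" by (rule sigma_finite) (rule fin)
    show ?thesis using mX1 mX2 by (rule emeasure_pair_measure_Times)
  qed
  also have "emeasure (?M A) X1 = ennreal (1 / fact (card A))"
    unfolding X1_def using emeasure_std_simplex_aux[OF fin(1), of 1] by simp
  also have "emeasure (?M S) X2 = ennreal (unit_ball_vol (card S))"
    unfolding X2_def using emeasure_cball_aux[OF fin(2), of 1] by simp
  finally show ?thesis
    unfolding A_def[symmetric] cardA by (simp add: ennreal_mult'[symmetric])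
qed

text \<open>The strict inequalities match the relatively open faces; they change the closed set only
  inside finitely many hyperplanes.\<close>

lemma measure_open_simplex_times_ball:
  fixes S :: "'n::finite set"
  shows "measure lebesgue {y::real^'n. (\<forall>i\<in>-S. 0 < y$i) \<and> (\<Sum>i\<in>-S. y$i) < 1 \<and> (\<Sum>i\<in>S. (y$i)\<^sup>2) \<le> 1}
       = unit_ball_vol (card S) / fact (CARD('n) - card S)"
    (is "measure lebesgue ?O = _")
proof -
  let ?b = "\<lambda>i::'n. axis i (1::real)"
  define T where "T = ?b ` S"
  have inj: "inj_on ?b X" for X by (auto simp: inj_on_def axis_eq_axis)
  have T: "T \<subseteq> Basis" by (auto simp: T_def Basis_vec_def)
  have BT: "Basis - T = ?b ` (-S)"
    by (auto simp: T_def Basis_vec_def axis_eq_axis)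
  have cT: "card T = card S" unfolding T_def by (rule card_image) (rule inj)
  let ?C = "{x::real^'n. (\<forall>b\<in>Basis - T. 0 \<le> x \<bullet> b) \<and> (\<Sum>b\<in>Basis - T. x \<bullet> b) \<le> 1 \<and>
                    sqrt (\<Sum>b\<in>T. (x \<bullet> b)\<^sup>2) \<le> 1}"
  have C: "?C = {y::real^'n. (\<forall>i\<in>-S. 0 \<le> y$i) \<and> (\<Sum>i\<in>-S. y$i) \<le> 1 \<and> (\<Sum>i\<in>S. (y$i)\<^sup>2) \<le> 1}"
    unfolding BT by (simp add: T_def sum.reindex[OF inj] inner_axis)
  have mC: "?C \<in> sets borel"
    by measurable
  have "measure lebesgue ?C = measure lborel ?C"
    using mC by simp
  also have "\<dots> = unit_ball_vol (card S) / fact (CARD('n) - card S)"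
    using emeasure_simplex_times_ball[OF T] by (simp add: measure_def cT del: std_simplex)
  finally have mes: "measure lebesgue ?C = unit_ball_vol (card S) / fact (CARD('n) - card S)" .
  \<comment> \<open>The indicator vector of \<open>-S\<close> exhibits the facet
    \<open>sum = 1\<close> of the simplex as part of a hyperplane.\<close>
  define s where "s = (\<chi> i. if i \<in> -S then 1 else (0::real))"
  have s: "(\<Sum>i\<in>-S. y$i) = s \<bullet> y" for y :: "real^'n"
    by (simp add: s_def inner_vec_def if_distrib[of "\<lambda>x. x * _"] sum.If_cases Compl_eq)
  have "negligible {y. s \<bullet> y = 1}"
    by (rule negligible_hyperplane) auto
  moreover have nb: "negligible {y. ?b i \<bullet> y = 0}" for i
    by (rule negligible_hyperplane) (simp add: axis_eq_0_iff)
  then have "negligible (\<Union>i\<in>-S. {y. ?b i \<bullet> y = 0})"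
    by (intro negligible_Union finite_imageI) (auto intro: nb)
  ultimately have "negligible ({y. s \<bullet> y = 1} \<union> (\<Union>i\<in>-S. {y. ?b i \<bullet> y = 0}))"
    by (rule negligible_Un)
  then have "negligible (sym_diff ?C ?O)"
    unfolding C by (rule negligible_subset) (auto simp: s inner_axis' order_less_le)
  then have "measure lebesgue ?O = measure lebesgue ?C"
  proof (intro measure_negligible_symdiff)
    show "?C \<in> lmeasurable"
    proof (rule fmeasurableI)
      show mC': "?C \<in> sets lebesgue" using mC by (simp only: sets_completionI_sets sets_lborel)
      have "emeasure lebesgue ?C = emeasure lborel ?C"
        using emeasure_completion[OF mC'] main_part[of ?C lborel] mC by (simp only: sets_lborel)
      then show "emeasure lebesgue ?C < \<infinity>"
        unfolding emeasure_simplex_times_ball[OF T] by (simp only: ennreal_less_top infinity_ennreal_def)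
    qed
  qed
  then show ?thesis using mes by simp
qed

section \<open>Faces and their normal cones in the coordinates of a linear frame\<close>

definition frame_map :: "('n \<Rightarrow> real^'n) \<Rightarrow> real^'n \<Rightarrow> real^'n::finite" where
  "frame_map w y = (\<Sum>i\<in>UNIV. y$i *\<^sub>R w i)"

lemma linear_frame_map: "linear (frame_map w)"
  unfolding frame_map_def
  by (rule linearI) (simp_all add: scaleR_add_left sum.distrib scaleR_sum_right)

lemma det_frame_map: "det (matrix (frame_map w)) = det (\<chi> i. w i)"
proof -
  have "matrix (frame_map w) = transpose (\<chi> i. w i)"
    by (simp add: matrix_def frame_map_def transpose_def vec_eq_iff axis_def
        if_distrib[of "\<lambda>x. x * _"] cong: if_cong)
  then show ?thesis by (simp add: det_transpose)
qed

text \<open>Coordinates outside \<open>S\<close> are barycentric: the slack in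
  \<open>sum < 1\<close> is the positive weight of a base vertex. Coordinates in \<open>S\<close>
  describe the normal vector; its value 0 is excluded, which will keep the regions disjoint from the
  polytope.\<close>

definition simplex_cone_domain :: "('n \<Rightarrow> real^'n) \<Rightarrow> 'n set \<Rightarrow> (real^'n) set \<Rightarrow> real \<Rightarrow> (real^'n::finite) set" where
  "simplex_cone_domain w S N \<epsilon> = {y. (\<forall>i\<in>-S. 0 < y$i) \<and> (\<Sum>i\<in>-S. y$i) < 1 \<and>
      (\<Sum>i\<in>S. y$i *\<^sub>R w i) \<in> N \<and> (\<Sum>i\<in>S. y$i *\<^sub>R w i) \<noteq> 0 \<and> norm (\<Sum>i\<in>S. y$i *\<^sub>R w i) \<le> \<epsilon>}"

definition simplex_cone :: "('n \<Rightarrow> real^'n) \<Rightarrow> 'n set \<Rightarrow> real^'n \<Rightarrow> (real^'n) set \<Rightarrow> real \<Rightarrow> (real^'n::finite) set" where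
  "simplex_cone w S x0 N \<epsilon> = (\<lambda>y. x0 + frame_map w y) ` simplex_cone_domain w S N \<epsilon>"

lemma norm_sum_orthonormal:
  fixes w :: "'n::finite \<Rightarrow> 'a::real_inner"
  assumes "\<And>i j. i \<in> S \<Longrightarrow> j \<in> S \<Longrightarrow> w i \<bullet> w j = (if i = j then 1 else 0)"
  shows "(norm (\<Sum>i\<in>S. c i *\<^sub>R w i))\<^sup>2 = (\<Sum>i\<in>S. (c i)\<^sup>2)"
proof -
  have "(norm (\<Sum>i\<in>S. c i *\<^sub>R w i))\<^sup>2 = (\<Sum>i\<in>S. \<Sum>j\<in>S. c j * (c i * (w i \<bullet> w j)))"
    unfolding power2_norm_eq_inner inner_sum_left inner_sum_right sum_distrib_left
    by (simp add: inner_commute mult.assoc)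
  also have "\<dots> = (\<Sum>i\<in>S. \<Sum>j\<in>S. if i = j then c i * c j else 0)"
    by (intro sum.cong refl) (auto simp: assms)
  finally show ?thesis by (simp add: power2_eq_square)
qed

text \<open>Orthonormality over \<open>S\<close> bounds those coordinates by \<epsilon>, and the
  others lie in the unit interval; closedness of \<open>N\<close> makes the set Borel.\<close>

lemma lmeasurable_simplex_cone_domain:
  fixes w :: "'n::finite \<Rightarrow> real^'n"
  assumes on: "\<And>i j. i \<in> S \<Longrightarrow> j \<in> S \<Longrightarrow> w i \<bullet> w j = (if i = j then 1 else 0)"
    and N: "closed N"
  shows "simplex_cone_domain w S N \<epsilon> \<in> lmeasurable"
proof (rule bounded_set_imp_lmeasurable)
  show "bounded (simplex_cone_domain w S N \<epsilon>)"
  proof -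
    have bd: "\<bar>y$i\<bar> \<le> max 1 \<epsilon>" if y: "y \<in> simplex_cone_domain w S N \<epsilon>" for y i
    proof (cases "i \<in> S")
      case True
      let ?n = "norm (\<Sum>i\<in>S. y$i *\<^sub>R w i)"
      have "(y$i)\<^sup>2 \<le> (\<Sum>i\<in>S. (y$i)\<^sup>2)"
        by (rule member_le_sum) (use True in auto)
      also have "\<dots> = ?n\<^sup>2"
        by (rule norm_sum_orthonormal[symmetric]) (erule (1) on)
      finally have "\<bar>y$i\<bar> \<le> ?n"
        using power2_le_iff_abs_le[of ?n "y$i"] by simp
      moreover have "?n \<le> \<epsilon>" using y by (simp add: simplex_cone_domain_def)
      ultimately show ?thesis by linarith
    next
      case False
      then have "y$i \<le> (\<Sum>i\<in>-S. y$i)"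
        by (intro member_le_sum) (use y in \<open>auto simp: simplex_cone_domain_def intro: less_imp_le\<close>)
      moreover have "0 < y$i" using y False by (auto simp: simplex_cone_domain_def)
      ultimately show ?thesis using y by (auto simp: simplex_cone_domain_def)
    qed
    have "norm y \<le> (\<Sum>i\<in>(UNIV::'n set). max 1 \<epsilon>)" if y: "y \<in> simplex_cone_domain w S N \<epsilon>" for y
    proof -
      have "norm y \<le> (\<Sum>i\<in>UNIV. \<bar>y$i\<bar>)" by (rule norm_le_l1_cart)
      also have "\<dots> \<le> (\<Sum>i\<in>(UNIV::'n set). max 1 \<epsilon>)" by (rule sum_mono) (rule bd[OF y])
      finally show ?thesis .
    qed
    then show ?thesis by (rule boundedI)
  qed
  let ?f = "\<lambda>y::real^'n. \<Sum>i\<in>S. y$i *\<^sub>R w i"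
  have f: "continuous_on UNIV ?f" by (intro continuous_intros)
  then have fm: "?f \<in> borel_measurable borel" by (rule borel_measurable_continuous_onI)
  have "open ((\<Inter>i\<in>-S. {y::real^'n. 0 < y$i}) \<inter> {y. (\<Sum>i\<in>-S. y$i) < 1})"
    by (intro open_Int open_INT ballI finite open_Collect_less continuous_intros)
  moreover have "(N - {0}) \<inter> cball 0 \<epsilon> \<in> sets borel"
    using N by (intro sets.Int sets.Diff borel_closed) auto
  then have "?f -` ((N - {0}) \<inter> cball 0 \<epsilon>) \<in> sets borel"
    using measurable_sets[OF fm] by (simp only: space_borel Int_UNIV_right)
  ultimately have "(\<Inter>i\<in>-S. {y::real^'n. 0 < y$i}) \<inter> {y. (\<Sum>i\<in>-S. y$i) < 1} \<inter> ?f -` ((N - {0}) \<inter> cball 0 \<epsilon>) \<in> sets borel"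
    using sets.Int borel_open by blast
  also have "(\<Inter>i\<in>-S. {y::real^'n. 0 < y$i}) \<inter> {y. (\<Sum>i\<in>-S. y$i) < 1} \<inter> ?f -` ((N - {0}) \<inter> cball 0 \<epsilon>)
    = simplex_cone_domain w S N \<epsilon>"
    by (auto simp: simplex_cone_domain_def)
  finally show "simplex_cone_domain w S N \<epsilon> \<in> sets lebesgue"
    by (simp only: sets_completionI_sets sets_lborel)
qed

context
  fixes w :: "'n::{finite,wellorder} \<Rightarrow> real^'n::_" and S :: "'n::_ set" and x0 :: "real^'n::_"
  assumes on: "\<And>i j. i \<in> S \<Longrightarrow> j \<in> S \<Longrightarrow> w i \<bullet> w j = (if i = j then 1 else 0)"
begin

private lemma norm_frame_sum: "(norm (\<Sum>i\<in>S. y$i *\<^sub>R w i))\<^sup>2 = (\<Sum>i\<in>S. (y$i)\<^sup>2)"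
  by (rule norm_sum_orthonormal) (erule (1) on)

lemma simplex_cone_image:
  "simplex_cone w S x0 N \<epsilon> = (+) x0 ` frame_map w ` simplex_cone_domain w S N \<epsilon>"
  by (auto simp: simplex_cone_def)

lemma lmeasurable_simplex_cone: "closed N \<Longrightarrow> simplex_cone w S x0 N \<epsilon> \<in> lmeasurable"
  unfolding simplex_cone_image
  by (intro measurable_translation measurable_linear_image linear_frame_map lmeasurable_simplex_cone_domain on)

lemma measure_simplex_cone:
  "closed N \<Longrightarrow> measure lebesgue (simplex_cone w S x0 N \<epsilon>)
     = \<bar>det (\<chi> i. w i)\<bar> * measure lebesgue (simplex_cone_domain w S N \<epsilon>)"
  unfolding simplex_cone_image
  by (simp add: measure_translation measure_linear_image linear_frame_map lmeasurable_simplex_cone_domain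
       on det_frame_map)

text \<open>This produces the powers in the Steiner polynomial. Stretching only the coordinates in
  \<open>S\<close> by \<epsilon> maps the domain for 1 onto the domain for \<epsilon>, as
  \<open>N\<close> is a cone, and has determinant \<open>\<epsilon> ^ card S\<close>.\<close>

lemma measure_simplex_cone_scale:
  assumes N: "closed N" and cone: "\<And>c x. c > 0 \<Longrightarrow> x \<in> N \<Longrightarrow> c *\<^sub>R x \<in> N" and "\<epsilon> > 0"
  shows "measure lebesgue (simplex_cone w S x0 N \<epsilon>) = \<epsilon> ^ card S * measure lebesgue (simplex_cone w S x0 N 1)"
proof -
  define m where "m = (\<lambda>i. if i \<in> S then \<epsilon> else 1)"
  let ?g = "\<lambda>y::real^'n::_. \<chi> i. m i * y$i"
  have "?g ` simplex_cone_domain w S N 1 = simplex_cone_domain w S N \<epsilon>"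
  proof -
    have sc: "(\<Sum>i\<in>S. ?g y $ i *\<^sub>R w i) = \<epsilon> *\<^sub>R (\<Sum>i\<in>S. y$i *\<^sub>R w i)" for y
      by (simp add: m_def scaleR_sum_right)
    have sm: "(\<forall>i\<in>-S. 0 < ?g y $ i) = (\<forall>i\<in>-S. 0 < y $ i)" "(\<Sum>i\<in>-S. ?g y $ i) = (\<Sum>i\<in>-S. y $ i)" for y
      by (auto simp: m_def intro!: sum.cong)
    have mem: "?g y \<in> simplex_cone_domain w S N \<epsilon>" if "y \<in> simplex_cone_domain w S N 1" for y
      using that cone[OF \<open>\<epsilon> > 0\<close>] \<open>\<epsilon> > 0\<close>
      unfolding simplex_cone_domain_def mem_Collect_eq sc sm by simp
    have mem': "z \<in> ?g ` simplex_cone_domain w S N 1" if z: "z \<in> simplex_cone_domain w S N \<epsilon>" for z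
    proof
      let ?y = "\<chi> i. z$i / m i"
      show zy: "z = ?g ?y" using \<open>\<epsilon> > 0\<close> by (simp add: vec_eq_iff m_def)
      have z': "?g ?y \<in> simplex_cone_domain w S N \<epsilon>" using z unfolding zy[symmetric] .
      have "\<epsilon> *\<^sub>R (\<Sum>i\<in>S. ?y$i *\<^sub>R w i) \<in> N" "(\<Sum>i\<in>S. ?y$i *\<^sub>R w i) \<noteq> 0" 
        "\<epsilon> * norm (\<Sum>i\<in>S. ?y$i *\<^sub>R w i) \<le> \<epsilon>" "\<forall>i\<in>-S. 0 < ?y $ i" "(\<Sum>i\<in>-S. ?y $ i) < 1"
        using z' \<open>\<epsilon> > 0\<close> unfolding simplex_cone_domain_def mem_Collect_eq sc sm by auto
      then show "?y \<in> simplex_cone_domain w S N 1"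
        using cone[of "1/\<epsilon>" "\<epsilon> *\<^sub>R (\<Sum>i\<in>S. ?y$i *\<^sub>R w i)"] \<open>\<epsilon> > 0\<close>
        unfolding simplex_cone_domain_def mem_Collect_eq by (simp add: field_simps)
    qed
    show ?thesis using mem mem' by blast
  qed
  moreover have "measure lebesgue (?g ` simplex_cone_domain w S N 1)
    = \<bar>prod m UNIV\<bar> * measure lebesgue (simplex_cone_domain w S N 1)"
    by (rule measure_stretch) (rule lmeasurable_simplex_cone_domain[OF on N])
  moreover have "prod m UNIV = \<epsilon> ^ card S"
    by (simp add: m_def prod.If_cases)
  ultimately show ?thesis
    using \<open>\<epsilon> > 0\<close> by (simp add: measure_simplex_cone N)
qed

text \<open>With \<open>N = UNIV\<close> the domain is the open simplex times a ball without its
  centre. For nonempty \<open>S\<close> the missing centre lies in a coordinate hyperplane; for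
  empty \<open>S\<close> nothing would be left.\<close>

lemma measure_simplex_ball:
  assumes "S \<noteq> {}"
  shows "measure lebesgue (simplex_cone w S x0 UNIV 1)
    = \<bar>det (\<chi> i. w i)\<bar> * unit_ball_vol (card S) / fact (CARD('n) - card S)"
proof -
  let ?O = "{y::real^'n::_. (\<forall>i\<in>-S. 0 < y$i) \<and> (\<Sum>i\<in>-S. y$i) < 1 \<and> (\<Sum>i\<in>S. (y$i)\<^sup>2) \<le> 1}"
  obtain k where k: "k \<in> S" using assms by auto
  have nrm: "norm (\<Sum>i\<in>S. y$i *\<^sub>R w i) \<le> 1 \<longleftrightarrow> (\<Sum>i\<in>S. (y$i)\<^sup>2) \<le> 1" for y
    using norm_frame_sum[of y] abs_square_le_1[of "norm (\<Sum>i\<in>S. y$i *\<^sub>R w i)"]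
    by simp
  have z: "y$k = 0" if "(\<Sum>i\<in>S. y$i *\<^sub>R w i) = 0" for y
  proof -
    have "(\<Sum>i\<in>S. (y$i)\<^sup>2) = 0"
      using norm_frame_sum[of y] that by simp
    then show ?thesis using k by (simp add: sum_nonneg_eq_0_iff)
  qed
  have "negligible {y::real^'n::_. axis k 1 \<bullet> y = 0}"
    by (rule negligible_hyperplane) (simp add: axis_eq_0_iff)
  then have "negligible (sym_diff (simplex_cone_domain w S UNIV 1) ?O)"
    by (rule negligible_subset) (auto simp: simplex_cone_domain_def nrm inner_axis' dest: z)
  then have "measure lebesgue ?O = measure lebesgue (simplex_cone_domain w S UNIV 1)"
    by (intro measure_negligible_symdiff) (use lmeasurable_simplex_cone_domain[OF on] in auto)
  then show ?thesis
    unfolding measure_open_simplex_times_ball by (simp add: measure_simplex_cone flip: times_divide_eq_right)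
qed

end

section \<open>Wedges and trihedral cones\<close>

text \<open>Cauchy's functional equation on an interval, with nonnegativity in the role of
  continuity. It suffices to bound \<open>\<phi>\<close> from below, since the same bound at
  \<open>b - t\<close> gives the upper one.\<close>

lemma additive_nonneg_linear:
  fixes \<phi> :: "real \<Rightarrow> real"
  assumes b: "b > 0" and nonneg: "\<And>t. 0 \<le> t \<Longrightarrow> t \<le> b \<Longrightarrow> 0 \<le> \<phi> t"
    and add: "\<And>s t. 0 \<le> s \<Longrightarrow> 0 \<le> t \<Longrightarrow> s + t \<le> b \<Longrightarrow> \<phi> (s + t) = \<phi> s + \<phi> t"
    and t: "0 \<le> t" "t \<le> b"
  shows "\<phi> t = t / b * \<phi> b"
proof -
  have mono: "\<phi> s \<le> \<phi> t" if "0 \<le> s" "s \<le> t" "t \<le> b" for s t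
    using add[of s "t - s"] nonneg[of "t - s"] that by simp
  have mult: "\<phi> (real n * s) = real n * \<phi> s" if "0 \<le> s" "real n * s \<le> b" for n s
    using that(2)
  proof (induction n)
    case 0
    then show ?case using add[of 0 0] b by simp
  next
    case (Suc n)
    then have "\<phi> (real n * s + s) = \<phi> (real n * s) + \<phi> s"
      using that(1) by (intro add) (auto simp: algebra_simps)
    with Suc show ?case using that(1) by (simp add: algebra_simps)
  qed
  have lower: "t / b * \<phi> b \<le> \<phi> t" if t: "0 \<le> t" "t \<le> b" for t
  proof (rule ccontr)
    assume "\<not> ?thesis"
    then have pos: "0 < t / b * \<phi> b - \<phi> t" by simp
    \<comment> \<open>For steps of width \<open>b / N\<close>, rounding \<open>t\<close> down loses
      at most \<open>\<phi> b / N\<close>, which is less than the assumed defect.\<close>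
    then obtain N :: nat where "\<phi> b / (t / b * \<phi> b - \<phi> t) < real N"
      using reals_Archimedean2 by blast
    moreover have "0 \<le> \<phi> b / (t / b * \<phi> b - \<phi> t)"
      using pos nonneg[of b] b by simp
    ultimately have N: "real N > 0" "\<phi> b < real N * (t / b * \<phi> b - \<phi> t)"
      using pos by (linarith, simp add: pos_divide_less_eq)
    \<comment> \<open>The number of full steps of width \<open>b / N\<close> below
      \<open>t\<close>.\<close>
    define m where "m = nat \<lfloor>t * real N / b\<rfloor>"
    have q0: "0 \<le> t * real N / b" using t b by simp
    have m: "real m \<le> t * real N / b" "t * real N / b < real m + 1"
      unfolding m_def using q0 by (auto simp: of_nat_nat)
    have mb: "real m * (b / real N) \<le> t"
      using m(1) b N(1) by (simp add: field_simps)
    have "real m * \<phi> (b / real N) \<le> \<phi> t"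
      using mult[of "b / real N" m] mono[OF _ mb] mb t b by simp
    moreover have "\<phi> b = real N * \<phi> (b / real N)"
      using mult[of "b / real N" N] b N(1) by simp
    ultimately have "real m * \<phi> b \<le> real N * \<phi> t"
      using N(1) by (simp add: mult.left_commute mult_left_mono)
    moreover have "(t * real N / b) * \<phi> b \<le> (real m + 1) * \<phi> b"
      using m(2) nonneg[of b] b by (intro mult_right_mono) auto
    ultimately have "(t * real N / b) * \<phi> b \<le> real N * \<phi> t + \<phi> b"
      by (simp add: algebra_simps)
    with N(2) show False by (simp add: algebra_simps)
  qed
  have "\<phi> b = \<phi> t + \<phi> (b - t)" using add[of t "b - t"] t by simp
  moreover have "(b - t) / b * \<phi> b = \<phi> b - t / b * \<phi> b"
    using b by (simp add: field_simps)
  ultimately show ?thesis using lower[OF t] lower[of "b - t"] t by simp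
qed

text \<open>Rotation by \<open>s\<close> in the plane of an orthonormal pair, the identity on the
  orthogonal complement. Written as \<open>x\<close> plus a vector of the plane, so that the
  displacement visibly stays in every subspace containing \<open>e1\<close> and
  \<open>e2\<close>.\<close>

definition plane_rot :: "'a::real_inner \<Rightarrow> 'a \<Rightarrow> real \<Rightarrow> 'a \<Rightarrow> 'a" where
  "plane_rot e1 e2 s x = x + ((cos s - 1) * (x \<bullet> e1) - sin s * (x \<bullet> e2)) *\<^sub>R e1
                           + ((cos s - 1) * (x \<bullet> e2) + sin s * (x \<bullet> e1)) *\<^sub>R e2"

text \<open>The direction \<open>cos t *\<^sub>R e1 + sin t *\<^sub>R e2\<close> turned by a right
  angle.\<close>

definition plane_normal :: "'a::real_inner \<Rightarrow> 'a \<Rightarrow> real \<Rightarrow> 'a" where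
  "plane_normal e1 e2 t = cos t *\<^sub>R e2 - sin t *\<^sub>R e1"

context
  fixes e1 e2 :: "'a::euclidean_space"
  assumes on: "e1 \<bullet> e1 = 1" "e2 \<bullet> e2 = 1" "e1 \<bullet> e2 = 0"
begin

lemma plane_rot_inner:
  "plane_rot e1 e2 s x \<bullet> e1 = cos s * (x \<bullet> e1) - sin s * (x \<bullet> e2)"
  "plane_rot e1 e2 s x \<bullet> e2 = cos s * (x \<bullet> e2) + sin s * (x \<bullet> e1)"
  using on by (simp_all add: plane_rot_def inner_add_left algebra_simps inner_commute[of e2 e1])

lemma orthogonal_plane_rot: "orthogonal_transformation (plane_rot e1 e2 s)"
  unfolding orthogonal_transformation
proof (intro conjI allI)
  show "linear (plane_rot e1 e2 s)"
    by (rule linearI) (simp_all add: plane_rot_def inner_add_left algebra_simps scaleR_add_left)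
  fix x
  let ?p = "(cos s - 1) * (x \<bullet> e1) - sin s * (x \<bullet> e2)"
  let ?q = "(cos s - 1) * (x \<bullet> e2) + sin s * (x \<bullet> e1)"
  have "plane_rot e1 e2 s x \<bullet> plane_rot e1 e2 s x
      = x \<bullet> x + (2 * ?p * (x \<bullet> e1) + 2 * ?q * (x \<bullet> e2) + ?p\<^sup>2 + ?q\<^sup>2)"
    unfolding plane_rot_def using on
    by (simp add: inner_add_left inner_add_right inner_commute[of e2 e1] inner_commute[of e1 x] inner_commute[of e2 x] power2_eq_square)
       (simp add: algebra_simps)
  also have "2 * ?p * (x \<bullet> e1) + 2 * ?q * (x \<bullet> e2) + ?p\<^sup>2 + ?q\<^sup>2
      = ((sin s)\<^sup>2 + (cos s)\<^sup>2 - 1) * ((x \<bullet> e1)\<^sup>2 + (x \<bullet> e2)\<^sup>2)"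
    by algebra
  finally show "norm (plane_rot e1 e2 s x) = norm x"
    by (simp add: norm_eq_sqrt_inner)
qed

lemma plane_rot_cancel: "plane_rot e1 e2 s (plane_rot e1 e2 (- s) x) = x"
proof -
  let ?p = "(cos s - 1) * (x \<bullet> e1) + sin s * (x \<bullet> e2) + ((cos s - 1) * (cos s * (x \<bullet> e1) + sin s * (x \<bullet> e2)) - sin s * (cos s * (x \<bullet> e2) - sin s * (x \<bullet> e1)))"
  let ?q = "(cos s - 1) * (x \<bullet> e2) - sin s * (x \<bullet> e1) + ((cos s - 1) * (cos s * (x \<bullet> e2) - sin s * (x \<bullet> e1)) + sin s * (cos s * (x \<bullet> e1) + sin s * (x \<bullet> e2)))"
  have "plane_rot e1 e2 s (plane_rot e1 e2 (- s) x) = x + ?p *\<^sub>R e1 + ?q *\<^sub>R e2"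
    unfolding plane_rot_def[of e1 e2 s] plane_rot_inner unfolding plane_rot_def
    by (simp add: scaleR_add_left scaleR_diff_left)
  also have "?p = ((sin s)\<^sup>2 + (cos s)\<^sup>2 - 1) * (x \<bullet> e1)"
    by algebra
  also have "?q = ((sin s)\<^sup>2 + (cos s)\<^sup>2 - 1) * (x \<bullet> e2)"
    by algebra
  finally show ?thesis by simp
qed

lemma plane_rot_normal: "plane_rot e1 e2 s x \<bullet> plane_normal e1 e2 (s + t) = x \<bullet> plane_normal e1 e2 t"
proof -
  have "plane_rot e1 e2 s x \<bullet> plane_normal e1 e2 (s + t)
      = ((sin s)\<^sup>2 + (cos s)\<^sup>2) * (cos t * (x \<bullet> e2) - sin t * (x \<bullet> e1))"
    unfolding plane_normal_def inner_diff_right inner_scaleR_right plane_rot_inner cos_add sin_add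
    by algebra
  then show ?thesis by (simp add: plane_normal_def inner_diff_right)
qed

lemma plane_normal_nonzero: "plane_normal e1 e2 t \<noteq> 0"
proof
  assume "plane_normal e1 e2 t = 0"
  then have "plane_normal e1 e2 t \<bullet> e1 = 0" "plane_normal e1 e2 t \<bullet> e2 = 0" by auto
  then have "sin t = 0" "cos t = 0"
    using on by (simp_all add: plane_normal_def inner_diff_left inner_commute[of e2 e1])
  then show False using sin_cos_squared_add[of t] by simp
qed

end

lemma halfspace_sets_lebesgue [measurable, simp]:
  fixes a :: "'a::euclidean_space"
  shows "{x. 0 \<le> x \<bullet> a} \<in> sets lebesgue" "{x. x \<bullet> a \<le> 0} \<in> sets lebesgue"
proof -
  have "closed {x. 0 \<le> x \<bullet> a}" "closed {x. x \<bullet> a \<le> 0}"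
    by (intro closed_Collect_le continuous_intros)+
  then show "{x. 0 \<le> x \<bullet> a} \<in> sets lebesgue" "{x. x \<bullet> a \<le> 0} \<in> sets lebesgue"
    by auto
qed

lemma negligible_inner_eq_0: "a \<noteq> 0 \<Longrightarrow> negligible {x::'a::euclidean_space. x \<bullet> a = 0}"
  using negligible_hyperplane[of a 0] by (simp add: inner_commute)

lemma measure_Un_negligible:
  fixes S T :: "'a::euclidean_space set"
  assumes "negligible (S \<inter> T)" "S \<in> lmeasurable" "T \<in> lmeasurable"
  shows "measure lebesgue (S \<union> T) = measure lebesgue S + measure lebesgue T"
  using assms by (simp add: measure_Un3 negligible_imp_measure0)

lemma measure_split_halfspace:
  fixes a :: "'a::euclidean_space"
  assumes X: "X \<in> lmeasurable" and a: "a \<noteq> 0"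
  shows "measure lebesgue X = measure lebesgue (X \<inter> {x. 0 \<le> x \<bullet> a}) + measure lebesgue (X \<inter> {x. x \<bullet> a \<le> 0})"
proof -
  have "X = (X \<inter> {x. 0 \<le> x \<bullet> a}) \<union> (X \<inter> {x. x \<bullet> a \<le> 0})" by auto
  moreover have "measure lebesgue ((X \<inter> {x. 0 \<le> x \<bullet> a}) \<union> (X \<inter> {x. x \<bullet> a \<le> 0}))
      = measure lebesgue (X \<inter> {x. 0 \<le> x \<bullet> a}) + measure lebesgue (X \<inter> {x. x \<bullet> a \<le> 0})"
  proof (rule measure_Un_negligible)
    show "negligible (X \<inter> {x. 0 \<le> x \<bullet> a} \<inter> (X \<inter> {x. x \<bullet> a \<le> 0}))"
      by (rule negligible_subset[OF negligible_inner_eq_0[OF a]]) auto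
  qed (use X in \<open>auto intro: fmeasurable_Int_fmeasurable\<close>)
  ultimately show ?thesis by simp
qed

text \<open>For \<open>s < t \<le> s + pi\<close> these are the points of \<open>B\<close> whose
  projection to the plane has polar angle between \<open>s\<close> and \<open>t\<close> or is 0.
  Beyond a half turn two half-spaces no longer cut out a sector, so angles are kept below
  \<open>pi\<close> throughout.\<close>

definition rot_wedge :: "'a::real_inner \<Rightarrow> 'a \<Rightarrow> 'a set \<Rightarrow> real \<Rightarrow> real \<Rightarrow> 'a set" where
  "rot_wedge e1 e2 B s t = B \<inter> {x. 0 \<le> x \<bullet> plane_normal e1 e2 s} \<inter> {x. x \<bullet> plane_normal e1 e2 t \<le> 0}"

context
  fixes e1 e2 :: "real^'n::{finite,wellorder}" and B :: "(real^'n::_) set"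
  assumes on: "e1 \<bullet> e1 = 1" "e2 \<bullet> e2 = 1" "e1 \<bullet> e2 = 0"
    and B: "B \<in> lmeasurable" and inv: "\<And>s. plane_rot e1 e2 s ` B \<subseteq> B"
begin

private abbreviation "wedge \<equiv> rot_wedge e1 e2 B"

lemma lmeasurable_wedge: "wedge s t \<in> lmeasurable"
  unfolding rot_wedge_def using B by (intro fmeasurable_Int_fmeasurable) auto

lemma measure_wedge_shift: "measure lebesgue (wedge s (s + t)) = measure lebesgue (wedge 0 t)"
proof -
  have "plane_rot e1 e2 s ` wedge 0 t = wedge s (s + t)"
  proof (intro equalityI subsetI)
    fix y assume "y \<in> plane_rot e1 e2 s ` wedge 0 t"
    then show "y \<in> wedge s (s + t)"
      using inv plane_rot_normal[OF on, of s _ t] plane_rot_normal[OF on, of s _ 0] by (auto simp: rot_wedge_def)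
  next
    fix y assume y: "y \<in> wedge s (s + t)"
    let ?x = "plane_rot e1 e2 (-s) y"
    have "?x \<in> wedge 0 t"
      using y inv plane_rot_normal[OF on, of "-s" y "s + t"] plane_rot_normal[OF on, of "-s" y s]
      by (auto simp: rot_wedge_def)
    then show "y \<in> plane_rot e1 e2 s ` wedge 0 t"
      using plane_rot_cancel[OF on, of s y] by (metis imageI)
  qed
  then show ?thesis
    using measure_orthogonal_image[OF orthogonal_plane_rot[OF on, of s] lmeasurable_wedge[of 0 t]] by simp
qed

lemma measure_wedge_0: "measure lebesgue (wedge 0 0) = 0"
proof -
  have "negligible (wedge 0 0)"
    by (rule negligible_subset[OF negligible_inner_eq_0[OF plane_normal_nonzero[OF on, of 0]]])
       (auto simp: rot_wedge_def)
  then show ?thesis by (rule negligible_imp_measure0)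
qed

text \<open>Three normals in a plane are dependent:
  \<open>sin a * n(a + b) = sin (a + b) * n(a) - sin b * n(0)\<close>, and below \<open>pi\<close>
  all these sines have the right sign. At \<open>a + b = pi\<close> the last normal is the negative
  of the first; this case is separate because \<open>sin a\<close> may vanish there.\<close>

lemma wedge_mono:
  assumes "0 < a" "0 \<le> b" "a + b \<le> pi" and x: "0 \<le> x \<bullet> plane_normal e1 e2 0" "x \<bullet> plane_normal e1 e2 a \<le> 0"
  shows "x \<bullet> plane_normal e1 e2 (a + b) \<le> 0"
proof (cases "a + b = pi")
  case True
  then show ?thesis using x by (simp add: plane_normal_def inner_diff_right)
next
  case False
  then have s: "0 < sin a" "0 \<le> sin (a + b)" "0 \<le> sin b"
    using assms by (auto intro!: sin_gt_zero sin_ge_zero)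
  have sb: "sin b = sin (a + b) * cos a - cos (a + b) * sin a"
    using sin_diff[of "a + b" a] by simp
  have "(x \<bullet> plane_normal e1 e2 (a + b)) * sin a
      = (x \<bullet> plane_normal e1 e2 a) * sin (a + b) - (x \<bullet> plane_normal e1 e2 0) * sin b"
    unfolding sb by (simp add: plane_normal_def inner_diff_right algebra_simps)
  also have "\<dots> \<le> 0"
    using s x mult_nonpos_nonneg[of "x \<bullet> plane_normal e1 e2 a" "sin (a + b)"]
      mult_nonneg_nonneg[of "x \<bullet> plane_normal e1 e2 0" "sin b"] by linarith
  finally show ?thesis using s by (simp add: mult_le_0_iff)
qed

lemma wedge_mono':
  assumes "0 \<le> a" "0 < b" "a + b \<le> pi" and x: "0 \<le> x \<bullet> plane_normal e1 e2 a" "x \<bullet> plane_normal e1 e2 (a + b) \<le> 0"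
  shows "0 \<le> x \<bullet> plane_normal e1 e2 0"
proof (cases "a + b = pi")
  case True
  then show ?thesis using x by (simp add: plane_normal_def inner_diff_right)
next
  case False
  then have s: "0 \<le> sin a" "0 \<le> sin (a + b)" "0 < sin b"
    using assms by (auto intro!: sin_gt_zero sin_ge_zero)
  have sb: "sin b = sin (a + b) * cos a - cos (a + b) * sin a"
    using sin_diff[of "a + b" a] by simp
  have "(x \<bullet> plane_normal e1 e2 0) * sin b
      = (x \<bullet> plane_normal e1 e2 a) * sin (a + b) - (x \<bullet> plane_normal e1 e2 (a + b)) * sin a"
    unfolding sb by (simp add: plane_normal_def inner_diff_right algebra_simps)
  moreover have "(x \<bullet> plane_normal e1 e2 a) * sin (a + b) - (x \<bullet> plane_normal e1 e2 (a + b)) * sin a \<ge> 0"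
    using s x mult_nonpos_nonneg[of "x \<bullet> plane_normal e1 e2 (a + b)" "sin a"]
      mult_nonneg_nonneg[of "x \<bullet> plane_normal e1 e2 a" "sin (a + b)"] by linarith
  ultimately have "0 \<le> (x \<bullet> plane_normal e1 e2 0) * sin b" by linarith
  then show ?thesis using s by (simp add: zero_le_mult_iff)
qed

lemma measure_wedge_add:
  assumes "0 \<le> a" "0 \<le> b" "a + b \<le> pi"
  shows "measure lebesgue (wedge 0 (a + b)) = measure lebesgue (wedge 0 a) + measure lebesgue (wedge 0 b)"
proof (cases "a = 0 \<or> b = 0")
  case True
  then show ?thesis using measure_wedge_0 by auto
next
  case False
  with assms have ab: "0 < a" "0 < b" by auto
  have "wedge 0 (a + b) = wedge 0 a \<union> wedge a (a + b)"
  proof (intro equalityI subsetI)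
    fix x assume "x \<in> wedge 0 (a + b)"
    then show "x \<in> wedge 0 a \<union> wedge a (a + b)"
      by (cases "x \<bullet> plane_normal e1 e2 a \<le> 0") (simp_all add: rot_wedge_def)
  next
    fix x assume "x \<in> wedge 0 a \<union> wedge a (a + b)"
    then show "x \<in> wedge 0 (a + b)"
      using wedge_mono[OF ab(1) less_imp_le[OF ab(2)] assms(3), of x]
        wedge_mono'[OF less_imp_le[OF ab(1)] ab(2) assms(3), of x]
      by (simp add: rot_wedge_def) blast
  qed
  moreover have "measure lebesgue (wedge 0 a \<union> wedge a (a + b)) = measure lebesgue (wedge 0 a) + measure lebesgue (wedge a (a + b))"
  proof (rule measure_Un_negligible)
    show "negligible (wedge 0 a \<inter> wedge a (a + b))"
      by (rule negligible_subset[OF negligible_inner_eq_0[OF plane_normal_nonzero[OF on, of a]]])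
         (auto simp: rot_wedge_def)
  qed (rule lmeasurable_wedge)+
  ultimately show ?thesis using measure_wedge_shift[of a b] by simp
qed

text \<open>The measure is additive in the angle up to \<open>pi\<close>, hence linear; two half
  turns make up \<open>B\<close>, which fixes the factor \<open>1 / (2 * pi)\<close>.\<close>

lemma measure_wedge:
  assumes "0 \<le> t" "t \<le> pi"
  shows "measure lebesgue (wedge 0 t) = t / (2 * pi) * measure lebesgue B"
proof -
  let ?n = "plane_normal e1 e2"
  have "measure lebesgue B = measure lebesgue (B \<inter> {x. 0 \<le> x \<bullet> ?n 0}) + measure lebesgue (B \<inter> {x. x \<bullet> ?n 0 \<le> 0})"
    by (rule measure_split_halfspace[OF B plane_normal_nonzero[OF on]])
  moreover have "B \<inter> {x. 0 \<le> x \<bullet> ?n 0} = wedge 0 pi" "B \<inter> {x. x \<bullet> ?n 0 \<le> 0} = wedge pi (pi + pi)"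
    by (auto simp: rot_wedge_def plane_normal_def inner_diff_right cos_add)
  ultimately have "measure lebesgue B = 2 * measure lebesgue (wedge 0 pi)"
    using measure_wedge_shift[of pi pi] by simp
  moreover have "measure lebesgue (wedge 0 t) = t / pi * measure lebesgue (wedge 0 pi)"
    by (rule additive_nonneg_linear[where \<phi> = "\<lambda>t. measure lebesgue (wedge 0 t)"])
       (use assms measure_wedge_add in auto)
  ultimately show ?thesis by simp
qed

end

text \<open>For an orthogonal map, having all displacements in a subspace \<open>L\<close> means
  fixing the orthogonal complement of \<open>L\<close> pointwise. Inclusion is enough, because the
  inverse map is of the same kind.\<close>

definition rot_invariant :: "'a::euclidean_space set \<Rightarrow> 'a set \<Rightarrow> bool" where
  "rot_invariant L B \<longleftrightarrow> (\<forall>f. orthogonal_transformation f \<longrightarrow> (\<forall>x. f x - x \<in> L) \<longrightarrow> f ` B \<subseteq> B)"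

context
  fixes L B :: "(real^'n::{finite,wellorder}) set"
  assumes L: "subspace L" and B: "B \<in> lmeasurable" and inv: "rot_invariant L B"
begin

text \<open>Take \<open>a\<close> as second axis and the normalised part of \<open>b\<close>
  orthogonal to \<open>a\<close> as first. The two half-spaces then bound the wedge from angle 0 to
  \<open>\<theta>\<close>, where \<open>\<theta>\<close> is \<open>pi\<close> minus the angle
  between the inner normals.\<close>

lemma measure_dihedral:
  assumes ab: "a \<in> L" "b \<in> L" "norm a = 1" "norm b = 1" and lt: "\<bar>a \<bullet> b\<bar> < 1"
  shows "measure lebesgue (B \<inter> {x. 0 \<le> x \<bullet> a} \<inter> {x. 0 \<le> x \<bullet> b})
     = arccos (- (a \<bullet> b)) / (2 * pi) * measure lebesgue B"
proof -
  define s where "s = sqrt (1 - (a \<bullet> b)\<^sup>2)"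
  have s2: "s\<^sup>2 = 1 - (a \<bullet> b)\<^sup>2" and s0: "s > 0"
    using lt by (auto simp: s_def abs_square_less_1 abs_square_le_1 less_imp_le)
  define e1 where "e1 = (1 / s) *\<^sub>R (b - (a \<bullet> b) *\<^sub>R a)"
  have aa: "a \<bullet> a = 1" "b \<bullet> b = 1" using ab by (auto simp: norm_eq_1)
  have on: "e1 \<bullet> e1 = 1" "a \<bullet> a = 1" "e1 \<bullet> a = 0"
  proof -
    have "(b - (a \<bullet> b) *\<^sub>R a) \<bullet> (b - (a \<bullet> b) *\<^sub>R a) = s\<^sup>2"
      unfolding s2 by (simp add: inner_diff_left inner_diff_right aa inner_commute[of b a] power2_eq_square)
    then show "e1 \<bullet> e1 = 1" using s0 by (simp add: e1_def power2_eq_square)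
    show "e1 \<bullet> a = 0" by (simp add: e1_def inner_diff_left aa inner_commute[of b a])
  qed (rule aa)
  have e1L: "e1 \<in> L" unfolding e1_def using L ab by (intro subspace_scale subspace_diff)
  have "plane_rot e1 a t ` B \<subseteq> B" for t
  proof -
    have "plane_rot e1 a t x - x \<in> L" for x
      unfolding plane_rot_def using L e1L ab
      by (auto simp: algebra_simps intro!: subspace_scale subspace_add subspace_diff)
    then show ?thesis
      using inv orthogonal_plane_rot[OF on] unfolding rot_invariant_def by blast
  qed
  note w = measure_wedge[OF on B this]
  define \<theta> where "\<theta> = arccos (- (a \<bullet> b))"
  have th: "0 \<le> \<theta>" "\<theta> \<le> pi" "cos \<theta> = - (a \<bullet> b)" "sin \<theta> = s"
    using lt by (auto simp: \<theta>_def arccos_lbound arccos_ubound sin_arccos s_def)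
  have "b = - plane_normal e1 a \<theta>"
    unfolding plane_normal_def th e1_def using s0 by simp
  then have "rot_wedge e1 a B 0 \<theta> = B \<inter> {x. 0 \<le> x \<bullet> a} \<inter> {x. 0 \<le> x \<bullet> b}"
    unfolding rot_wedge_def by (auto simp: plane_normal_def inner_diff_right)
  with w[OF th(1,2)] show ?thesis unfolding \<theta>_def by simp
qed

text \<open>The map \<open>- x\<close> would also flip the complement of \<open>L\<close>, where
  \<open>B\<close> need not be symmetric (later it contains a simplex). Instead \<open>f\<close>
  subtracts twice the orthogonal projection \<open>Q\<close> onto \<open>L\<close>: it negates
  \<open>L\<close> and fixes the complement.\<close>

lemma measure_antipodal:
  assumes "a \<in> L" "b \<in> L" "c \<in> L"
  shows "measure lebesgue (B \<inter> {x. 0 \<le> x \<bullet> a} \<inter> {x. 0 \<le> x \<bullet> b} \<inter> {x. 0 \<le> x \<bullet> c})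
     = measure lebesgue (B \<inter> {x. x \<bullet> a \<le> 0} \<inter> {x. x \<bullet> b \<le> 0} \<inter> {x. x \<bullet> c \<le> 0})"
proof -
  obtain E where E: "E \<subseteq> L" "pairwise orthogonal E" "\<And>x. x \<in> E \<Longrightarrow> norm x = 1" "independent E" "span E = L"
    using orthonormal_basis_subspace[OF L] by metis
  have fE: "finite E" using E(4) independent_imp_finite by blast
  define Q where "Q = (\<lambda>x. \<Sum>e\<in>E. (x \<bullet> e) *\<^sub>R e)"
  define f where "f = (\<lambda>x. x - 2 *\<^sub>R Q x)"
  have linQ: "linear Q"
    unfolding Q_def by (rule linearI) (simp_all add: inner_add_left scaleR_add_left sum.distrib scaleR_sum_right)
  have QL: "Q x \<in> L" for x
    unfolding Q_def using E(1) L by (intro subspace_sum subspace_scale) auto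
  have Qe: "Q x \<bullet> e = x \<bullet> e" if "e \<in> E" for x e
  proof -
    have "Q x \<bullet> e = (\<Sum>u\<in>E. if u = e then x \<bullet> e else 0)"
      unfolding Q_def inner_sum_left using E(2,3) that
      by (intro sum.cong) (auto simp: pairwise_def orthogonal_def norm_eq_1)
    then show ?thesis using fE that by simp
  qed
  have Ql: "Q x \<bullet> l = x \<bullet> l" if "l \<in> L" for x l
  proof -
    have "(Q x - x) \<bullet> l = 0"
      using that unfolding E(5)[symmetric]
      by (induction rule: span_induct_alt) (simp_all add: inner_add_right inner_diff_left Qe)
    then show ?thesis by (simp add: inner_diff_left)
  qed
  have fl: "f x \<bullet> l = - (x \<bullet> l)" if "l \<in> L" for x l
    using Ql[OF that, of x] by (simp add: f_def inner_diff_left)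
  have orth: "orthogonal_transformation f"
    unfolding orthogonal_transformation
  proof (intro conjI allI)
    show "linear f" unfolding f_def
      by (intro linear_compose_sub linear_compose_scale_right linQ linear_id[unfolded id_def])
    fix x
    have "f x \<bullet> f x = x \<bullet> x"
      using Ql[OF QL, of x x] by (simp add: f_def inner_diff_left inner_diff_right inner_commute)
    then show "norm (f x) = norm x" by (simp add: norm_eq_sqrt_inner)
  qed
  have ff: "f (f x) = x" for x
    unfolding f_def using Ql[OF QL] linQ
  proof -
    have "Q (Q x) = (\<Sum>e\<in>E. (Q x \<bullet> e) *\<^sub>R e)" by (subst (1) Q_def) simp
    also have "\<dots> = (\<Sum>e\<in>E. (x \<bullet> e) *\<^sub>R e)" by (simp add: Qe)
    finally have "Q (Q x) = Q x" by (simp only: Q_def)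
    then show "x - 2 *\<^sub>R Q x - 2 *\<^sub>R Q (x - 2 *\<^sub>R Q x) = x"
      using linQ by (simp add: linear_diff linear_scale)
  qed
  have fB: "f ` B \<subseteq> B"
    using inv orth QL L unfolding rot_invariant_def by (auto simp: f_def subspace_neg subspace_scale)
  let ?X = "B \<inter> {x. 0 \<le> x \<bullet> a} \<inter> {x. 0 \<le> x \<bullet> b} \<inter> {x. 0 \<le> x \<bullet> c}"
  let ?Y = "B \<inter> {x. x \<bullet> a \<le> 0} \<inter> {x. x \<bullet> b \<le> 0} \<inter> {x. x \<bullet> c \<le> 0}"
  have "f ` ?X = ?Y"
  proof (intro equalityI subsetI)
    fix y assume "y \<in> ?Y"
    then have "f y \<in> ?X" using fB fl assms by auto
    then show "y \<in> f ` ?X" using ff[of y] by (metis imageI)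
  qed (use fB fl assms in auto)
  moreover have "?X \<in> lmeasurable"
    using B by (intro fmeasurable_Int_fmeasurable) auto
  ultimately show ?thesis using measure_orthogonal_image[OF orth] by metis
qed

text \<open>Girard's theorem: the eight octants are paired by the antipodal map, and each dihedral wedge
  is a union of two octants.\<close>

lemma measure_trihedral:
  assumes L3: "a \<in> L" "b \<in> L" "c \<in> L" and n: "norm a = 1" "norm b = 1" "norm c = 1"
    and lt: "\<bar>a \<bullet> b\<bar> < 1" "\<bar>a \<bullet> c\<bar> < 1" "\<bar>b \<bullet> c\<bar> < 1"
  shows "measure lebesgue (B \<inter> {x. 0 \<le> x \<bullet> a} \<inter> {x. 0 \<le> x \<bullet> b} \<inter> {x. 0 \<le> x \<bullet> c})
     = (arccos (- (a \<bullet> b)) + arccos (- (a \<bullet> c)) + arccos (- (b \<bullet> c)) - pi) / (4 * pi) * measure lebesgue B"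
proof -
  let ?m = "measure lebesgue"
  let ?P = "\<lambda>a. {x. 0 \<le> x \<bullet> a}" let ?N = "\<lambda>a. {x. x \<bullet> a \<le> 0}"
  have nz: "a \<noteq> 0" "b \<noteq> 0" "c \<noteq> 0" using n by auto
  have meas: "X \<in> lmeasurable \<Longrightarrow> X \<inter> ?P a \<in> lmeasurable" "X \<in> lmeasurable \<Longrightarrow> X \<inter> ?N a \<in> lmeasurable" for X a
    by (auto intro: fmeasurable_Int_fmeasurable)
  note sp = measure_split_halfspace
  note mB = B meas(1)[OF B] meas(2)[OF B]
  have spc: "?m (X \<inter> ?P b) = ?m (X \<inter> ?P b \<inter> ?P c) + ?m (X \<inter> ?P b \<inter> ?N c)"
    "?m (X \<inter> ?N b) = ?m (X \<inter> ?N b \<inter> ?P c) + ?m (X \<inter> ?N b \<inter> ?N c)" if "X \<in> lmeasurable" for X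
    using sp[OF meas(1)[OF that] nz(3)] sp[OF meas(2)[OF that] nz(3)] by auto
  have neg: "?P (- u) = ?N u" "?N (- u) = ?P u" for u :: "real^'n::_" by auto
  have nL: "- a \<in> L" "- b \<in> L" "- c \<in> L" using L3 L by (auto intro: subspace_neg)
  have "?m B = ?m (B \<inter> ?P a \<inter> ?P b \<inter> ?P c) + ?m (B \<inter> ?P a \<inter> ?P b \<inter> ?N c)
    + (?m (B \<inter> ?P a \<inter> ?N b \<inter> ?P c) + ?m (B \<inter> ?P a \<inter> ?N b \<inter> ?N c))
    + (?m (B \<inter> ?N a \<inter> ?P b \<inter> ?P c) + ?m (B \<inter> ?N a \<inter> ?P b \<inter> ?N c)
    + (?m (B \<inter> ?N a \<inter> ?N b \<inter> ?P c) + ?m (B \<inter> ?N a \<inter> ?N b \<inter> ?N c)))"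
    unfolding sp[OF B nz(1)] sp[OF mB(2)[of a] nz(2)] sp[OF mB(3)[of a] nz(2)]
      spc[OF mB(2)[of a]] spc[OF mB(3)[of a]] ..
  moreover have "?m (B \<inter> ?P a \<inter> ?P b \<inter> ?P c) = ?m (B \<inter> ?N a \<inter> ?N b \<inter> ?N c)"
    using measure_antipodal[OF L3] by simp
  moreover have "?m (B \<inter> ?P a \<inter> ?P b \<inter> ?N c) = ?m (B \<inter> ?N a \<inter> ?N b \<inter> ?P c)"
    using measure_antipodal[OF L3(1,2) nL(3)] unfolding neg .
  moreover have "?m (B \<inter> ?P a \<inter> ?N b \<inter> ?P c) = ?m (B \<inter> ?N a \<inter> ?P b \<inter> ?N c)"
    using measure_antipodal[OF L3(1) nL(2) L3(3)] unfolding neg .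
  moreover have "?m (B \<inter> ?N a \<inter> ?P b \<inter> ?P c) = ?m (B \<inter> ?P a \<inter> ?N b \<inter> ?N c)"
    using measure_antipodal[OF nL(1) L3(2,3)] unfolding neg .
  moreover have "arccos (- (a \<bullet> b)) / (2 * pi) * ?m B = ?m (B \<inter> ?P a \<inter> ?P b \<inter> ?P c) + ?m (B \<inter> ?P a \<inter> ?P b \<inter> ?N c)"
    using measure_dihedral[OF L3(1,2) n(1,2) lt(1)] spc(1)[OF mB(2)[of a]] by simp
  moreover have "arccos (- (a \<bullet> c)) / (2 * pi) * ?m B = ?m (B \<inter> ?P a \<inter> ?P b \<inter> ?P c) + ?m (B \<inter> ?P a \<inter> ?N b \<inter> ?P c)"
    using measure_dihedral[OF L3(1,3) n(1,3) lt(2)] sp[OF meas(1)[OF mB(2)[of a]] nz(2), of c]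
    by (simp add: Int_ac)
  moreover have "arccos (- (b \<bullet> c)) / (2 * pi) * ?m B = ?m (B \<inter> ?P a \<inter> ?P b \<inter> ?P c) + ?m (B \<inter> ?N a \<inter> ?P b \<inter> ?P c)"
    using measure_dihedral[OF L3(2,3) n(2,3) lt(3)] sp[OF meas(1)[OF mB(2)[of b]] nz(1), of c]
    by (simp add: Int_ac)
  moreover define M where "M = ?m (B \<inter> ?P a \<inter> ?P b \<inter> ?P c)"
  \<comment> \<open>The three wedges share the octant \<open>M\<close>, and each contains one more
    octant. By the antipodal pairing these four octants make up half of \<open>B\<close>, and
    \<open>M\<close> is counted three times.\<close>
  ultimately have "arccos (- (a \<bullet> b)) / (2 * pi) * ?m B + arccos (- (a \<bullet> c)) / (2 * pi) * ?m B + arccos (- (b \<bullet> c)) / (2 * pi) * ?m B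
    = 2 * M + ?m B / 2" by linarith
  then have "2 * (2 * pi) * M = (arccos (- (a \<bullet> b)) + arccos (- (a \<bullet> c)) + arccos (- (b \<bullet> c)) - pi) * ?m B"
    by (simp add: field_simps)
  then show ?thesis unfolding M_def[symmetric] by (simp add: field_simps)
qed

end

section \<open>Isosceles spherical triangles\<close>

text \<open>L'Huilier's formula for legs \<open>\<alpha>\<close> and base \<open>\<beta>\<close>:
  half the semiperimeter is \<open>\<alpha> / 2 + \<beta> / 4\<close>, and its companions are
  \<open>\<alpha> / 2 - \<beta> / 4\<close> and twice \<open>\<beta> / 4\<close>. The arccosines are
  the base angle and the apex angle by the spherical law of cosines; \<open>ab\<close> is the
  triangle inequality and the bound on the perimeter.\<close>

lemma isosceles_spherical_excess:
  fixes \<alpha> \<beta> :: real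
  assumes a: "0 < \<alpha>" "\<alpha> < pi" and b: "0 < \<beta>" "\<beta> < pi" and ab: "\<beta> < 2 * \<alpha>" "\<beta> + 2 * \<alpha> < 2 * pi"
  defines "c \<equiv> cos \<alpha>" and "r \<equiv> cos \<beta>"
  shows "2 * arccos (c * (1 - r) / sqrt ((1 - c\<^sup>2) * (1 - r\<^sup>2))) + arccos ((r - c\<^sup>2) / (1 - c\<^sup>2)) - pi
       = 4 * arctan (sqrt (tan (\<alpha> / 2 + \<beta> / 4) * tan (\<alpha> / 2 - \<beta> / 4) * tan (\<beta> / 4) ^ 2))"
proof -
  \<comment> \<open>The altitude halves the triangle into right triangles with hypotenuse
    \<open>\<alpha>\<close> and leg \<open>\<beta> / 2\<close>; all angle functions become rational
    in \<open>c\<close>, \<open>g\<close>, \<open>h\<close>, \<open>k\<close>,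
    \<open>s\<close>.\<close>
  define g where "g = cos (\<beta> / 2)"
  define k where "k = sqrt (g\<^sup>2 - c\<^sup>2)"
  define h where "h = sin (\<beta> / 2)"
  define s where "s = sin \<alpha>"
  have g0: "0 < g" unfolding g_def by (rule cos_gt_zero_pi) (use b in auto)
  have h0: "0 < h" unfolding h_def by (rule sin_gt_zero) (use b in auto)
  have s0: "0 < s" unfolding s_def by (rule sin_gt_zero) (use a in auto)
  have h2: "h\<^sup>2 = 1 - g\<^sup>2" unfolding h_def g_def by (simp add: sin_squared_eq)
  have s2: "s\<^sup>2 = 1 - c\<^sup>2" unfolding s_def c_def by (simp add: sin_squared_eq)
  have r: "r = 2 * g\<^sup>2 - 1" unfolding r_def g_def using cos_double_cos[of "\<beta> / 2"] by simp
  have "c < g" unfolding c_def g_def by (rule cos_monotone_0_pi) (use a b ab in auto)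
  moreover have "- g < c"
  proof -
    have "cos (pi - \<beta> / 2) < cos \<alpha>" by (rule cos_monotone_0_pi) (use a b ab in auto)
    then show ?thesis by (simp add: c_def g_def)
  qed
  ultimately have "\<bar>c\<bar> < \<bar>g\<bar>" using g0 by linarith
  then have cg: "c\<^sup>2 < g\<^sup>2" by (metis abs_le_square_iff not_le)
  have k0: "0 < k" and k2: "k\<^sup>2 = g\<^sup>2 - c\<^sup>2" using cg by (auto simp: k_def)
  define A where "A = arccos (c * (1 - r) / sqrt ((1 - c\<^sup>2) * (1 - r\<^sup>2)))"
  define C where "C = arccos ((r - c\<^sup>2) / (1 - c\<^sup>2))"
  have "(1 - c\<^sup>2) * (1 - r\<^sup>2) = (2 * h * g * s)\<^sup>2"
    unfolding r power_mult_distrib h2 s2 by algebra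
  then have sq: "sqrt ((1 - c\<^sup>2) * (1 - r\<^sup>2)) = 2 * h * g * s"
    using g0 h0 s0 by simp
  have A1: "c * (1 - r) / sqrt ((1 - c\<^sup>2) * (1 - r\<^sup>2)) = c * h / (g * s)"
  proof -
    have hr: "1 - r = 2 * h * h" using h2 by (simp add: r power2_eq_square)
    show ?thesis unfolding sq hr using g0 h0 s0 by simp
  qed
  have AA: "1 - (c * h / (g * s))\<^sup>2 = (k / (g * s))\<^sup>2"
  proof -
    have "(g * s)\<^sup>2 - (c * h)\<^sup>2 = k\<^sup>2" unfolding power_mult_distrib h2 s2 k2 by algebra
    moreover have "1 - (c * h / (g * s))\<^sup>2 = ((g * s)\<^sup>2 - (c * h)\<^sup>2) / (g * s)\<^sup>2"
      using g0 s0 by (simp add: power_divide diff_divide_distrib)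
    ultimately show ?thesis by (simp add: power_divide)
  qed
  have "(c * h / (g * s))\<^sup>2 \<le> 1" using AA zero_le_power2[of "k / (g * s)"] by linarith
  then have ab1: "\<bar>c * h / (g * s)\<bar> \<le> 1" by (simp add: abs_square_le_1)
  then have cosA: "cos A = c * h / (g * s)" unfolding A_def A1 by (intro cos_arccos_abs)
  have sinA: "sin A = k / (g * s)"
    unfolding A_def A1 using ab1 g0 s0 k0 by (subst sin_arccos_abs) (simp_all only: AA real_sqrt_abs, simp)
  have A0: "0 \<le> A" "A \<le> pi" unfolding A_def A1
    by (rule arccos_lbound arccos_ubound; use ab1 in linarith)+
  have cC: "- 1 \<le> (r - c\<^sup>2) / (1 - c\<^sup>2)" "(r - c\<^sup>2) / (1 - c\<^sup>2) \<le> 1"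
    using cg h2 s2 zero_less_power[OF s0, of 2] zero_less_power[OF h0, of 2]
    by (simp_all add: r pos_le_divide_eq pos_divide_le_eq)
  have C0: "0 \<le> C" "C \<le> pi" using cC by (auto simp: C_def arccos_lbound arccos_ubound)
  have cosC: "cos C = (r - c\<^sup>2) / (1 - c\<^sup>2)" using cC by (simp add: C_def cos_arccos)
  have cosC2: "cos (C / 2) = k / s"
  proof -
    have "2 * (cos (C / 2))\<^sup>2 = 1 + cos C" using cos_double_cos[of "C / 2"] by simp
    also have "\<dots> = 2 * (k / s)\<^sup>2" using s0 zero_less_power[OF s0, of 2] unfolding cosC r power_divide k2 s2
      by (simp add: field_simps)
    finally have "(cos (C / 2))\<^sup>2 = (k / s)\<^sup>2" by simp
    moreover have "0 \<le> cos (C / 2)" by (rule cos_ge_zero) (use C0 in auto)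
    ultimately show ?thesis using k0 s0 by (simp add: power2_eq_iff_nonneg)
  qed
  have sinC2: "sin (C / 2) = h / s"
  proof -
    have "(sin (C / 2))\<^sup>2 = (h / s)\<^sup>2"
      using zero_less_power[OF s0, of 2] unfolding sin_squared_eq cosC2 power_divide k2 s2 h2
      by (simp add: field_simps)
    moreover have "0 \<le> sin (C / 2)" by (rule sin_ge_zero) (use C0 in auto)
    ultimately show ?thesis using h0 s0 by (simp add: power2_eq_iff_nonneg)
  qed
  \<comment> \<open>Half the spherical excess. It lies in \<open>[0, pi]\<close>, as does twice the
    arctangent \<open>\<theta>\<close> below, so equality of cosines suffices.\<close>
  define E where "E = A + C / 2 - pi / 2"
  have c1: "1 + c > 0" "1 - c > 0" 
    using s0 s2 zero_less_power[OF s0, of 2] by (auto simp: abs_square_less_1)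
  have cosE: "cos E = (c + g\<^sup>2) / ((1 + c) * g)"
  proof -
    have "cos E = sin (A + C / 2)" by (simp add: E_def cos_diff)
    also have "\<dots> = (k\<^sup>2 + c * h\<^sup>2) / (g * s\<^sup>2)"
      unfolding sin_add sinA cosA cosC2 sinC2 using g0 s0 by (simp add: field_simps power2_eq_square)
    also have "\<dots> = ((c + g\<^sup>2) * (1 - c)) / (((1 + c) * g) * (1 - c))"
      unfolding k2 h2 s2 by (simp add: algebra_simps power2_eq_square)
    also have "\<dots> = (c + g\<^sup>2) / ((1 + c) * g)" using c1 by simp
    finally show ?thesis .
  qed
  have sinE: "sin E \<ge> 0"
  proof -
    have "sin E = - cos (A + C / 2)" by (simp add: E_def sin_diff)
    also have "\<dots> = k * h * (1 - c) / (g * s\<^sup>2)"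
      unfolding cos_add sinA cosA cosC2 sinC2 using g0 s0 by (simp add: field_simps power2_eq_square)
    finally show ?thesis using k0 h0 c1 g0 s0 by simp
  qed
  have E0: "0 \<le> E"
  proof (rule ccontr)
    assume "\<not> 0 \<le> E"
    moreover have "- (pi / 2) \<le> E" using A0 C0 by (simp add: E_def)
    ultimately have "0 < sin (- E)" by (intro sin_gt_zero) (use pi_gt_zero in auto)
    then show False using sinE by simp
  qed
  have Epi: "E \<le> pi" using A0 C0 by (simp add: E_def)
  define Y where "Y = tan (\<alpha> / 2 + \<beta> / 4) * tan (\<alpha> / 2 - \<beta> / 4) * tan (\<beta> / 4) ^ 2"
  have Ypos: "0 < Y" unfolding Y_def
    by (intro mult_pos_pos zero_less_power tan_gt_zero) (use a b ab in auto)
  \<comment> \<open>In \<open>q\<close> and \<open>u\<close> the numerator and denominator of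
    \<open>Y\<close> are polynomials, and \<open>cos (2 * \<theta>) = (1 - Y) / (1 + Y)\<close>
    turns into the rational expression for \<open>cos E\<close>.\<close>
  define q where "q = (cos (\<alpha> / 2))\<^sup>2"
  define u where "u = (sin (\<beta> / 4))\<^sup>2"
  have q: "2 * q = 1 + c" unfolding q_def c_def using cos_double_cos[of "\<alpha> / 2"] by simp
  have u: "1 - 2 * u = g" unfolding u_def g_def using cos_double_sin[of "\<beta> / 4"] by simp
  have cospos: "0 < cos (\<alpha> / 2 + \<beta> / 4)" "0 < cos (\<alpha> / 2 - \<beta> / 4)" "0 < cos (\<beta> / 4)"
    by (rule cos_gt_zero_pi; use a b ab in auto)+
  have ss: "sin (\<alpha> / 2 + \<beta> / 4) * sin (\<alpha> / 2 - \<beta> / 4) = 1 - q - u"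
  proof -
    have "sin (\<alpha> / 2 + \<beta> / 4) * sin (\<alpha> / 2 - \<beta> / 4)
        = (sin (\<alpha> / 2))\<^sup>2 * (cos (\<beta> / 4))\<^sup>2 - (cos (\<alpha> / 2))\<^sup>2 * (sin (\<beta> / 4))\<^sup>2"
      by (simp add: sin_add sin_diff algebra_simps power2_eq_square)
    also have "\<dots> = (1 - q) * (1 - u) - q * u" unfolding q_def u_def sin_squared_eq[of "\<alpha> / 2"] cos_squared_eq[of "\<beta> / 4"] by simp
    finally show ?thesis by (simp add: algebra_simps)
  qed
  have cc: "cos (\<alpha> / 2 + \<beta> / 4) * cos (\<alpha> / 2 - \<beta> / 4) = q - u"
  proof -
    have "cos (\<alpha> / 2 + \<beta> / 4) * cos (\<alpha> / 2 - \<beta> / 4)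
        = (cos (\<alpha> / 2))\<^sup>2 * (cos (\<beta> / 4))\<^sup>2 - (sin (\<alpha> / 2))\<^sup>2 * (sin (\<beta> / 4))\<^sup>2"
      by (simp add: cos_add cos_diff algebra_simps power2_eq_square)
    also have "\<dots> = q * (1 - u) - (1 - q) * u" unfolding q_def u_def sin_squared_eq[of "\<alpha> / 2"] cos_squared_eq[of "\<beta> / 4"] by simp
    finally show ?thesis by (simp add: algebra_simps)
  qed
  have qu: "0 < q - u" unfolding cc[symmetric] using cospos by simp
  have u1: "0 < 1 - u" using cospos(3) by (simp add: u_def flip: cos_squared_eq)
  have Yq: "Y = ((1 - q - u) * u) / ((q - u) * (1 - u))"
  proof -
    have "Y = (sin (\<alpha> / 2 + \<beta> / 4) * sin (\<alpha> / 2 - \<beta> / 4) * (sin (\<beta> / 4))\<^sup>2)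
        / (cos (\<alpha> / 2 + \<beta> / 4) * cos (\<alpha> / 2 - \<beta> / 4) * (cos (\<beta> / 4))\<^sup>2)"
      by (simp add: Y_def tan_def power_divide)
    then show ?thesis unfolding ss cc cos_squared_eq u_def[symmetric] .
  qed
  have den: "(q - u) * (1 - u) + (1 - q - u) * u = q * g" unfolding u[symmetric] by (simp add: algebra_simps)
  have q0: "0 < q" using q c1 by simp
  define \<theta> where "\<theta> = arctan (sqrt Y)"
  have th: "0 \<le> \<theta>" "2 * \<theta> \<le> pi"
    using Ypos arctan_ubound[of "sqrt Y"] by (auto simp: \<theta>_def)
  have "cos (2 * \<theta>) = 2 / (1 + Y) - 1"
    unfolding cos_double_cos \<theta>_def cos_arctan using Ypos by (simp add: power_divide)
  also have "\<dots> = (1 - Y) / (1 + Y)" using Ypos by (simp add: field_simps)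
  also have "\<dots> = ((q - u) * (1 - u) - (1 - q - u) * u) / ((q - u) * (1 - u) + (1 - q - u) * u)"
    unfolding Yq using qu u1 by (simp add: divide_simps den[unfolded] g0 q0)
  also have "\<dots> = (q - 2 * u * (1 - u)) / (q * g)" unfolding den by (simp add: algebra_simps)
  also have "\<dots> = (2 * q - 4 * u * (1 - u)) / (2 * q * g)"
    using q0 g0 by (simp add: field_simps)
  also have "4 * u * (1 - u) = 1 - g\<^sup>2" unfolding u[symmetric] by (simp add: algebra_simps power2_eq_square)
  finally have "cos (2 * \<theta>) = cos E" unfolding cosE q by simp
  then have "2 * \<theta> = E"
    using th E0 Epi by (rule_tac cos_inj_pi) auto
  then show ?thesis
    unfolding E_def \<theta>_def A_def C_def Y_def by simp
qed

text \<open>The half-space normals are the normalised dual basis of \<open>y1\<close>,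
  \<open>y2\<close>, \<open>y3\<close>; their mutual angles are \<open>pi\<close> minus the angles
  of the spherical triangle. The cone is given by signs of coefficients on \<open>L\<close> and by
  half-spaces on \<open>B\<close>, because \<open>B\<close> also extends in directions outside
  \<open>L\<close>.\<close>

lemma measure_isosceles_cone:
  fixes L B :: "(real^'n::{finite,wellorder}) set"
  assumes L: "subspace L" and B: "B \<in> lmeasurable" and inv: "rot_invariant L B"
    and a: "0 < \<alpha>" "\<alpha> < pi" and b: "0 < \<beta>" "\<beta> < pi" and ab: "\<beta> < 2 * \<alpha>" "\<beta> + 2 * \<alpha> < 2 * pi"
    and y: "y1 \<in> L" "y2 \<in> L" "y3 \<in> L" "y1 \<bullet> y1 = 1" "y2 \<bullet> y2 = 1" "y3 \<bullet> y3 = 1"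
    and yy: "y1 \<bullet> y2 = cos \<alpha>" "y2 \<bullet> y3 = cos \<alpha>" "y1 \<bullet> y3 = cos \<beta>"
  obtains n1 n2 n3 where "n1 \<in> L" "n2 \<in> L" "n3 \<in> L"
    "\<And>t1 t2 t3. 0 \<le> (t1 *\<^sub>R y1 + t2 *\<^sub>R y2 + t3 *\<^sub>R y3) \<bullet> n1 \<longleftrightarrow> 0 \<le> t1"
    "\<And>t1 t2 t3. 0 \<le> (t1 *\<^sub>R y1 + t2 *\<^sub>R y2 + t3 *\<^sub>R y3) \<bullet> n2 \<longleftrightarrow> 0 \<le> t2"
    "\<And>t1 t2 t3. 0 \<le> (t1 *\<^sub>R y1 + t2 *\<^sub>R y2 + t3 *\<^sub>R y3) \<bullet> n3 \<longleftrightarrow> 0 \<le> t3"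
    "measure lebesgue (B \<inter> {x. 0 \<le> x \<bullet> n1} \<inter> {x. 0 \<le> x \<bullet> n2} \<inter> {x. 0 \<le> x \<bullet> n3})
      = arctan (sqrt (tan (\<alpha> / 2 + \<beta> / 4) * tan (\<alpha> / 2 - \<beta> / 4) * tan (\<beta> / 4) ^ 2)) / pi * measure lebesgue B"
proof -
  define c where "c = cos \<alpha>"
  define r where "r = cos \<beta>"
  have r1: "r < 1" "- 1 < r" 
    using cos_monotone_0_pi[of 0 \<beta>] cos_monotone_0_pi[of \<beta> pi] b by (auto simp: r_def)
  have c1: "c < 1" "- 1 < c"
    using cos_monotone_0_pi[of 0 \<alpha>] cos_monotone_0_pi[of \<alpha> pi] a by (auto simp: c_def)
  have c2: "c\<^sup>2 < 1" using c1 by (simp add: abs_square_less_1)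
  have r2: "r\<^sup>2 < 1" using r1 by (simp add: abs_square_less_1)
  \<comment> \<open>Positivity of the Gram determinant amounts to
    \<open>\<bar>cos \<alpha>\<bar> < cos (\<beta> / 2)\<close>, which expresses the triangle
    inequality and the perimeter bound.\<close>
  have det: "0 < 1 + r - 2 * c\<^sup>2"
  proof -
    have "cos \<alpha> < cos (\<beta> / 2)" by (rule cos_monotone_0_pi) (use a b ab in auto)
    moreover have "cos (pi - \<beta> / 2) < cos \<alpha>" by (rule cos_monotone_0_pi) (use a b ab in auto)
    ultimately have "\<bar>c\<bar> < \<bar>cos (\<beta> / 2)\<bar>" by (simp add: c_def)
    then have "c\<^sup>2 < (cos (\<beta> / 2))\<^sup>2" by (metis abs_le_square_iff not_le)
    then show ?thesis using cos_double_cos[of "\<beta> / 2"] by (simp add: r_def)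
  qed
  define \<Delta> where "\<Delta> = (1 - r) * (1 + r - 2 * c\<^sup>2)"
  have D0: "\<Delta> > 0" using det r1 by (simp add: \<Delta>_def)
  \<comment> \<open>The coefficients are the rows of the adjugate of the Gram matrix of the
    \<open>y\<close>'s, and \<open>\<Delta>\<close> is its determinant; so the \<open>m\<close>'s
    are the dual basis scaled by \<open>\<Delta>\<close>.\<close>
  define m1 where "m1 = (1 - c\<^sup>2) *\<^sub>R y1 - (c * (1 - r)) *\<^sub>R y2 + (c\<^sup>2 - r) *\<^sub>R y3"
  define m2 where "m2 = (1 - r\<^sup>2) *\<^sub>R y2 - (c * (1 - r)) *\<^sub>R y1 - (c * (1 - r)) *\<^sub>R y3"
  define m3 where "m3 = (1 - c\<^sup>2) *\<^sub>R y3 - (c * (1 - r)) *\<^sub>R y2 + (c\<^sup>2 - r) *\<^sub>R y1"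
  have y': "y1 \<bullet> y2 = c" "y2 \<bullet> y1 = c" "y2 \<bullet> y3 = c" "y3 \<bullet> y2 = c" "y1 \<bullet> y3 = r" "y3 \<bullet> y1 = r"
    using yy by (simp_all add: c_def r_def inner_commute)
  note ex = inner_add_left inner_add_right inner_diff_left inner_diff_right inner_scaleR_left inner_scaleR_right y' y(4,5,6)
  have dual: "(t1 *\<^sub>R y1 + t2 *\<^sub>R y2 + t3 *\<^sub>R y3) \<bullet> m1 = t1 * \<Delta>"
    "(t1 *\<^sub>R y1 + t2 *\<^sub>R y2 + t3 *\<^sub>R y3) \<bullet> m2 = t2 * \<Delta>"
    "(t1 *\<^sub>R y1 + t2 *\<^sub>R y2 + t3 *\<^sub>R y3) \<bullet> m3 = t3 * \<Delta>" for t1 t2 t3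
    unfolding m1_def m2_def m3_def \<Delta>_def ex by algebra+
  have gram: "m1 \<bullet> m1 = (1 - c\<^sup>2) * \<Delta>" "m2 \<bullet> m2 = (1 - r\<^sup>2) * \<Delta>" "m3 \<bullet> m3 = (1 - c\<^sup>2) * \<Delta>"
    "m1 \<bullet> m2 = - (c * (1 - r)) * \<Delta>" "m2 \<bullet> m3 = - (c * (1 - r)) * \<Delta>" "m1 \<bullet> m3 = (c\<^sup>2 - r) * \<Delta>"
    unfolding m1_def m2_def m3_def \<Delta>_def ex by algebra+
  define N1 where "N1 = sqrt ((1 - c\<^sup>2) * \<Delta>)"
  define N2 where "N2 = sqrt ((1 - r\<^sup>2) * \<Delta>)"
  have N0: "N1 > 0" "N2 > 0" using c2 r2 D0 by (auto simp: N1_def N2_def)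
  have N11: "N1 * N1 = (1 - c\<^sup>2) * \<Delta>" using c2 D0 by (simp add: N1_def)
  have N12: "N1 * N2 = sqrt ((1 - c\<^sup>2) * (1 - r\<^sup>2)) * \<Delta>"
    using D0 by (simp add: N1_def N2_def real_sqrt_mult)
  have nm: "norm m1 = N1" "norm m2 = N2" "norm m3 = N1"
    by (simp_all add: norm_eq_sqrt_inner gram N1_def N2_def)
  define n1 where "n1 = (1 / N1) *\<^sub>R m1"
  define n2 where "n2 = (1 / N2) *\<^sub>R m2"
  define n3 where "n3 = (1 / N1) *\<^sub>R m3"
  have nL: "n1 \<in> L" "n2 \<in> L" "n3 \<in> L"
    unfolding n1_def n2_def n3_def m1_def m2_def m3_def
    using L y(1-3) by (auto intro!: subspace_scale subspace_add subspace_diff)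
  have n1: "norm n1 = 1" "norm n2 = 1" "norm n3 = 1"
    using N0 by (simp_all add: n1_def n2_def n3_def nm)
  let ?A = "c * (1 - r) / sqrt ((1 - c\<^sup>2) * (1 - r\<^sup>2))"
  let ?C = "(r - c\<^sup>2) / (1 - c\<^sup>2)"
  have i12: "n1 \<bullet> n2 = - ?A" 
  proof -
    have "n1 \<bullet> n2 = - (c * (1 - r)) * \<Delta> / (N1 * N2)"
      by (simp add: n1_def n2_def gram)
    then show ?thesis unfolding N12 using D0 by simp
  qed
  have i23: "n2 \<bullet> n3 = - ?A"
  proof -
    have "n2 \<bullet> n3 = - (c * (1 - r)) * \<Delta> / (N1 * N2)"
      by (simp add: n3_def n2_def gram)
    then show ?thesis unfolding N12 using D0 by simp
  qed
  have i13: "n1 \<bullet> n3 = - ?C"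
  proof -
    have "n1 \<bullet> n3 = (c\<^sup>2 - r) * \<Delta> / (N1 * N1)"
      by (simp add: n3_def n1_def gram)
    then show ?thesis unfolding N11 using D0 by (simp add: minus_divide_left)
  qed
  have A1: "\<bar>?A\<bar> < 1"
  proof -
    have p: "0 < (1 - c\<^sup>2) * (1 - r\<^sup>2)" using c2 r2 by simp
    have "(1 - c\<^sup>2) * (1 - r\<^sup>2) - (c * (1 - r))\<^sup>2 = \<Delta>"
      unfolding \<Delta>_def by algebra
    then have "(c * (1 - r))\<^sup>2 < (1 - c\<^sup>2) * (1 - r\<^sup>2)" using D0 by linarith
    then have "?A\<^sup>2 < 1" using p by (simp add: power_divide)
    then show ?thesis by (simp add: abs_square_less_1)
  qed
  have C1: "\<bar>?C\<bar> < 1"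
    using det c2 r1 by (auto simp: abs_less_iff field_simps)
  have "measure lebesgue (B \<inter> {x. 0 \<le> x \<bullet> n1} \<inter> {x. 0 \<le> x \<bullet> n2} \<inter> {x. 0 \<le> x \<bullet> n3})
     = (arccos (- (n1 \<bullet> n2)) + arccos (- (n1 \<bullet> n3)) + arccos (- (n2 \<bullet> n3)) - pi) / (4 * pi) * measure lebesgue B"
    by (rule measure_trihedral[OF L B inv nL n1]) (use A1 C1 in \<open>auto simp: i12 i13 i23\<close>)
  also have "arccos (- (n1 \<bullet> n2)) + arccos (- (n1 \<bullet> n3)) + arccos (- (n2 \<bullet> n3)) - pi
     = 4 * arctan (sqrt (tan (\<alpha> / 2 + \<beta> / 4) * tan (\<alpha> / 2 - \<beta> / 4) * tan (\<beta> / 4) ^ 2))"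
    using isosceles_spherical_excess[OF a b ab] by (simp add: i12 i13 i23 c_def r_def)
  finally have "measure lebesgue (B \<inter> {x. 0 \<le> x \<bullet> n1} \<inter> {x. 0 \<le> x \<bullet> n2} \<inter> {x. 0 \<le> x \<bullet> n3})
      = arctan (sqrt (tan (\<alpha> / 2 + \<beta> / 4) * tan (\<alpha> / 2 - \<beta> / 4) * tan (\<beta> / 4) ^ 2)) / pi * measure lebesgue B"
    by simp
  moreover have "0 \<le> (t1 *\<^sub>R y1 + t2 *\<^sub>R y2 + t3 *\<^sub>R y3) \<bullet> n1 \<longleftrightarrow> 0 \<le> t1"
    "0 \<le> (t1 *\<^sub>R y1 + t2 *\<^sub>R y2 + t3 *\<^sub>R y3) \<bullet> n2 \<longleftrightarrow> 0 \<le> t2"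
    "0 \<le> (t1 *\<^sub>R y1 + t2 *\<^sub>R y2 + t3 *\<^sub>R y3) \<bullet> n3 \<longleftrightarrow> 0 \<le> t3" for t1 t2 t3
    unfolding n1_def n2_def n3_def inner_scaleR_right dual using N0 D0 by (simp_all add: zero_le_mult_iff zero_le_divide_iff)
  ultimately show thesis using that nL by blast
qed

text \<open>The dual basis again: its normalised vectors have inner product
  \<open>- cos \<alpha>\<close>, so the dihedral angle is \<open>\<alpha>\<close> itself.\<close>

lemma measure_planar_cone:
  fixes L B :: "(real^'n::{finite,wellorder}) set"
  assumes L: "subspace L" and B: "B \<in> lmeasurable" and inv: "rot_invariant L B"
    and a: "0 < \<alpha>" "\<alpha> < pi"
    and y: "y1 \<in> L" "y2 \<in> L" "y1 \<bullet> y1 = 1" "y2 \<bullet> y2 = 1" and yy: "y1 \<bullet> y2 = cos \<alpha>"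
  obtains n1 n2 where "n1 \<in> L" "n2 \<in> L"
    "\<And>t1 t2. 0 \<le> (t1 *\<^sub>R y1 + t2 *\<^sub>R y2) \<bullet> n1 \<longleftrightarrow> 0 \<le> t1"
    "\<And>t1 t2. 0 \<le> (t1 *\<^sub>R y1 + t2 *\<^sub>R y2) \<bullet> n2 \<longleftrightarrow> 0 \<le> t2"
    "measure lebesgue (B \<inter> {x. 0 \<le> x \<bullet> n1} \<inter> {x. 0 \<le> x \<bullet> n2}) = \<alpha> / (2 * pi) * measure lebesgue B"
proof -
  define s where "s = sin \<alpha>"
  define c where "c = cos \<alpha>"
  have s0: "0 < s" unfolding s_def by (rule sin_gt_zero) (use a in auto)
  have s2: "s\<^sup>2 = 1 - c\<^sup>2" unfolding s_def c_def by (simp add: sin_squared_eq)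
  define n1 where "n1 = (1 / s) *\<^sub>R (y1 - c *\<^sub>R y2)"
  define n2 where "n2 = (1 / s) *\<^sub>R (y2 - c *\<^sub>R y1)"
  have y': "y1 \<bullet> y2 = c" "y2 \<bullet> y1 = c" using yy by (simp_all add: c_def inner_commute)
  note ex = inner_add_left inner_add_right inner_diff_left inner_diff_right inner_scaleR_left inner_scaleR_right y' y(3,4)
  have g: "(y1 - c *\<^sub>R y2) \<bullet> (y1 - c *\<^sub>R y2) = s\<^sup>2" "(y2 - c *\<^sub>R y1) \<bullet> (y2 - c *\<^sub>R y1) = s\<^sup>2"
    "(y1 - c *\<^sub>R y2) \<bullet> (y2 - c *\<^sub>R y1) = - c * s\<^sup>2"
    unfolding s2 ex by algebra+
  have dual: "(t1 *\<^sub>R y1 + t2 *\<^sub>R y2) \<bullet> (y1 - c *\<^sub>R y2) = t1 * s\<^sup>2"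
    "(t1 *\<^sub>R y1 + t2 *\<^sub>R y2) \<bullet> (y2 - c *\<^sub>R y1) = t2 * s\<^sup>2" for t1 t2
    unfolding s2 ex by algebra+
  have nL: "n1 \<in> L" "n2 \<in> L"
    unfolding n1_def n2_def using L y(1,2) by (auto intro!: subspace_scale subspace_diff)
  have n: "norm n1 = 1" "norm n2 = 1" "n1 \<bullet> n2 = - c"
    using s0 by (simp_all add: n1_def n2_def norm_eq_sqrt_inner g power2_eq_square)
  have "\<bar>- c\<bar> < 1"
    using cos_monotone_0_pi[of 0 \<alpha>] cos_monotone_0_pi[of \<alpha> pi] a by (auto simp: c_def abs_less_iff)
  then have "measure lebesgue (B \<inter> {x. 0 \<le> x \<bullet> n1} \<inter> {x. 0 \<le> x \<bullet> n2}) = \<alpha> / (2 * pi) * measure lebesgue B"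
    using measure_dihedral[OF L B inv nL n(1,2)] a by (simp add: n c_def arccos_cos)
  moreover have "0 \<le> (t1 *\<^sub>R y1 + t2 *\<^sub>R y2) \<bullet> n1 \<longleftrightarrow> 0 \<le> t1" "0 \<le> (t1 *\<^sub>R y1 + t2 *\<^sub>R y2) \<bullet> n2 \<longleftrightarrow> 0 \<le> t2" for t1 t2
    unfolding n1_def n2_def inner_scaleR_right dual using s0 by (simp_all add: zero_le_mult_iff zero_le_divide_iff)
  ultimately show thesis using that nL by blast
qed

section \<open>Determinants by orthogonalisation\<close>

text \<open>Rows are replaced one at a time from the highest rank downwards. When row
  \<open>i\<close> changes, all rows of lower rank are still the original ones, so a combination of
  other rows is added.\<close>

lemma det_gram_schmidt_inj:
  fixes w u :: "'n::finite \<Rightarrow> real^'n" and rk :: "'n \<Rightarrow> nat"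
  assumes inj: "inj rk" and sp: "\<And>i. u i - w i \<in> span (w ` {j. rk j < rk i})"
  shows "det (\<chi> i. u i) = det (\<chi> i. w i)"
proof -
  define W where "W = (\<lambda>m. \<chi> i. if m \<le> rk i then u i else w i)"
  have step: "det (W m) = det (W (Suc m))" for m
  proof (cases "m \<in> range rk")
    case False
    then have "m \<noteq> rk i" for i by blast
    then have "m \<le> rk i \<longleftrightarrow> Suc m \<le> rk i" for i by (simp add: Suc_le_eq less_le)
    then show ?thesis by (simp add: W_def)
  next
    case True
    then obtain i where i: "rk i = m" by auto
    have row: "row k (W (Suc m)) = (if Suc m \<le> rk k then u k else w k)" for k
      by (simp add: W_def row_def vec_eq_iff)
    have "w ` {j. rk j < rk i} \<subseteq> {row j (W (Suc m)) | j. j \<noteq> i}"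
    proof
      fix x assume "x \<in> w ` {j. rk j < rk i}"
      then obtain j where j: "x = w j" "rk j < rk i" by auto
      then have "x = row j (W (Suc m))" "j \<noteq> i" using i by (auto simp: row)
      then show "x \<in> {row j (W (Suc m)) | j. j \<noteq> i}" by blast
    qed
    then have "u i - w i \<in> vec.span {row j (W (Suc m)) | j. j \<noteq> i}"
      using sp[of i] span_mono unfolding span_vec_eq by blast
    from det_row_span[OF this]
    have "det (\<chi> k. if k = i then row i (W (Suc m)) + (u i - w i) else row k (W (Suc m))) = det (W (Suc m))" .
    moreover have "(\<chi> k. if k = i then row i (W (Suc m)) + (u i - w i) else row k (W (Suc m))) = W m"
    proof -
      have "m \<le> rk k \<longleftrightarrow> Suc m \<le> rk k" if "k \<noteq> i" for k
        using injD[OF inj, of k i] that i by (auto simp: Suc_le_eq less_le)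
      then show ?thesis unfolding row using i by (auto simp: W_def vec_eq_iff)
    qed
    ultimately show ?thesis by simp
  qed
  have "det (W 0) = det (W m)" for m by (induction m) (simp, metis step)
  moreover have "W (Suc (Max (range rk))) = (\<chi> i. w i)"
  proof -
    have "\<not> Suc (Max (range rk)) \<le> rk i" for i by (simp add: not_le less_Suc_eq_le)
    then show ?thesis by (simp add: W_def)
  qed
  moreover have "W 0 = (\<chi> i. u i)" by (simp add: W_def)
  ultimately show ?thesis by metis
qed

text \<open>Equal ranks are broken by an arbitrary numbering \<open>f\<close>. Ties do occur later,
  where the rank of a vertex is its position in its column and all columns are treated at
  once.\<close>

lemma det_gram_schmidt:
  fixes w u :: "'n::finite \<Rightarrow> real^'n" and rk :: "'n \<Rightarrow> nat"
  assumes sp: "\<And>i. u i - w i \<in> span (w ` {j. rk j < rk i})"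
  shows "det (\<chi> i. u i) = det (\<chi> i. w i)"
proof -
  obtain f :: "'n \<Rightarrow> nat" and n where f: "f ` UNIV = {i. i < n}" "inj f"
    using finite_imp_inj_to_nat_seg[of "UNIV :: 'n set"] by auto
  have fn: "f i < n" for i using f(1) by auto
  define rk' where "rk' = (\<lambda>i. rk i * n + f i)"
  have less: "rk' j < rk' i" if "rk j < rk i" for i j
  proof -
    have "rk' j < (rk j + 1) * n" using fn[of j] by (simp add: rk'_def)
    also have "\<dots> \<le> rk i * n" using that by (intro mult_right_mono) auto
    finally show ?thesis by (simp add: rk'_def)
  qed
  show ?thesis
  proof (rule det_gram_schmidt_inj[of rk'])
    show "inj rk'"
    proof (rule injI)
      fix i j assume "rk' i = rk' j"
      then have "rk' i mod n = rk' j mod n" by simp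
      then show "i = j" using fn[of i] fn[of j] f(2) by (simp add: rk'_def inj_eq)
    qed
    show "u i - w i \<in> span (w ` {j. rk' j < rk' i})" for i
      using sp[of i] less span_mono[of "w ` {j. rk j < rk i}" "w ` {j. rk' j < rk' i}"] by auto
  qed
qed

lemma det_orthogonal_rows:
  fixes w :: "'n::finite \<Rightarrow> real^'n"
  assumes "\<And>i j. i \<noteq> j \<Longrightarrow> w i \<bullet> w j = 0"
  shows "(det (\<chi> i. w i))\<^sup>2 = (\<Prod>i\<in>UNIV. w i \<bullet> w i)"
proof -
  let ?A = "(\<chi> i. w i) :: real^'n^'n"
  have ent: "(?A ** transpose ?A) $ i $ j = w i \<bullet> w j" for i j
    by (simp add: matrix_matrix_mult_def transpose_def inner_vec_def)
  have "(det ?A)\<^sup>2 = det (?A ** transpose ?A)"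
    by (simp add: det_mul det_transpose power2_eq_square)
  also have "\<dots> = (\<Prod>i\<in>UNIV. (?A ** transpose ?A) $ i $ i)"
    by (rule det_diagonal) (simp add: ent assms)
  finally show ?thesis by (simp add: ent)
qed

text \<open>Counting smaller elements numbers \<open>A\<close> from 0 to \<open>card A - 1\<close>;
  this turns a product over the vertices of a column into a telescoping one.\<close>

lemma prod_rank:
  fixes A :: "nat set"
  assumes "finite A"
  shows "(\<Prod>j\<in>A. g (card {i\<in>A. i < j})) = (\<Prod>m<card A. g m :: 'b::comm_monoid_mult)"
  using assms
proof (induction A rule: finite_linorder_max_induct)
  case (insert b A)
  have "(\<Prod>j\<in>insert b A. g (card {i\<in>insert b A. i < j}))
      = g (card {i\<in>insert b A. i < b}) * (\<Prod>j\<in>A. g (card {i\<in>insert b A. i < j}))"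
    by (rule prod.insert) (use insert.hyps in auto)
  also have "{i\<in>insert b A. i < b} = A" using insert.hyps by auto
  also have "(\<Prod>j\<in>A. g (card {i\<in>insert b A. i < j})) = (\<Prod>j\<in>A. g (card {i\<in>A. i < j}))"
  proof (rule prod.cong[OF refl])
    fix j assume "j \<in> A"
    then have "{i\<in>insert b A. i < j} = {i\<in>A. i < j}" using insert.hyps by (auto dest: less_asym)
    then show "g (card {i\<in>insert b A. i < j}) = g (card {i\<in>A. i < j})" by simp
  qed
  also have "b \<notin> A" using insert.hyps by auto
  ultimately show ?case using insert by (simp add: mult.commute)
qed simp

lemma real_choose_2: "real (n choose 2) = real n * (real n - 1) / 2"
  by (induction n) (simp_all add: numeral_2_eq_2 field_simps)

lemma real_choose_3: "real (n choose 3) = real n * (real n - 1) * (real n - 2) / 6"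
proof (induction n)
  case (Suc n)
  have "Suc n choose 3 = (n choose 2) + (n choose 3)" by (simp add: numeral_3_eq_3 numeral_2_eq_2)
  then show ?case using Suc by (simp add: real_choose_2 field_simps)
qed simp

text \<open>Adding the two normality inequalities leaves the squared distance of \<open>p\<close>
  and \<open>p'\<close> at most 0.\<close>

lemma normal_decomposition_unique:
  fixes p :: "'b::real_inner"
  assumes "n \<bullet> (p' - p) \<le> 0" "n' \<bullet> (p - p') \<le> 0" "p + n = p' + n'"
  shows "p = p'"
proof -
  have "n' = n + (p - p')" using assms(3) by (simp add: algebra_simps)
  then have "(p - p') \<bullet> (p - p') \<le> 0"
    using assms(1,2) by (simp add: inner_add_left inner_diff_right)
  then have "(p - p') \<bullet> (p - p') = 0" using inner_ge_zero[of "p - p'"] by linarith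
  then show ?thesis by simp
qed

section \<open>Normal regions of the complementarity polytope\<close>

text \<open>The configuration is recorded by its Gram matrix, which encodes both the simplex in each
  column (one of the \<open>d + 1\<close> summands) and the orthogonality of different
  columns.\<close>

locale mub_vertices =
  fixes d :: nat and v :: "nat \<Rightarrow> nat \<Rightarrow> real^'n::{finite,wellorder}"
  assumes d2: "2 \<le> d" and cardn: "CARD('n::{finite,wellorder}) = d\<^sup>2 - 1"
    and gram: "\<And>r s j k. r \<in> {1..d+1} \<Longrightarrow> s \<in> {1..d+1} \<Longrightarrow> j \<in> {1..d} \<Longrightarrow> k \<in> {1..d} \<Longrightarrow>
       v r j \<bullet> v s k = (if r = s then (if j = k then 1 else 0) - 1 / real d else 0)"
begin

definition "cols = {1..d+1}"
definition "idx = cols \<times> {1..d}"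
definition "V \<rho> = v (fst \<rho>) (snd \<rho>)"
definition "P = convex hull (V ` idx)"

lemma finite_idx [simp]: "finite idx" and finite_cols [simp]: "finite cols" and card_cols: "card cols = d + 1"
  by (auto simp: idx_def cols_def)

lemma gramV: "\<rho> \<in> idx \<Longrightarrow> \<sigma> \<in> idx \<Longrightarrow>
    V \<rho> \<bullet> V \<sigma> = (if fst \<rho> = fst \<sigma> then (if \<rho> = \<sigma> then 1 else 0) - 1 / real d else 0)"
  by (cases \<rho>; cases \<sigma>) (simp add: V_def idx_def cols_def gram)

text \<open>Testing against the vertices recovers the coefficients up to the mean of their column.
  All uniqueness statements about faces rest on this.\<close>

lemma comb_inner:
  assumes "r \<in> cols" "j \<in> {1..d}"
  shows "(\<Sum>\<sigma>\<in>idx. \<mu> \<sigma> *\<^sub>R V \<sigma>) \<bullet> V (r, j) = \<mu> (r, j) - (\<Sum>i\<in>{1..d}. \<mu> (r, i)) / real d"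
proof -
  have "(\<Sum>\<sigma>\<in>idx. \<mu> \<sigma> *\<^sub>R V \<sigma>) \<bullet> V (r, j) = (\<Sum>\<sigma>\<in>idx. \<mu> \<sigma> * (V \<sigma> \<bullet> V (r, j)))"
    by (simp add: inner_sum_left)
  also have "\<dots> = (\<Sum>s\<in>cols. \<Sum>i\<in>{1..d}. \<mu> (s, i) * (V (s, i) \<bullet> V (r, j)))"
    unfolding idx_def by (simp add: sum.cartesian_product case_prod_unfold)
  also have "\<dots> = (\<Sum>s\<in>cols. if s = r then (\<Sum>i\<in>{1..d}. \<mu> (r, i) * ((if i = j then 1 else 0) - 1 / real d)) else 0)"
    by (intro sum.cong refl) (use assms in \<open>auto simp: gramV idx_def intro!: sum.cong\<close>)
  also have "\<dots> = (\<Sum>i\<in>{1..d}. (if i = j then \<mu> (r, j) else 0) - \<mu> (r, i) / real d)"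
    using assms(1) by (auto simp: right_diff_distrib intro!: sum.cong)
  also have "\<dots> = \<mu> (r, j) - (\<Sum>i\<in>{1..d}. \<mu> (r, i)) / real d"
    using assms(2) by (simp add: sum_subtractf sum_divide_distrib del: atLeastAtMost_iff)
  finally show ?thesis .
qed

lemma sum_column_zero:
  assumes r: "r \<in> cols"
  shows "(\<Sum>j\<in>{1..d}. V (r, j)) = 0"
proof -
  define \<mu> where "\<mu> = (\<lambda>\<sigma>::nat \<times> nat. if fst \<sigma> = r then 1 else (0::real))"
  let ?x = "\<Sum>\<sigma>\<in>idx. \<mu> \<sigma> *\<^sub>R V \<sigma>"
  have x: "?x = (\<Sum>j\<in>{1..d}. V (r, j))"
  proof -
    have "?x = (\<Sum>s\<in>cols. \<Sum>i\<in>{1..d}. \<mu> (s, i) *\<^sub>R V (s, i))"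
      unfolding idx_def by (simp add: sum.cartesian_product case_prod_unfold)
    also have "\<dots> = (\<Sum>s\<in>cols. if s = r then (\<Sum>i\<in>{1..d}. V (r, i)) else 0)"
      by (intro sum.cong refl) (auto simp: \<mu>_def)
    finally show ?thesis using r by simp
  qed
  have "?x \<bullet> V (r, j) = 0" if "j \<in> {1..d}" for j
    using comb_inner[OF r that, of \<mu>] d2 by (simp add: \<mu>_def)
  then have "?x \<bullet> ?x = 0" unfolding x by (simp add: inner_sum_right)
  then show ?thesis using x by simp
qed

lemma inner_sum_column_zero: "r \<in> cols \<Longrightarrow> (\<Sum>j\<in>{1..d}. n \<bullet> V (r, j)) = 0"
  using sum_column_zero[of r] by (metis inner_sum_right inner_zero_right)

lemma inj_V: "inj_on V idx"
proof (rule inj_onI)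
  fix \<rho> \<sigma> assume "\<rho> \<in> idx" "\<sigma> \<in> idx" and eq: "V \<rho> = V \<sigma>"
  then have "V \<rho> \<bullet> V \<rho> = V \<rho> \<bullet> V \<sigma>" "V \<rho> \<bullet> V \<rho> = 1 - 1 / real d"
    using gramV[of \<rho> \<rho>] by auto
  moreover have "V \<rho> \<bullet> V \<sigma> \<le> 0" if "\<rho> \<noteq> \<sigma>"
    using gramV[OF \<open>\<rho> \<in> idx\<close> \<open>\<sigma> \<in> idx\<close>] that by auto
  moreover have "1 - 1 / real d > 0" using d2 by simp
  ultimately show "\<rho> = \<sigma>" by fastforce
qed

text \<open>Faces are indexed by the complementary, columnwise nonempty vertex sets \<open>C\<close>.\<close>

definition "face C = (SIGMA r:cols. {1..d} - C r)"
definition "adm = cols \<rightarrow>\<^sub>E (Pow {1..d} - {{}})"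

lemma face_sub: "face C \<subseteq> idx" by (auto simp: face_def idx_def)
lemma finite_face [simp]: "finite (face C)" using face_sub finite_idx by (rule finite_subset)
lemma finite_adm: "finite adm" unfolding adm_def by (intro finite_PiE) auto

lemma admD: "C \<in> adm \<Longrightarrow> r \<in> cols \<Longrightarrow> C r \<subseteq> {1..d} \<and> C r \<noteq> {} \<and> finite (C r)"
  unfolding adm_def by (auto simp: PiE_iff intro: finite_subset)

lemma comb_inner_face:
  assumes "r \<in> cols" "j \<in> {1..d}"
  shows "(\<Sum>\<sigma>\<in>face C. \<mu> \<sigma> *\<^sub>R V \<sigma>) \<bullet> V (r, j) = (if j \<in> C r then 0 else \<mu> (r, j)) - (\<Sum>i\<in>{1..d} - C r. \<mu> (r, i)) / real d"
proof -
  define \<nu> where "\<nu> = (\<lambda>\<sigma>. if \<sigma> \<in> face C then \<mu> \<sigma> else 0)"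
  have "(\<Sum>\<sigma>\<in>face C. \<mu> \<sigma> *\<^sub>R V \<sigma>) = (\<Sum>\<sigma>\<in>idx. \<nu> \<sigma> *\<^sub>R V \<sigma>)"
    by (rule sum.mono_neutral_cong_left) (use face_sub in \<open>auto simp: \<nu>_def\<close>)
  moreover have "(\<Sum>i\<in>{1..d}. \<nu> (r, i)) = (\<Sum>i\<in>{1..d} - C r. \<mu> (r, i))"
    by (rule sum.mono_neutral_cong_right) (use assms in \<open>auto simp: \<nu>_def face_def\<close>)
  ultimately show ?thesis
    using comb_inner[OF assms, of \<nu>] assms by (auto simp: \<nu>_def face_def)
qed

text \<open>Testing against a deleted vertex shows that the column mean is 0; testing against the
  others then gives the coefficients.\<close>

lemma face_coeffs_zero:
  assumes C: "\<And>r. r \<in> cols \<Longrightarrow> C r \<inter> {1..d} \<noteq> {}" and z: "(\<Sum>\<sigma>\<in>face C. \<mu> \<sigma> *\<^sub>R V \<sigma>) = 0" and \<sigma>: "\<sigma> \<in> face C"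
  shows "\<mu> \<sigma> = 0"
proof -
  obtain r j where rj: "\<sigma> = (r, j)" by (cases \<sigma>)
  then have r: "r \<in> cols" "j \<in> {1..d}" "j \<notin> C r" using \<sigma> by (auto simp: face_def)
  obtain c where c: "c \<in> C r" "c \<in> {1..d}" using C[OF r(1)] by blast
  have "(\<Sum>i\<in>{1..d} - C r. \<mu> (r, i)) / real d = 0"
    using comb_inner_face[OF r(1) c(2), where C = C and \<mu> = \<mu>] c z by simp
  then show ?thesis using comb_inner_face[OF r(1,2), where C = C and \<mu> = \<mu>] r z rj by simp
qed

lemma independent_face:
  assumes C: "\<And>r. r \<in> cols \<Longrightarrow> C r \<inter> {1..d} \<noteq> {}"
  shows "independent (V ` face C)"
proof -
  have inj: "inj_on V (face C)" using inj_V face_sub by (rule inj_on_subset)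
  have "u (V \<sigma>) = 0" if "(\<Sum>x\<in>V ` face C. u x *\<^sub>R x) = 0" "\<sigma> \<in> face C" for u \<sigma>
    by (rule face_coeffs_zero[where C = C and \<mu> = "\<lambda>\<sigma>. u (V \<sigma>)"])
       (use that C in \<open>simp_all add: sum.reindex[OF inj]\<close>)
  then show ?thesis unfolding independent_explicit by auto
qed

text \<open>Dropping vertex \<open>d\<close> from every column leaves
  \<open>(d + 1) * (d - 1) = d^2 - 1\<close> independent vectors, hence a basis.\<close>

lemma eq_0_if_inner_V_0:
  assumes "\<And>\<sigma>. \<sigma> \<in> idx \<Longrightarrow> x \<bullet> V \<sigma> = 0"
  shows "x = 0"
proof -
  let ?C = "\<lambda>r::nat. {d}"
  have ind: "independent (V ` face ?C)" by (rule independent_face) (use d2 in auto)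
  have inj: "inj_on V (face ?C)" using inj_V face_sub by (rule inj_on_subset)
  have "card (V ` face ?C) = card (cols \<times> ({1..d} - {d}))"
    unfolding card_image[OF inj] by (simp add: face_def)
  also have "\<dots> = (d + 1) * (d - 1)"
    using d2 by (simp add: card_cartesian_product card_cols card_Diff_singleton)
  also have "\<dots> = d\<^sup>2 - 1" by (simp add: power2_eq_square algebra_simps diff_mult_distrib2)
  finally have "dim (UNIV :: (real^'n::_) set) \<le> card (V ` face ?C)" using cardn by simp
  then have "UNIV \<subseteq> span (V ` face ?C)"
    using ind by (intro card_ge_dim_independent) auto
  then have "x \<in> span (V ` face ?C)" by auto
  moreover have "x \<bullet> y = 0" if "y \<in> span (V ` face ?C)" for y
    using that by (induction rule: span_induct_alt)
      (use assms face_sub[of ?C] in \<open>auto simp: inner_add_right\<close>)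
  ultimately have "x \<bullet> x = 0" by blast
  then show ?thesis by simp
qed

lemma P_explicit: "p \<in> P \<longleftrightarrow> (\<exists>l. (\<forall>\<sigma>\<in>idx. 0 \<le> l \<sigma>) \<and> sum l idx = 1 \<and> p = (\<Sum>\<sigma>\<in>idx. l \<sigma> *\<^sub>R V \<sigma>))"
proof
  assume "p \<in> P"
  then obtain u where "\<forall>x\<in>V ` idx. 0 \<le> u x" "sum u (V ` idx) = 1" "(\<Sum>x\<in>V ` idx. u x *\<^sub>R x) = p"
    unfolding P_def by (subst (asm) convex_hull_finite) auto
  then show "\<exists>l. (\<forall>\<sigma>\<in>idx. 0 \<le> l \<sigma>) \<and> sum l idx = 1 \<and> p = (\<Sum>\<sigma>\<in>idx. l \<sigma> *\<^sub>R V \<sigma>)"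
    by (intro exI[of _ "u \<circ> V"]) (auto simp: sum.reindex[OF inj_V])
next
  assume "\<exists>l. (\<forall>\<sigma>\<in>idx. 0 \<le> l \<sigma>) \<and> sum l idx = 1 \<and> p = (\<Sum>\<sigma>\<in>idx. l \<sigma> *\<^sub>R V \<sigma>)"
  then obtain l where l: "\<And>\<sigma>. \<sigma> \<in> idx \<Longrightarrow> 0 \<le> l \<sigma>" "sum l idx = 1" "p = (\<Sum>\<sigma>\<in>idx. l \<sigma> *\<^sub>R V \<sigma>)" by auto
  show "p \<in> P" unfolding l(3) P_def
    by (rule convex_sum) (use l in \<open>auto intro: hull_inc\<close>)
qed

lemma V_in_P: "\<sigma> \<in> idx \<Longrightarrow> V \<sigma> \<in> P" unfolding P_def by (auto intro: hull_inc)
lemma idx_ne: "idx \<noteq> {}" using d2 by (auto simp: idx_def cols_def)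
lemma P_ne: "P \<noteq> {}" using V_in_P idx_ne by auto
lemma compact_P: "compact P" unfolding P_def by (intro finite_imp_compact_convex_hull finite_imageI) simp
lemma convex_P: "convex P" unfolding P_def by (rule convex_convex_hull)

definition "ncone C = {n. \<forall>\<rho>\<in>face C. \<forall>\<sigma>\<in>idx. n \<bullet> V \<sigma> \<le> n \<bullet> V \<rho>}"
text \<open>The orthogonal complement of the edge directions of the face. It also contains the
  direction from the origin to the affine hull of the face.\<close>

definition "nspace C = {n. \<forall>\<rho>\<in>face C. \<forall>\<sigma>\<in>face C. n \<bullet> V \<sigma> = n \<bullet> V \<rho>}"
definition "open_face C = {\<Sum>\<sigma>\<in>face C. l \<sigma> *\<^sub>R V \<sigma> | l. (\<forall>\<sigma>\<in>face C. 0 < l \<sigma>) \<and> sum l (face C) = 1}"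
text \<open>The cone is a parameter: \<open>ncone C\<close> gives a piece of the parallel body, and
  \<open>UNIV\<close> the full cylinder against which that piece is measured. Membership in
  \<open>nspace C\<close> is therefore demanded separately.\<close>

definition "normal_region C N \<epsilon> = {p + n | p n. p \<in> open_face C \<and> n \<in> nspace C \<and> n \<in> N \<and> n \<noteq> 0 \<and> norm n \<le> \<epsilon>}"

lemma ncone_sub: "ncone C \<subseteq> nspace C"
  unfolding ncone_def nspace_def using face_sub[of C] by (auto intro!: antisym)

lemma nspaceD: "n \<in> nspace C \<Longrightarrow> \<rho> \<in> face C \<Longrightarrow> \<sigma> \<in> face C \<Longrightarrow> n \<bullet> V \<sigma> = n \<bullet> V \<rho>"
  unfolding nspace_def by blast

lemma subspace_nspace: "subspace (nspace C)"
proof (rule subspaceI)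
  fix x y assume "x \<in> nspace C" "y \<in> nspace C"
  then show "x + y \<in> nspace C"
    unfolding nspace_def mem_Collect_eq inner_add_left by metis
next
  fix x c assume "x \<in> nspace C"
  then show "c *\<^sub>R x \<in> nspace C"
    unfolding nspace_def mem_Collect_eq inner_scaleR_left by metis
qed (simp add: nspace_def)

lemma closed_ncone: "closed (ncone C)"
proof -
  have "ncone C = (\<Inter>\<rho>\<in>face C. \<Inter>\<sigma>\<in>idx. {n. n \<bullet> V \<sigma> \<le> n \<bullet> V \<rho>})" by (auto simp: ncone_def)
  then show ?thesis by (auto intro!: closed_INT closed_Collect_le continuous_intros)
qed

lemma ncone_scale: "c > 0 \<Longrightarrow> n \<in> ncone C \<Longrightarrow> c *\<^sub>R n \<in> ncone C"
  by (auto simp: ncone_def)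

lemma open_face_sub: "open_face C \<subseteq> P"
proof
  fix p assume "p \<in> open_face C"
  then obtain l where l: "\<And>\<sigma>. \<sigma> \<in> face C \<Longrightarrow> 0 < l \<sigma>" "sum l (face C) = 1" "p = (\<Sum>\<sigma>\<in>face C. l \<sigma> *\<^sub>R V \<sigma>)"
    by (auto simp: open_face_def)
  show "p \<in> P" unfolding l(3)
    by (rule convex_sum[OF _ convex_P]) (use l face_sub[of C] V_in_P in \<open>auto intro: less_imp_le\<close>)
qed

lemma open_face_ne_face: "p \<in> open_face C \<Longrightarrow> face C \<noteq> {}"
  by (auto simp: open_face_def)

lemma ncone_normal:
  assumes p: "p \<in> open_face C" and n: "n \<in> ncone C" and y: "y \<in> P"
  shows "n \<bullet> (y - p) \<le> 0"
proof -
  obtain l where l: "\<And>\<sigma>. \<sigma> \<in> face C \<Longrightarrow> 0 < l \<sigma>" "sum l (face C) = 1" "p = (\<Sum>\<sigma>\<in>face C. l \<sigma> *\<^sub>R V \<sigma>)"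
    using p by (auto simp: open_face_def)
  obtain \<rho> where \<rho>: "\<rho> \<in> face C" using open_face_ne_face[OF p] by auto
  have eq: "n \<bullet> V \<sigma> = n \<bullet> V \<rho>" if "\<sigma> \<in> face C" for \<sigma>
    using nspaceD[OF _ \<rho> that] ncone_sub n by blast
  have "n \<bullet> p = (\<Sum>\<sigma>\<in>face C. l \<sigma> * (n \<bullet> V \<rho>))"
    unfolding l(3) inner_sum_right by (intro sum.cong) (auto simp: eq)
  also have "\<dots> = n \<bullet> V \<rho>" using l(2) by (simp flip: sum_distrib_right)
  finally have np: "n \<bullet> p = n \<bullet> V \<rho>" .
  have "P \<subseteq> {y. n \<bullet> y \<le> n \<bullet> V \<rho>}"
    unfolding P_def by (rule hull_minimal) (use n \<rho> in \<open>auto simp: ncone_def convex_halfspace_le\<close>)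
  then show ?thesis using y np by (auto simp: inner_diff_right)
qed

text \<open>Two nonnegative representations of a point differ by a constant \<open>t\<close> in each
  column. Either one vanishes somewhere in the column, and the two zeros force
  \<open>t \<le> 0\<close> and \<open>t \<ge> 0\<close>.\<close>

lemma open_face_unique:
  assumes C: "C \<in> adm" and C': "C' \<in> adm" and p: "p \<in> open_face C" "p \<in> open_face C'"
  shows "C = C'"
proof -
  obtain l where l: "\<And>\<sigma>. \<sigma> \<in> face C \<Longrightarrow> 0 < l \<sigma>" "p = (\<Sum>\<sigma>\<in>face C. l \<sigma> *\<^sub>R V \<sigma>)"
    using p(1) by (auto simp: open_face_def)
  obtain m where m: "\<And>\<sigma>. \<sigma> \<in> face C' \<Longrightarrow> 0 < m \<sigma>" "p = (\<Sum>\<sigma>\<in>face C'. m \<sigma> *\<^sub>R V \<sigma>)"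
    using p(2) by (auto simp: open_face_def)
  define x where "x = (\<lambda>\<sigma>. if \<sigma> \<in> face C then l \<sigma> else 0)"
  define y where "y = (\<lambda>\<sigma>. if \<sigma> \<in> face C' then m \<sigma> else 0)"
  have px: "p = (\<Sum>\<sigma>\<in>idx. x \<sigma> *\<^sub>R V \<sigma>)" unfolding l(2)
    by (rule sum.mono_neutral_cong_left) (use face_sub in \<open>auto simp: x_def\<close>)
  have py: "p = (\<Sum>\<sigma>\<in>idx. y \<sigma> *\<^sub>R V \<sigma>)" unfolding m(2)
    by (rule sum.mono_neutral_cong_left) (use face_sub in \<open>auto simp: y_def\<close>)
  have x0: "0 \<le> x \<sigma>" "x \<sigma> = 0 \<longleftrightarrow> \<sigma> \<notin> face C" for \<sigma> using l(1)[of \<sigma>] by (auto simp: x_def)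
  have y0: "0 \<le> y \<sigma>" "y \<sigma> = 0 \<longleftrightarrow> \<sigma> \<notin> face C'" for \<sigma> using m(1)[of \<sigma>] by (auto simp: y_def)
  have xy: "x (r, j) = y (r, j)" if r: "r \<in> cols" "j \<in> {1..d}" for r j
  proof -
    define t where "t = ((\<Sum>i\<in>{1..d}. x (r, i)) - (\<Sum>i\<in>{1..d}. y (r, i))) / real d"
    have diff: "x (r, i) - y (r, i) = t" if "i \<in> {1..d}" for i
      using comb_inner[OF r(1) that, of x] comb_inner[OF r(1) that, of y]
      by (simp add: t_def diff_divide_distrib flip: px py)
    obtain c where c: "c \<in> C r" "c \<in> {1..d}" using admD[OF C r(1)] by blast
    obtain c' where c': "c' \<in> C' r" "c' \<in> {1..d}" using admD[OF C' r(1)] by blast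
    have "x (r, c) = 0" "y (r, c') = 0" using c c' x0(2) y0(2) by (auto simp: face_def)
    then have "t = 0" using diff[OF c(2)] diff[OF c'(2)] x0(1)[of "(r, c')"] y0(1)[of "(r, c)"] by auto
    then show ?thesis using diff[OF r(2)] by simp
  qed
  have "C r = C' r" if r: "r \<in> cols" for r
  proof -
    have "j \<in> C r \<longleftrightarrow> j \<in> C' r" if "j \<in> {1..d}" for j
      using xy[OF r that] x0(2)[of "(r, j)"] y0(2)[of "(r, j)"] r that by (auto simp: face_def)
    then show ?thesis using admD[OF C r] admD[OF C' r] by blast
  qed
  then show ?thesis using C C' unfolding adm_def by (metis PiE_ext)
qed

lemma normal_region_disjoint:
  assumes "C \<in> adm" "C' \<in> adm" "C \<noteq> C'"
  shows "normal_region C (ncone C) \<epsilon> \<inter> normal_region C' (ncone C') \<epsilon> = {}"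
proof (rule ccontr)
  assume "\<not> ?thesis"
  then obtain p n p' n' where a: "p \<in> open_face C" "n \<in> ncone C" "p' \<in> open_face C'" "n' \<in> ncone C'" "p + n = p' + n'"
    unfolding normal_region_def by blast
  then have "p = p'"
    using normal_decomposition_unique[of n p' p n'] ncone_normal[of p C n p'] ncone_normal[of p' C' n' p] open_face_sub
    by blast
  then show False using open_face_unique[of C C' p] a assms by simp
qed

lemma normal_region_disjoint_P: "normal_region C (ncone C) \<epsilon> \<inter> P = {}"
proof (rule ccontr)
  assume "\<not> ?thesis"
  then obtain p n where a: "p \<in> open_face C" "n \<in> ncone C" "n \<noteq> 0" "p + n \<in> P"
    unfolding normal_region_def by blast
  then have "n \<bullet> n \<le> 0" using ncone_normal[of p C n "p + n"] by simp
  then show False using a(3) by (metis inner_gt_zero_iff not_le)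
qed

text \<open>A point outside \<open>P\<close> is split into its nearest point \<open>p\<close> and
  the outer normal \<open>n\<close>; the face is read off as the vertices of positive weight in a
  representation of \<open>p\<close>.\<close>

lemma parallel_body_decomposition:
  "parallel_body P \<epsilon> = (if \<epsilon> \<ge> 0 then P \<union> (\<Union>C\<in>adm. normal_region C (ncone C) \<epsilon>) else {})"
proof (cases "\<epsilon> \<ge> 0")
  case False
  then show ?thesis using infdist_nonneg[of _ P] by (auto simp: parallel_body_def intro: order_trans)
next
  case True
  have clP: "closed P" using compact_P by (rule compact_imp_closed)
  have "x \<in> parallel_body P \<epsilon>" if x: "x \<in> P \<union> (\<Union>C\<in>adm. normal_region C (ncone C) \<epsilon>)" for x
    using x
  proof
    assume "x \<in> P" then show ?thesis using True by (simp add: parallel_body_def)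
  next
    assume "x \<in> (\<Union>C\<in>adm. normal_region C (ncone C) \<epsilon>)"
    then obtain C p n where "x = p + n" "p \<in> open_face C" "norm n \<le> \<epsilon>"
      unfolding normal_region_def by blast
    then show ?thesis unfolding parallel_body_def mem_Collect_eq
      by (intro infdist_le2[of p]) (use open_face_sub in \<open>auto simp: dist_norm\<close>)
  qed
  moreover have "x \<in> P \<union> (\<Union>C\<in>adm. normal_region C (ncone C) \<epsilon>)" if x: "x \<in> parallel_body P \<epsilon>" for x
  proof (cases "x \<in> P")
    case True then show ?thesis by simp
  next
    case False
    define p where "p = closest_point P x"
    define n where "n = x - p"
    have pP: "p \<in> P" unfolding p_def by (rule closest_point_in_set[OF clP P_ne])
    have n0: "n \<noteq> 0" using False pP by (auto simp: n_def)
    have "infdist x P = dist x p"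
      unfolding p_def infdist_eq_setdist by (rule setdist_closest_point[OF clP P_ne])
    then have ne: "norm n \<le> \<epsilon>" using x by (simp add: parallel_body_def n_def dist_norm)
    have nor: "n \<bullet> y \<le> n \<bullet> p" if "y \<in> P" for y
      using closest_point_dot[OF convex_P clP that, of x] by (simp add: n_def p_def inner_diff_right)
    obtain l where l: "\<And>\<sigma>. \<sigma> \<in> idx \<Longrightarrow> 0 \<le> l \<sigma>" "sum l idx = 1" "p = (\<Sum>\<sigma>\<in>idx. l \<sigma> *\<^sub>R V \<sigma>)"
      using pP unfolding P_explicit by blast
    \<comment> \<open>Complementary slackness: a weighted sum of nonnegative gaps vanishes, so every
      vertex of positive weight attains the maximum of \<open>n\<close> on \<open>P\<close>.\<close>
    have act: "n \<bullet> V \<sigma> = n \<bullet> p" if \<sigma>: "\<sigma> \<in> idx" "l \<sigma> > 0" for \<sigma>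
    proof -
      have "(\<Sum>\<sigma>\<in>idx. l \<sigma> * (n \<bullet> p - n \<bullet> V \<sigma>)) = (\<Sum>\<sigma>\<in>idx. l \<sigma>) * (n \<bullet> p) - n \<bullet> p"
        by (subst (3) l(3)) (simp add: right_diff_distrib sum_subtractf sum_distrib_right inner_sum_right)
      then have "(\<Sum>\<sigma>\<in>idx. l \<sigma> * (n \<bullet> p - n \<bullet> V \<sigma>)) = 0" using l(2) by simp
      moreover have "0 \<le> l \<sigma> * (n \<bullet> p - n \<bullet> V \<sigma>)" if "\<sigma> \<in> idx" for \<sigma>
        using l(1)[OF that] nor[OF V_in_P[OF that]] by simp
      ultimately have "l \<sigma> * (n \<bullet> p - n \<bullet> V \<sigma>) = 0"
        using \<sigma>(1) by (subst (asm) sum_nonneg_eq_0_iff) auto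
      then show ?thesis using \<sigma>(2) by simp
    qed
    define C where "C = (\<lambda>r\<in>cols. {j \<in> {1..d}. l (r, j) = 0})"
    have fC: "face C = {\<sigma> \<in> idx. l \<sigma> > 0}"
    proof -
      have "\<sigma> \<in> face C \<longleftrightarrow> \<sigma> \<in> idx \<and> 0 < l \<sigma>" for \<sigma>
        using l(1)[of \<sigma>] by (cases \<sigma>) (auto simp: face_def C_def idx_def less_le)
      then show ?thesis by auto
    qed
    have l0: "l \<sigma> = 0" if "\<sigma> \<in> idx" "\<not> 0 < l \<sigma>" for \<sigma> using l(1)[of \<sigma>] that by auto
    \<comment> \<open>On a column with no zero weight \<open>n\<close> is constantly
      \<open>n \<bullet> p\<close>; as the column sums to 0, this maximum is 0. In every column the
      values are then at most 0 with sum 0, so they all vanish and \<open>n = 0\<close>.\<close>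
    have Cne: "C r \<noteq> {}" if r: "r \<in> cols" for r
    proof
      assume "C r = {}"
      then have "l (r, j) > 0" if "j \<in> {1..d}" for j
        using l(1)[of "(r, j)"] r that by (auto simp: C_def idx_def less_le)
      then have "(\<Sum>j\<in>{1..d}. n \<bullet> V (r, j)) = (\<Sum>j\<in>{1..d}. n \<bullet> p)"
        using r by (intro sum.cong refl act) (auto simp: idx_def)
      then have np: "n \<bullet> p = 0" using inner_sum_column_zero[OF r, of n] d2 by simp
      have "n \<bullet> V \<sigma> = 0" if \<sigma>: "\<sigma> \<in> idx" for \<sigma>
      proof -
        obtain s j where sj: "\<sigma> = (s, j)" "s \<in> cols" "j \<in> {1..d}"
          using \<sigma> by (cases \<sigma>) (auto simp: idx_def)
        have "(\<Sum>j\<in>{1..d}. - (n \<bullet> V (s, j))) = 0" using inner_sum_column_zero[OF sj(2), of n] by (simp add: sum_negf)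
        moreover have "0 \<le> - (n \<bullet> V (s, j))" if "j \<in> {1..d}" for j
          using nor[OF V_in_P, of "(s, j)"] that sj np by (auto simp: idx_def)
        ultimately show ?thesis using sj by (subst (asm) sum_nonneg_eq_0_iff) auto
      qed
      then have "n = 0" by (rule eq_0_if_inner_V_0)
      then show False using n0 by simp
    qed
    have Cadm: "C \<in> adm" using Cne unfolding adm_def by (auto simp: C_def)
    have "sum l (face C) = 1" "p = (\<Sum>\<sigma>\<in>face C. l \<sigma> *\<^sub>R V \<sigma>)"
    proof -
      have "sum l (face C) = sum l idx"
        unfolding fC by (rule sum.mono_neutral_left) (use l0 in auto)
      then show "sum l (face C) = 1" using l(2) by simp
      show "p = (\<Sum>\<sigma>\<in>face C. l \<sigma> *\<^sub>R V \<sigma>)"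
        unfolding l(3) fC by (rule sum.mono_neutral_right) (use l0 in auto)
    qed
    then have "p \<in> open_face C" unfolding open_face_def fC by auto
    moreover have nc: "n \<in> ncone C" unfolding ncone_def fC using act nor[OF V_in_P] by auto
    moreover have "n \<in> nspace C" using nc ncone_sub by auto
    moreover have "x = p + n" by (simp add: n_def)
    ultimately have "x \<in> normal_region C (ncone C) \<epsilon>" unfolding normal_region_def using n0 ne by blast
    then show ?thesis using Cadm by blast
  qed
  ultimately show ?thesis using True by auto
qed


section \<open>Volumes of faces\<close>

text \<open>Give each vertex of the face the weight \<open>1 / card (C r)\<close> of its column;
  this is the total weight. Its product with \<open>d\<close> is the reciprocal of the squared
  distance from the origin to the affine hull, by \<open>foot_norm\<close>.\<close>

definition "inv_ratio_sum C = (\<Sum>r\<in>cols. (real d - real (card (C r))) / real (card (C r)))"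
text \<open>The Gram determinant of the edges at a vertex of the face: that of the vertices, a
  product over columns, divided by the squared distance of the affine hull.\<close>

definition "detsq C = inv_ratio_sum C * real d * (\<Prod>r\<in>cols. real (card (C r)) / real d)"
text \<open>\<open>foot C\<close> is the point of the affine hull of the face nearest to the origin.\<close>

definition "foot_weight C \<sigma> = 1 / (real (card (C (fst \<sigma>))) * inv_ratio_sum C)"
definition "foot C = (\<Sum>\<sigma>\<in>face C. foot_weight C \<sigma> *\<^sub>R V \<sigma>)"
text \<open>Within a column all vertices have the same norm and the same mutual inner products, so
  orthogonalisation adds a multiple of the sum of the earlier vertices. The squared norms telescope
  along the column.\<close>

definition "lower C \<sigma> = {i \<in> {1..d} - C (fst \<sigma>). i < snd \<sigma>}"
definition "gram_schmidt C \<sigma> = V \<sigma> + (1 / (real d - real (card (lower C \<sigma>)))) *\<^sub>R (\<Sum>i\<in>lower C \<sigma>. V (fst \<sigma>, i))"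

lemma card_compl:
  assumes "C \<in> adm" "r \<in> cols"
  shows "card ({1..d} - C r) = d - card (C r)" "card (C r) \<le> d" "0 < card (C r)"
  using admD[OF assms] card_mono[of "{1..d}" "C r"] by (auto simp: card_Diff_subset card_gt_0_iff)

lemma sum_face: "(\<Sum>\<sigma>\<in>face C. f \<sigma>) = (\<Sum>r\<in>cols. \<Sum>j\<in>{1..d} - C r. f (r, j))"
  using sum.Sigma[of cols "\<lambda>r. {1..d} - C r" "\<lambda>r j. f (r, j)"] by (simp add: face_def case_prod_unfold)

lemma card_face:
  assumes "C \<in> adm"
  shows "card (face C) = (\<Sum>r\<in>cols. d - card (C r))"
proof -
  have "card (face C) = (\<Sum>r\<in>cols. card ({1..d} - C r))" unfolding face_def by (rule card_SigmaI) auto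
  also have "\<dots> = (\<Sum>r\<in>cols. d - card (C r))" by (intro sum.cong refl card_compl(1)[OF assms])
  finally show ?thesis .
qed

lemma inv_ratio_sum_pos:
  assumes C: "C \<in> adm" and ne: "face C \<noteq> {}"
  shows "0 < inv_ratio_sum C"
proof -
  obtain r j where rj: "(r, j) \<in> face C" using ne by auto
  then have r: "r \<in> cols" "j \<in> {1..d} - C r" by (auto simp: face_def)
  then have "0 < card ({1..d} - C r)" by (auto simp: card_gt_0_iff)
  then have "0 < (real d - real (card (C r))) / real (card (C r))"
    using card_compl[OF C r(1)] by simp
  moreover have "0 \<le> (real d - real (card (C r))) / real (card (C r))" if "r \<in> cols" for r
    using card_compl[OF C that] by simp
  ultimately show ?thesis unfolding inv_ratio_sum_def using r(1) by (intro sum_pos2) auto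
qed

lemma sum_foot_weight:
  assumes C: "C \<in> adm" and ne: "face C \<noteq> {}"
  shows "sum (foot_weight C) (face C) = 1"
proof -
  have "sum (foot_weight C) (face C) = (\<Sum>r\<in>cols. (real d - real (card (C r))) / real (card (C r)) / inv_ratio_sum C)"
    unfolding sum_face foot_weight_def by (intro sum.cong refl) (use card_compl[OF C] in \<open>auto simp: of_nat_diff\<close>)
  also have "\<dots> = inv_ratio_sum C / inv_ratio_sum C" unfolding sum_divide_distrib[symmetric] inv_ratio_sum_def[symmetric] ..
  finally show ?thesis using inv_ratio_sum_pos[OF assms] by simp
qed

text \<open>The inner product with a vertex comes out as \<open>card (C r) / d\<close> times the
  weight used in column \<open>r\<close>, so weights inverse to \<open>card (C r)\<close> make it
  constant on the face.\<close>

lemma foot_inner: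
  assumes C: "C \<in> adm" and \<sigma>: "\<sigma> \<in> face C"
  shows "foot C \<bullet> V \<sigma> = 1 / (inv_ratio_sum C * real d)"
proof -
  obtain r j where rj: "\<sigma> = (r, j)" by (cases \<sigma>)
  then have r: "r \<in> cols" "j \<in> {1..d}" "j \<notin> C r" using \<sigma> by (auto simp: face_def)
  have s: "0 < inv_ratio_sum C" using inv_ratio_sum_pos[OF C] \<sigma> by auto
  have c: "card ({1..d} - C r) = d - card (C r)" "card (C r) \<le> d" "0 < card (C r)" by (rule card_compl[OF C r(1)])+
  have "foot C \<bullet> V \<sigma> = foot_weight C (r, j) - (\<Sum>i\<in>{1..d} - C r. foot_weight C (r, i)) / real d"
    unfolding foot_def rj comb_inner_face[OF r(1,2)] using r(3) by simp
  also have "(\<Sum>i\<in>{1..d} - C r. foot_weight C (r, i)) = (real d - real (card (C r))) * foot_weight C (r, j)"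
    using c by (simp add: foot_weight_def of_nat_diff)
  also have "foot_weight C (r, j) - (real d - real (card (C r))) * foot_weight C (r, j) / real d = real (card (C r)) * foot_weight C (r, j) / real d"
    using d2 by (simp add: field_simps)
  also have "\<dots> = 1 / (inv_ratio_sum C * real d)" using c(3) by (simp add: foot_weight_def)
  finally show ?thesis .
qed

lemma foot_norm:
  assumes C: "C \<in> adm" and ne: "face C \<noteq> {}"
  shows "foot C \<bullet> foot C = 1 / (inv_ratio_sum C * real d)"
proof -
  have "foot C \<bullet> foot C = (\<Sum>\<sigma>\<in>face C. foot_weight C \<sigma> * (foot C \<bullet> V \<sigma>))"
    by (subst (2) foot_def) (simp add: inner_sum_right)
  also have "\<dots> = (\<Sum>\<sigma>\<in>face C. foot_weight C \<sigma>) * (1 / (inv_ratio_sum C * real d))"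
    unfolding sum_distrib_right by (intro sum.cong) (auto simp: foot_inner[OF C])
  finally show ?thesis using sum_foot_weight[OF assms] by simp
qed

text \<open>The column contains \<open>\<sigma>\<close> and the vertices of
  \<open>lower C \<sigma>\<close> and misses at least one vertex; this keeps the denominators and
  the squared norms of the orthogonalisation positive.\<close>

lemma lower_card:
  assumes C: "C \<in> adm" and \<sigma>: "\<sigma> \<in> face C"
  shows "card (lower C \<sigma>) + 1 < d" "finite (lower C \<sigma>)" "snd \<sigma> \<notin> lower C \<sigma>" "lower C \<sigma> \<subseteq> {1..d}"
proof -
  obtain r j where rj: "\<sigma> = (r, j)" by (cases \<sigma>)
  then have r: "r \<in> cols" "j \<in> {1..d}" "j \<notin> C r" using \<sigma> by (auto simp: face_def)
  have sub: "lower C \<sigma> \<subseteq> ({1..d} - C r) - {j}" by (auto simp: lower_def rj)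
  then have "card (lower C \<sigma>) \<le> card (({1..d} - C r) - {j})" by (intro card_mono) auto
  moreover have "card (({1..d} - C r) - {j}) = d - card (C r) - 1" using r card_compl(1)[OF C r(1)] by simp
  moreover have "d - card (C r) - 1 + 1 < d"
  proof -
    have "0 < card ({1..d} - C r)" using r by (auto simp: card_gt_0_iff)
    then show ?thesis using card_compl[OF C r(1)] by simp
  qed
  ultimately show "card (lower C \<sigma>) + 1 < d" by linarith
  show "finite (lower C \<sigma>)" "snd \<sigma> \<notin> lower C \<sigma>" "lower C \<sigma> \<subseteq> {1..d}" by (auto simp: lower_def)
qed

lemma gram_schmidt_inner:
  assumes C: "C \<in> adm" and \<sigma>: "\<sigma> \<in> face C" and s: "s \<in> cols" "i \<in> {1..d}"
  shows "gram_schmidt C \<sigma> \<bullet> V (s, i) = (if s = fst \<sigma> then (if i = snd \<sigma> then 1 else 0) - 1 / real d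
     + ((if i \<in> lower C \<sigma> then 1 else 0) - real (card (lower C \<sigma>)) / real d) / (real d - real (card (lower C \<sigma>))) else 0)"
proof -
  obtain r j where rj: "\<sigma> = (r, j)" by (cases \<sigma>)
  then have r: "r \<in> cols" "j \<in> {1..d}" using \<sigma> by (auto simp: face_def)
  note lc = lower_card[OF C \<sigma>]
  have mem: "(r, i') \<in> idx" if "i' \<in> lower C \<sigma>" for i' using that r lc(4) by (auto simp: idx_def)
  have "(\<Sum>i'\<in>lower C \<sigma>. V (r, i')) \<bullet> V (s, i)
      = (\<Sum>i'\<in>lower C \<sigma>. if r = s then (if i' = i then 1 else 0) - 1 / real d else 0)"
    unfolding inner_sum_left using mem s by (intro sum.cong refl) (simp add: gramV idx_def)
  also have "\<dots> = (if r = s then (if i \<in> lower C \<sigma> then 1 else 0) - real (card (lower C \<sigma>)) / real d else 0)"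
    using lc(2) by (simp add: sum_subtractf)
  finally show ?thesis
    using r s by (auto simp: gram_schmidt_def rj inner_add_left gramV idx_def)
qed

text \<open>An earlier vertex has inner product \<open>- 1 / d\<close> with
  \<open>V \<sigma>\<close> and \<open>(d - m) / d\<close> with the sum of all \<open>m\<close>
  earlier ones, which dictates the coefficient \<open>1 / (d - m)\<close>.\<close>

lemma gram_schmidt_orth_lower:
  assumes C: "C \<in> adm" and \<sigma>: "\<sigma> \<in> face C" and i: "i \<in> lower C \<sigma>"
  shows "gram_schmidt C \<sigma> \<bullet> V (fst \<sigma>, i) = 0"
proof -
  note lc = lower_card[OF C \<sigma>]
  have "fst \<sigma> \<in> cols" "i \<in> {1..d}" using \<sigma> i lc(4) by (auto simp: face_def)
  then have "gram_schmidt C \<sigma> \<bullet> V (fst \<sigma>, i) = - 1 / real d + (1 - real (card (lower C \<sigma>)) / real d) / (real d - real (card (lower C \<sigma>)))"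
    using gram_schmidt_inner[OF C \<sigma>, of "fst \<sigma>" i] i lc(3) by auto
  also have "1 - real (card (lower C \<sigma>)) / real d = (real d - real (card (lower C \<sigma>))) / real d"
    using d2 by (simp add: field_simps)
  also have "- 1 / real d + (real d - real (card (lower C \<sigma>))) / real d / (real d - real (card (lower C \<sigma>))) = 0"
    using lc(1) by simp
  finally show ?thesis .
qed

lemma gram_schmidt_norm:
  assumes C: "C \<in> adm" and \<sigma>: "\<sigma> \<in> face C"
  shows "gram_schmidt C \<sigma> \<bullet> gram_schmidt C \<sigma> = (real d - real (card (lower C \<sigma>)) - 1) / (real d - real (card (lower C \<sigma>)))"
proof -
  let ?m = "real (card (lower C \<sigma>))"
  note lc = lower_card[OF C \<sigma>]
  have m: "real d - ?m > 0" using lc(1) by linarith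
  have "gram_schmidt C \<sigma> \<bullet> gram_schmidt C \<sigma> = gram_schmidt C \<sigma> \<bullet> V \<sigma>"
    by (subst (2) gram_schmidt_def) (simp add: inner_add_right inner_sum_right gram_schmidt_orth_lower[OF C \<sigma>])
  also have "\<dots> = 1 - 1 / real d - ?m / real d / (real d - ?m)"
    using gram_schmidt_inner[OF C \<sigma>, of "fst \<sigma>" "snd \<sigma>"] lc(3) \<sigma> by (auto simp: face_def)
  also have "\<dots> = (real d - ?m - 1) / (real d - ?m)"
    using m d2 by (simp add: field_simps)
  finally show ?thesis .
qed

lemma gram_schmidt_orth:
  assumes C: "C \<in> adm" and \<sigma>: "\<sigma> \<in> face C" "\<tau> \<in> face C" "\<sigma> \<noteq> \<tau>"
  shows "gram_schmidt C \<sigma> \<bullet> gram_schmidt C \<tau> = 0"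
proof -
  have *: "gram_schmidt C \<sigma> \<bullet> gram_schmidt C \<tau> = 0"
    if \<sigma>: "\<sigma> \<in> face C" "\<tau> \<in> face C" and le: "fst \<sigma> \<noteq> fst \<tau> \<or> snd \<tau> < snd \<sigma>" for \<sigma> \<tau>
  proof -
    have z: "gram_schmidt C \<sigma> \<bullet> V (fst \<tau>, i) = 0" if "i = snd \<tau> \<or> i \<in> lower C \<tau>" for i
    proof (cases "fst \<sigma> = fst \<tau>")
      case True
      then have "i \<in> lower C \<sigma>" using le that \<sigma> by (auto simp: lower_def face_def)
      then show ?thesis using gram_schmidt_orth_lower[OF C \<sigma>(1)] True by simp
    next
      case False
      have "fst \<tau> \<in> cols" "i \<in> {1..d}" using that \<sigma> by (auto simp: lower_def face_def)
      then show ?thesis using gram_schmidt_inner[OF C \<sigma>(1), of "fst \<tau>" i] False by simp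
    qed
    then show ?thesis using z[of "snd \<tau>"]
      by (subst (2) gram_schmidt_def) (simp add: inner_add_right inner_sum_right)
  qed
  show ?thesis
  proof (cases "fst \<sigma> \<noteq> fst \<tau> \<or> snd \<tau> < snd \<sigma>")
    case True then show ?thesis using * \<sigma> by blast
  next
    case False
    then have "snd \<sigma> < snd \<tau>" using \<sigma>(3) by (auto simp: prod_eq_iff)
    then show ?thesis using *[OF \<sigma>(2,1)] by (simp add: inner_commute)
  qed
qed

text \<open>This product is the Gram determinant of the vertices. A column with
  \<open>k = d - card (C r)\<close> vertices contributes \<open>(d - k) / d\<close> after
  telescoping.\<close>

lemma prod_gram_schmidt_norm:
  assumes C: "C \<in> adm"
  shows "(\<Prod>\<sigma>\<in>face C. gram_schmidt C \<sigma> \<bullet> gram_schmidt C \<sigma>) = (\<Prod>r\<in>cols. real (card (C r)) / real d)"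
proof -
  let ?g = "\<lambda>m::nat. (real d - real m - 1) / (real d - real m)"
  have tele: "(\<Prod>m<k. ?g m) = (real d - real k) / real d" if "k \<le> d - 1" for k
    using that
  proof (induction k)
    case 0 then show ?case using d2 by simp
  next
    case (Suc k)
    then have "real d - real k \<noteq> 0" using d2 by linarith
    moreover have "(\<Prod>m<Suc k. ?g m) = (real d - real k) / real d * ?g k" using Suc by simp
    ultimately show ?case by simp
  qed
  have "(\<Prod>\<sigma>\<in>face C. gram_schmidt C \<sigma> \<bullet> gram_schmidt C \<sigma>) = (\<Prod>\<sigma>\<in>face C. ?g (card (lower C \<sigma>)))"
    by (intro prod.cong) (auto simp: gram_schmidt_norm[OF C])
  also have "\<dots> = (\<Prod>r\<in>cols. \<Prod>j\<in>{1..d} - C r. ?g (card {i \<in> {1..d} - C r. i < j}))"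
    using prod.Sigma[of cols "\<lambda>r. {1..d} - C r" "\<lambda>r j. ?g (card {i \<in> {1..d} - C r. i < j})"]
    by (simp add: face_def lower_def case_prod_unfold)
  also have "\<dots> = (\<Prod>r\<in>cols. \<Prod>m<card ({1..d} - C r). ?g m)"
    by (intro prod.cong refl prod_rank) auto
  also have "\<dots> = (\<Prod>r\<in>cols. real (card (C r)) / real d)"
  proof (intro prod.cong refl)
    fix r assume r: "r \<in> cols"
    note c = card_compl[OF C r]
    show "(\<Prod>m<card ({1..d} - C r). ?g m) = real (card (C r)) / real d"
      unfolding c(1) using c by (subst tele) (auto simp: of_nat_diff)
  qed
  finally show ?thesis .
qed


lemma foot_open_face:
  assumes C: "C \<in> adm" and ne: "face C \<noteq> {}"
  shows "foot C \<in> open_face C"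
proof -
  have "0 < foot_weight C \<sigma>" if "\<sigma> \<in> face C" for \<sigma>
  proof -
    have "fst \<sigma> \<in> cols" using that by (auto simp: face_def)
    then show ?thesis using card_compl(3)[OF C] inv_ratio_sum_pos[OF assms] by (simp add: foot_weight_def)
  qed
  then show ?thesis unfolding open_face_def foot_def using sum_foot_weight[OF assms] by blast
qed

lemma foot_nspace: "C \<in> adm \<Longrightarrow> foot C \<in> nspace C"
  by (simp add: nspace_def foot_inner)

lemma open_face_diff_nspace:
  assumes p: "p \<in> open_face C" "q \<in> open_face C" and n: "n \<in> nspace C"
  shows "n \<bullet> p = n \<bullet> q"
proof -
  have "n \<bullet> x = n \<bullet> V \<rho>" if x: "x \<in> open_face C" and \<rho>: "\<rho> \<in> face C" for x \<rho>
  proof -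
    obtain l where l: "sum l (face C) = 1" "x = (\<Sum>\<sigma>\<in>face C. l \<sigma> *\<^sub>R V \<sigma>)"
      using x by (auto simp: open_face_def)
    have "n \<bullet> x = (\<Sum>\<sigma>\<in>face C. l \<sigma> * (n \<bullet> V \<rho>))"
      unfolding l(2) inner_sum_right inner_scaleR_right
      by (intro sum.cong refl) (use nspaceD[OF n \<rho>] in auto)
    then show ?thesis using l(1) by (simp flip: sum_distrib_right)
  qed
  moreover obtain \<rho> where "\<rho> \<in> face C" using open_face_ne_face[OF p(1)] by auto
  ultimately show ?thesis using p by metis
qed

text \<open>Row operations turn the edges and the unit vector towards \<open>foot C\<close> into the
  vertices of the face and then into orthogonal vectors. The remaining rows are orthonormal and
  orthogonal to the vertices, so they contribute 1.\<close>

lemma frame_det: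
  fixes w :: "'n::_ \<Rightarrow> real^'n::_"
  assumes C: "C \<in> adm" and \<rho>0: "\<rho>0 \<in> face C" and a: "a \<in> S"
    and \<psi>: "bij_betw \<psi> (-S) (face C - {\<rho>0})"
    and w_edge: "\<And>i. i \<notin> S \<Longrightarrow> w i = V (\<psi> i) - V \<rho>0"
    and w_a: "w a = sqrt (inv_ratio_sum C * real d) *\<^sub>R foot C"
    and w_V: "\<And>i \<sigma>. i \<in> S - {a} \<Longrightarrow> \<sigma> \<in> face C \<Longrightarrow> w i \<bullet> V \<sigma> = 0"
    and on: "\<And>i j. i \<in> S \<Longrightarrow> j \<in> S \<Longrightarrow> w i \<bullet> w j = (if i = j then 1 else 0)"
  shows "\<bar>det (\<chi> i. w i)\<bar> = sqrt (detsq C)"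
proof -
  have ne: "face C \<noteq> {}" using \<rho>0 by auto
  define \<kappa> where "\<kappa> = sqrt (inv_ratio_sum C * real d)"
  have sgp: "0 < inv_ratio_sum C * real d" using inv_ratio_sum_pos[OF C ne] d2 by simp
  have \<kappa>0: "\<kappa> > 0" using sgp by (simp add: \<kappa>_def)
  define \<psi>' where "\<psi>' = (\<lambda>i. if i = a then \<rho>0 else \<psi> i)"
  define U where "U = insert a (-S)"
  have aU: "a \<notin> - S" using a by auto
  have \<psi>': "bij_betw \<psi>' U (face C)"
  proof -
    have "bij_betw \<psi>' (-S) (face C - {\<rho>0})"
      using \<psi> aU by (subst bij_betw_cong[of _ _ \<psi>]) (auto simp: \<psi>'_def)
    then have "bij_betw \<psi>' (-S \<union> {a}) (face C - {\<rho>0} \<union> {\<rho>0})"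
      by (rule bij_betw_combine) (auto simp: \<psi>'_def bij_betw_def)
    moreover have "- S \<union> {a} = U" "face C - {\<rho>0} \<union> {\<rho>0} = face C" using \<rho>0 by (auto simp: U_def)
    ultimately show ?thesis by simp
  qed
  have \<psi>'F: "\<psi>' i \<in> face C" if "i \<in> U" for i using \<psi>' that by (auto simp: bij_betw_def)
  define w1 where "w1 = w(a := V \<rho>0)"
  define w2 where "w2 = (\<lambda>i. if i \<in> U then V (\<psi>' i) else w i)"
  define w3 where "w3 = (\<lambda>i. if i \<in> U then gram_schmidt C (\<psi>' i) else w i)"
  have "det (\<chi> i. w i) = \<kappa> * det (\<chi> i. w1 i)"
  proof -
    \<comment> \<open>The difference of two points of the affine hull is a combination of edges, so
      row \<open>a\<close> may be replaced by the base vertex, up to the scalar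
      \<open>\<kappa>\<close>.\<close>
    define x where "x = foot C - V \<rho>0"
    have "x = (\<Sum>\<sigma>\<in>face C. foot_weight C \<sigma> *\<^sub>R (V \<sigma> - V \<rho>0))"
      using sum_foot_weight[OF C ne]
      by (simp add: x_def foot_def scaleR_diff_right sum_subtractf flip: scaleR_sum_left)
    also have "\<dots> \<in> span (w ` (-S))"
    proof (intro span_sum span_scale)
      fix \<sigma> assume "\<sigma> \<in> face C"
      show "V \<sigma> - V \<rho>0 \<in> span (w ` (-S))"
      proof (cases "\<sigma> = \<rho>0")
        case False
        then have "\<sigma> \<in> \<psi> ` (-S)" using \<psi> \<open>\<sigma> \<in> face C\<close> by (auto simp: bij_betw_def)
        then obtain i where "i \<notin> S" "\<sigma> = \<psi> i" by auto
        then show ?thesis using w_edge[of i] by (metis ComplI imageI span_base)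
      qed (simp add: span_zero)
    qed
    finally have "x \<in> span (w ` (-S))" .
    moreover have row: "row k (\<chi> i. w1 i) = w1 k" for k by (simp add: row_def vec_eq_iff)
    have "w ` (-S) \<subseteq> {row j (\<chi> i. w1 i) | j. j \<noteq> a}"
    proof
      fix y assume "y \<in> w ` (-S)"
      then obtain i where "i \<notin> S" "y = w i" by auto
      then have "y = row i (\<chi> i. w1 i)" "i \<noteq> a" using a unfolding row by (auto simp: w1_def)
      then show "y \<in> {row j (\<chi> i. w1 i) | j. j \<noteq> a}" by blast
    qed
    ultimately have "x \<in> vec.span {row j (\<chi> i. w1 i) | j. j \<noteq> a}"
      unfolding span_vec_eq using span_mono by blast
    from det_row_span[OF this]
    have d1: "det (\<chi> k. if k = a then V \<rho>0 + x else w k) = det (\<chi> i. w1 i)"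
      unfolding row by (simp add: w1_def fun_upd_def cong: if_cong)
    have "(\<chi> i. w i) = (\<chi> k. if k = a then \<kappa> *s (V \<rho>0 + x) else w k)"
      by (auto simp: vec_eq_iff w_a x_def \<kappa>_def)
    then show ?thesis using det_row_mul[of a \<kappa> "\<lambda>_. V \<rho>0 + x" w] d1 by simp
  qed
  \<comment> \<open>Adding the base vertex in row \<open>a\<close> to each edge row turns that row
    into a vertex.\<close>
  also have "det (\<chi> i. w1 i) = det (\<chi> i. w2 i)"
  proof (rule det_gram_schmidt[symmetric, where rk = "\<lambda>i. if i = a then 0 else 1"])
    fix i
    consider "i = a" | "i \<notin> S" "i \<noteq> a" | "i \<in> S" "i \<noteq> a" by blast
    then show "w2 i - w1 i \<in> span (w1 ` {j. (if j = a then 0 else 1) < (if i = a then 0 else (1::nat))})"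
    proof cases
      case 2
      then have "w2 i - w1 i = w1 a" using w_edge[of i] by (simp add: w2_def w1_def U_def \<psi>'_def)
      moreover have "w1 a \<in> span (w1 ` {j. (if j = a then 0 else 1) < (if i = a then 0 else (1::nat))})"
        using 2 by (intro span_base) auto
      ultimately show ?thesis by simp
    qed (auto simp: w2_def w1_def U_def \<psi>'_def span_zero)
  qed
  also have "det (\<chi> i. w2 i) = det (\<chi> i. w3 i)"
  proof (rule det_gram_schmidt[symmetric, where rk = "\<lambda>i. if i \<in> U then snd (\<psi>' i) else 0"])
    fix i
    let ?sp = "span (w2 ` {j. (if j \<in> U then snd (\<psi>' j) else 0) < (if i \<in> U then snd (\<psi>' i) else 0)})"
    show "w3 i - w2 i \<in> ?sp"
    proof (cases "i \<in> U")
      case True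
      have mem: "V (fst (\<psi>' i), k) \<in> ?sp" if k: "k \<in> lower C (\<psi>' i)" for k
      proof -
        have "(fst (\<psi>' i), k) \<in> face C" using k \<psi>'F[OF True] by (auto simp: lower_def face_def)
        then obtain j where j: "j \<in> U" "\<psi>' j = (fst (\<psi>' i), k)" 
          using \<psi>' unfolding bij_betw_def by (metis imageE)
        have "w2 j = V (fst (\<psi>' i), k)" using j by (simp add: w2_def)
        moreover have "w2 j \<in> ?sp" using j True k by (intro span_base imageI) (auto simp: lower_def)
        ultimately show ?thesis by simp
      qed
      have "w3 i - w2 i = (1 / (real d - real (card (lower C (\<psi>' i))))) *\<^sub>R (\<Sum>k\<in>lower C (\<psi>' i). V (fst (\<psi>' i), k))"
        using True by (simp add: w3_def w2_def gram_schmidt_def)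
      also have "\<dots> \<in> ?sp" by (intro span_scale span_sum mem)
      finally show ?thesis .
    qed (simp add: w3_def w2_def span_zero)
  qed
  finally have "\<bar>det (\<chi> i. w i)\<bar> = \<kappa> * \<bar>det (\<chi> i. w3 i)\<bar>" using \<kappa>0 by (simp add: abs_mult)
  moreover have "(det (\<chi> i. w3 i))\<^sup>2 = (\<Prod>i\<in>UNIV. w3 i \<bullet> w3 i)"
  proof (rule det_orthogonal_rows)
    fix i j :: 'n assume ij: "i \<noteq> j"
    have wg: "w i \<bullet> gram_schmidt C \<sigma> = 0" if i: "i \<notin> U" and \<sigma>: "\<sigma> \<in> face C" for i \<sigma>
    proof -
      have i': "i \<in> S - {a}" using i by (auto simp: U_def)
      have "(fst \<sigma>, k) \<in> face C" if "k \<in> lower C \<sigma>" for k using that \<sigma> by (auto simp: lower_def face_def)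
      then show ?thesis using w_V[OF i'] \<sigma> by (simp add: gram_schmidt_def inner_add_right inner_sum_right)
    qed
    have ww: "w i \<bullet> w j = 0" if "i \<notin> U" "j \<notin> U"
      using on[of i j] that ij by (auto simp: U_def)
    have "\<psi>' i \<noteq> \<psi>' j" if "i \<in> U" "j \<in> U"
      using \<psi>' that ij by (auto simp: bij_betw_def inj_on_def)
    then show "w3 i \<bullet> w3 j = 0"
      using gram_schmidt_orth[OF C \<psi>'F \<psi>'F, of i j] wg[of i "\<psi>' j"] wg[of j "\<psi>' i"] ww \<psi>'F
      by (auto simp: w3_def inner_commute)
  qed
  moreover have "(\<Prod>i\<in>UNIV. w3 i \<bullet> w3 i) = (\<Prod>r\<in>cols. real (card (C r)) / real d)"
  proof -
    have "(\<Prod>i\<in>UNIV. w3 i \<bullet> w3 i) = (\<Prod>i\<in>U. w3 i \<bullet> w3 i)"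
      using on by (intro prod.mono_neutral_right) (auto simp: w3_def U_def)
    also have "\<dots> = (\<Prod>i\<in>U. gram_schmidt C (\<psi>' i) \<bullet> gram_schmidt C (\<psi>' i))" by (simp add: w3_def)
    also have "\<dots> = (\<Prod>\<sigma>\<in>face C. gram_schmidt C \<sigma> \<bullet> gram_schmidt C \<sigma>)" by (rule prod.reindex_bij_betw[OF \<psi>'])
    finally show ?thesis by (simp add: prod_gram_schmidt_norm[OF C])
  qed
  ultimately have "\<bar>det (\<chi> i. w i)\<bar> = \<kappa> * sqrt (\<Prod>r\<in>cols. real (card (C r)) / real d)"
    by (metis real_sqrt_abs)
  then show ?thesis by (simp add: \<kappa>_def detsq_def real_sqrt_mult)
qed

text \<open>Barycentric coordinates on the face and orthonormal coordinates on the normal space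
  parametrise the region; the base vertex carries the remaining weight.\<close>

lemma frame_region:
  fixes w :: "'n::_ \<Rightarrow> real^'n::_"
  assumes \<rho>0: "\<rho>0 \<in> face C"
    and \<psi>: "bij_betw \<psi> (-S) (face C - {\<rho>0})"
    and w_edge: "\<And>i. i \<notin> S \<Longrightarrow> w i = V (\<psi> i) - V \<rho>0"
    and w_L: "\<And>i. i \<in> S \<Longrightarrow> w i \<in> nspace C"
    and expand: "\<And>n. n \<in> nspace C \<Longrightarrow> (\<Sum>i\<in>S. (n \<bullet> w i) *\<^sub>R w i) = n"
  shows "normal_region C N \<epsilon> = simplex_cone w S (V \<rho>0) N \<epsilon>"
proof -
  have fm: "frame_map w y = (\<Sum>i\<in>S. y$i *\<^sub>R w i) + (\<Sum>i\<in>-S. y$i *\<^sub>R (V (\<psi> i) - V \<rho>0))" for y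
  proof -
    have "frame_map w y = (\<Sum>i\<in>S \<union> -S. y$i *\<^sub>R w i)" unfolding frame_map_def by (simp only: Compl_partition)
    also have "\<dots> = (\<Sum>i\<in>S. y$i *\<^sub>R w i) + (\<Sum>i\<in>-S. y$i *\<^sub>R w i)"
      by (rule sum.union_disjoint) auto
    also have "(\<Sum>i\<in>-S. y$i *\<^sub>R w i) = (\<Sum>i\<in>-S. y$i *\<^sub>R (V (\<psi> i) - V \<rho>0))"
      by (intro sum.cong) (auto simp: w_edge)
    finally show ?thesis .
  qed
  have comb: "V \<rho>0 + (\<Sum>i\<in>-S. l (\<psi> i) *\<^sub>R (V (\<psi> i) - V \<rho>0)) = (\<Sum>\<sigma>\<in>face C. l \<sigma> *\<^sub>R V \<sigma>)"
    if l: "sum l (face C) = 1" for l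
  proof -
    have "(\<Sum>i\<in>-S. l (\<psi> i) *\<^sub>R (V (\<psi> i) - V \<rho>0)) = (\<Sum>\<sigma>\<in>face C - {\<rho>0}. l \<sigma> *\<^sub>R (V \<sigma> - V \<rho>0))"
      by (rule sum.reindex_bij_betw[OF \<psi>])
    also have "\<dots> = (\<Sum>\<sigma>\<in>face C. l \<sigma> *\<^sub>R (V \<sigma> - V \<rho>0))"
      using \<rho>0 by (simp add: sum.remove)
    also have "\<dots> = (\<Sum>\<sigma>\<in>face C. l \<sigma> *\<^sub>R V \<sigma>) - V \<rho>0"
      using l by (simp add: scaleR_diff_right sum_subtractf flip: scaleR_sum_left)
    finally show ?thesis by simp
  qed
  have sl: "(\<Sum>i\<in>-S. l (\<psi> i)) = sum l (face C) - l \<rho>0" for l :: "nat \<times> nat \<Rightarrow> real"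
    using sum.reindex_bij_betw[OF \<psi>, of l] \<rho>0 by (simp add: sum.remove[of "face C" \<rho>0])
  show ?thesis
  proof (intro equalityI subsetI)
    fix x assume "x \<in> normal_region C N \<epsilon>"
    then obtain l n where l: "\<And>\<sigma>. \<sigma> \<in> face C \<Longrightarrow> 0 < l \<sigma>" "sum l (face C) = 1"
      and x: "x = (\<Sum>\<sigma>\<in>face C. l \<sigma> *\<^sub>R V \<sigma>) + n"
      and n: "n \<in> nspace C" "n \<in> N" "n \<noteq> 0" "norm n \<le> \<epsilon>"
      unfolding normal_region_def open_face_def by blast
    define y where "y = (\<chi> i. if i \<in> S then n \<bullet> w i else l (\<psi> i))"
    have yS: "(\<Sum>i\<in>S. y$i *\<^sub>R w i) = n" using expand[OF n(1)] by (simp add: y_def)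
    have yA: "y$i = l (\<psi> i)" if "i \<in> -S" for i using that by (simp add: y_def)
    have "\<psi> i \<in> face C" if "i \<in> -S" for i using \<psi> that by (auto simp: bij_betw_def)
    then have "\<forall>i\<in>-S. 0 < y$i" using l(1) yA by auto
    moreover have "(\<Sum>i\<in>-S. y$i) < 1"
    proof -
      have "(\<Sum>i\<in>-S. y$i) = (\<Sum>i\<in>-S. l (\<psi> i))" by (intro sum.cong) (auto simp: yA)
      then show ?thesis using sl[of l] l(1)[OF \<rho>0] l(2) by linarith
    qed
    ultimately have "y \<in> simplex_cone_domain w S N \<epsilon>"
      unfolding simplex_cone_domain_def mem_Collect_eq yS using n by blast
    moreover have "(\<Sum>i\<in>-S. y$i *\<^sub>R (V (\<psi> i) - V \<rho>0)) = (\<Sum>i\<in>-S. l (\<psi> i) *\<^sub>R (V (\<psi> i) - V \<rho>0))"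
      by (intro sum.cong) (auto simp: yA)
    then have "V \<rho>0 + frame_map w y = x"
      unfolding x comb[OF l(2), symmetric] fm yS by simp
    ultimately show "x \<in> simplex_cone w S (V \<rho>0) N \<epsilon>" unfolding simplex_cone_def by blast
  next
    fix x assume "x \<in> simplex_cone w S (V \<rho>0) N \<epsilon>"
    then obtain y where x: "x = V \<rho>0 + frame_map w y" and y: "y \<in> simplex_cone_domain w S N \<epsilon>"
      unfolding simplex_cone_def by blast
    define n where "n = (\<Sum>i\<in>S. y$i *\<^sub>R w i)"
    have n: "n \<in> N" "n \<noteq> 0" "norm n \<le> \<epsilon>" using y by (auto simp: simplex_cone_domain_def n_def)
    have nL: "n \<in> nspace C" unfolding n_def using subspace_nspace w_L
      by (intro subspace_sum subspace_scale) auto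
    \<comment> \<open>The slack of the barycentric coordinates becomes the weight of
      \<open>\<rho>0\<close>.\<close>
    define l where "l = (\<lambda>\<sigma>. if \<sigma> = \<rho>0 then 1 - (\<Sum>i\<in>-S. y$i) else y $ (inv_into (-S) \<psi> \<sigma>))"
    have l\<psi>: "l (\<psi> i) = y $ i" if "i \<in> -S" for i
    proof -
      have "\<psi> i \<noteq> \<rho>0" using \<psi> that by (auto simp: bij_betw_def)
      then show ?thesis using \<psi> that by (simp add: l_def bij_betw_def inv_into_f_f)
    qed
    have s1: "sum l (face C) = 1"
    proof -
      have "(\<Sum>i\<in>-S. l (\<psi> i)) = (\<Sum>i\<in>-S. y$i)" by (intro sum.cong) (auto simp: l\<psi>)
      then show ?thesis using sl[of l] by (simp add: l_def)
    qed
    have "0 < l \<sigma>" if "\<sigma> \<in> face C" for \<sigma>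
    proof (cases "\<sigma> = \<rho>0")
      case True then show ?thesis using y by (simp add: l_def simplex_cone_domain_def)
    next
      case False
      then have "\<sigma> \<in> \<psi> ` (-S)" using \<psi> that by (auto simp: bij_betw_def)
      then obtain i where "i \<in> -S" "\<sigma> = \<psi> i" by blast
      then show ?thesis using y l\<psi> by (simp add: simplex_cone_domain_def)
    qed
    then have "(\<Sum>\<sigma>\<in>face C. l \<sigma> *\<^sub>R V \<sigma>) \<in> open_face C" unfolding open_face_def using s1 by blast
    moreover have "x = (\<Sum>\<sigma>\<in>face C. l \<sigma> *\<^sub>R V \<sigma>) + n"
    proof -
      have "(\<Sum>i\<in>-S. y$i *\<^sub>R (V (\<psi> i) - V \<rho>0)) = (\<Sum>i\<in>-S. l (\<psi> i) *\<^sub>R (V (\<psi> i) - V \<rho>0))"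
        by (intro sum.cong) (auto simp: l\<psi>)
      then show ?thesis unfolding x comb[OF s1, symmetric] fm n_def by simp
    qed
    ultimately show "x \<in> normal_region C N \<epsilon>" unfolding normal_region_def using n nL by blast
  qed
qed

text \<open>The frame consists of the edges at a base vertex \<open>\<rho>0\<close>, indexed by
  \<open>-S\<close>, and an orthonormal basis of the normal space: the unit vector \<open>e1\<close>
  towards the foot, and a basis of the complement \<open>T\<close> of the linear span of the
  vertices.\<close>

lemma frame_exists:
  assumes C: "C \<in> adm" and ne: "face C \<noteq> {}"
  obtains w :: "'n::_ \<Rightarrow> real^'n::_" and S x0 where
    "card S = CARD('n) + 1 - card (face C)" "S \<noteq> {}" "card (face C) \<le> CARD('n)"
    "\<And>i j. i \<in> S \<Longrightarrow> j \<in> S \<Longrightarrow> w i \<bullet> w j = (if i = j then 1 else 0)"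
    "\<And>N \<epsilon>. normal_region C N \<epsilon> = simplex_cone w S x0 N \<epsilon>"
    "\<bar>det (\<chi> i. w i)\<bar> = sqrt (detsq C)"
proof -
  obtain \<rho>0 where \<rho>0: "\<rho>0 \<in> face C" using ne by auto
  have ind: "independent (V ` face C)"
    by (rule independent_face) (use admD[OF C] in blast)
  have cV: "card (V ` face C) = card (face C)"
    by (rule card_image) (rule inj_on_subset[OF inj_V face_sub])
  define T where "T = {y. \<forall>x\<in>span (V ` face C). orthogonal x y}"
  have "dim {y \<in> UNIV. \<forall>x\<in>span (V ` face C). orthogonal x y} + dim (span (V ` face C)) = dim (UNIV :: (real^'n::_) set)"
    by (rule dim_subspace_orthogonal_to_vectors) auto
  then have dT: "dim T + card (face C) = CARD('n)"
    using ind by (simp add: T_def dim_span dim_eq_card_independent cV)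
  have Tsub: "subspace T" unfolding T_def by (auto simp: subspace_def orthogonal_clauses)
  have Tiff: "y \<in> T \<longleftrightarrow> (\<forall>\<sigma>\<in>face C. y \<bullet> V \<sigma> = 0)" for y
  proof
    assume "y \<in> T" then show "\<forall>\<sigma>\<in>face C. y \<bullet> V \<sigma> = 0"
      by (auto simp: T_def orthogonal_def inner_commute span_base)
  next
    assume z: "\<forall>\<sigma>\<in>face C. y \<bullet> V \<sigma> = 0"
    then have z': "\<forall>\<sigma>\<in>face C. V \<sigma> \<bullet> y = 0" by (simp add: inner_commute)
    have "x \<bullet> y = 0" if "x \<in> span (V ` face C)" for x
      using that by (induction rule: span_induct_alt) (use z' in \<open>auto simp: inner_add_left\<close>)
    then show "y \<in> T" by (simp add: T_def orthogonal_def)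
  qed
  obtain E' where E': "E' \<subseteq> T" "pairwise orthogonal E'" "\<And>x. x \<in> E' \<Longrightarrow> norm x = 1" "independent E'" "card E' = dim T" "span E' = T"
    using orthonormal_basis_subspace[OF Tsub] by metis
  have fE': "finite E'" using E'(4) independent_imp_finite by blast
  define e1 where "e1 = sqrt (inv_ratio_sum C * real d) *\<^sub>R foot C"
  define K where "K = inv_ratio_sum C * real d"
  have sgp: "0 < K" using inv_ratio_sum_pos[OF C ne] d2 by (simp add: K_def)
  have e1K: "e1 = sqrt K *\<^sub>R foot C" by (simp add: e1_def K_def)
  have e1V: "e1 \<bullet> V \<sigma> = 1 / sqrt K" if "\<sigma> \<in> face C" for \<sigma>
  proof -
    have "e1 \<bullet> V \<sigma> = sqrt K * (1 / (sqrt K * sqrt K))"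
      using foot_inner[OF C that, folded K_def] sgp by (simp add: e1K)
    also have "q * (1 / (q * q)) = 1 / q" for q :: real by simp
    finally show ?thesis .
  qed
  have e1n: "e1 \<bullet> e1 = 1"
  proof -
    have "e1 \<bullet> e1 = (sqrt K * sqrt K) * (1 / K)"
      using foot_norm[OF C ne, folded K_def] by (simp add: e1K)
    then show ?thesis using sgp by simp
  qed
  have e1T: "e1 \<bullet> y = 0" if "y \<in> T" for y
  proof -
    have "V \<sigma> \<bullet> y = 0" if "\<sigma> \<in> face C" for \<sigma> using \<open>y \<in> T\<close> that by (metis Tiff inner_commute)
    then show ?thesis by (simp add: e1_def foot_def inner_sum_left)
  qed
  then have e1T': "y \<bullet> e1 = 0" if "y \<in> T" for y using that by (metis inner_commute)
  have e1E: "e1 \<notin> E'" using e1T[of e1] e1n E'(1) by auto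
  define E where "E = insert e1 E'"
  have Eon: "x \<bullet> y = (if x = y then 1 else 0)" if "x \<in> E" "y \<in> E" for x y
    using that e1n e1T e1T' E'(1-3) e1E unfolding E_def
    by (auto simp: pairwise_def orthogonal_def norm_eq_1 subset_iff)
  have EL: "E \<subseteq> nspace C"
  proof -
    have "e1 \<in> nspace C" unfolding e1_def using foot_nspace[OF C] subspace_nspace by (intro subspace_scale)
    moreover have "T \<subseteq> nspace C" by (auto simp: Tiff nspace_def)
    ultimately show ?thesis using E'(1) by (auto simp: E_def)
  qed
  have Lspan: "n \<in> span E" if "n \<in> nspace C" for n
  proof -
    \<comment> \<open>All vertices of the face have inner product \<open>1 / sqrt K\<close> with
      \<open>e1\<close>, so this multiple of \<open>e1\<close> removes the common value of
      \<open>n\<close> on them.\<close>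
    define t where "t = (n \<bullet> V \<rho>0) * sqrt K"
    have "n - t *\<^sub>R e1 \<in> T"
      unfolding Tiff using nspaceD[OF that \<rho>0] sgp by (auto simp: inner_diff_left e1V t_def)
    then have "n - t *\<^sub>R e1 \<in> span E" using span_mono[of E' E] by (auto simp: E'(6) E_def)
    moreover have "t *\<^sub>R e1 \<in> span E" by (intro span_scale span_base) (simp add: E_def)
    ultimately show ?thesis using span_add by fastforce
  qed
  have cE: "card E = CARD('n) + 1 - card (face C)"
    using dT fE' e1E by (simp add: E_def E'(5))
  have fE: "finite E" using fE' by (simp add: E_def)
  have cF: "0 < card (face C)" using ne by (simp add: card_gt_0_iff)
  obtain A :: "'n::_ set" where A: "card A = card (face C) - 1"
    by (rule obtain_subset_with_card_n[of "card (face C) - 1" "UNIV :: 'n::_ set"]) (use dT in auto)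
  define S where "S = - A"
  have AS: "- S = A" by (simp add: S_def)
  have cS: "card S = CARD('n) + 1 - card (face C)"
    unfolding S_def using A cF dT by (simp add: Compl_eq_Diff_UNIV card_Diff_subset)
  obtain \<psi> where \<psi>: "bij_betw \<psi> (-S) (face C - {\<rho>0})"
    using finite_same_card_bij[of "-S" "face C - {\<rho>0}"] A \<rho>0 by (auto simp: AS)
  obtain \<eta> where \<eta>: "bij_betw \<eta> S E"
    using finite_same_card_bij[of S E] cE cS fE by auto
  define w where "w = (\<lambda>i. if i \<in> S then \<eta> i else V (\<psi> i) - V \<rho>0)"
  have wE: "w i \<in> E" if "i \<in> S" for i using \<eta> that by (auto simp: w_def bij_betw_def)
  have on: "w i \<bullet> w j = (if i = j then 1 else 0)" if "i \<in> S" "j \<in> S" for i j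
    using Eon[OF wE wE, OF that] \<eta> that by (auto simp: w_def bij_betw_def inj_on_def)
  obtain a where a: "a \<in> S" "\<eta> a = e1"
    using \<eta> unfolding bij_betw_def E_def by (metis imageE insertI1)
  have reg: "normal_region C N \<epsilon> = simplex_cone w S (V \<rho>0) N \<epsilon>" for N \<epsilon>
  proof (rule frame_region[OF \<rho>0 \<psi>])
    show "w i = V (\<psi> i) - V \<rho>0" if "i \<notin> S" for i using that by (simp add: w_def)
    show "w i \<in> nspace C" if "i \<in> S" for i using wE[OF that] EL by auto
    show "(\<Sum>i\<in>S. (n \<bullet> w i) *\<^sub>R w i) = n" if "n \<in> nspace C" for n
    proof -
      have "(\<Sum>i\<in>S. (n \<bullet> w i) *\<^sub>R w i) = (\<Sum>i\<in>S. (n \<bullet> \<eta> i) *\<^sub>R \<eta> i)" by (simp add: w_def)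
      also have "\<dots> = (\<Sum>e\<in>E. (n \<bullet> e) *\<^sub>R e)" by (rule sum.reindex_bij_betw[OF \<eta>])
      also have "\<dots> = n"
        by (rule orthonormal_basis_expand[OF _ _ Lspan[OF that] fE])
           (use Eon in \<open>auto simp: pairwise_def orthogonal_def norm_eq_1\<close>)
      finally show ?thesis .
    qed
  qed
  have det: "\<bar>det (\<chi> i. w i)\<bar> = sqrt (detsq C)"
  proof (rule frame_det[OF C \<rho>0 a(1) \<psi>])
    show "w i = V (\<psi> i) - V \<rho>0" if "i \<notin> S" for i using that by (simp add: w_def)
    show "w a = sqrt (inv_ratio_sum C * real d) *\<^sub>R foot C" using a by (simp add: w_def e1_def)
    show "w i \<bullet> V \<sigma> = 0" if "i \<in> S - {a}" "\<sigma> \<in> face C" for i \<sigma>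
    proof -
      have "w i \<noteq> e1" using that a \<eta> by (auto simp: w_def bij_betw_def inj_on_def)
      then have "w i \<in> T" using wE[of i] that E'(1) by (auto simp: E_def)
      then show ?thesis using that by (simp add: Tiff)
    qed
  qed (rule on)
  have "S \<noteq> {}" using a by auto
  moreover have "card (face C) \<le> CARD('n)" using dT by simp
  ultimately show thesis using that[OF cS _ _ on reg det] by blast
qed


section \<open>Normal cones in codimension two and three\<close>

lemma normal_region_empty: "face C = {} \<Longrightarrow> normal_region C N \<epsilon> = {}"
  unfolding normal_region_def open_face_def by auto

lemma lmeasurable_normal_region:
  assumes C: "C \<in> adm" and N: "closed N"
  shows "normal_region C N \<epsilon> \<in> lmeasurable"
proof (cases "face C = {}")
  case True then show ?thesis by (simp add: normal_region_empty)
next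
  case False
  obtain w :: "'n::_ \<Rightarrow> real^'n::_" and S x0 where on: "\<And>i j. i \<in> S \<Longrightarrow> j \<in> S \<Longrightarrow> w i \<bullet> w j = (if i = j then 1 else 0)"
    and reg: "\<And>N \<epsilon>. normal_region C N \<epsilon> = simplex_cone w S x0 N \<epsilon>"
    by (rule frame_exists[OF C False]) blast
  show ?thesis unfolding reg using N by (intro lmeasurable_simplex_cone) (erule (1) on)
qed

lemma measure_normal_region_scale:
  assumes C: "C \<in> adm" and e: "0 < \<epsilon>"
  shows "measure lebesgue (normal_region C (ncone C) \<epsilon>)
       = \<epsilon> ^ (CARD('n) + 1 - card (face C)) * measure lebesgue (normal_region C (ncone C) 1)"
proof (cases "face C = {}")
  case True then show ?thesis by (simp add: normal_region_empty)
next
  case False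
  obtain w :: "'n::_ \<Rightarrow> real^'n::_" and S x0 where
    cS: "card S = CARD('n) + 1 - card (face C)"
    and on: "\<And>i j. i \<in> S \<Longrightarrow> j \<in> S \<Longrightarrow> w i \<bullet> w j = (if i = j then 1 else 0)"
    and reg: "\<And>N \<epsilon>. normal_region C N \<epsilon> = simplex_cone w S x0 N \<epsilon>"
    by (rule frame_exists[OF C False]) blast
  show ?thesis unfolding reg cS[symmetric]
    by (rule measure_simplex_cone_scale) (auto simp: on closed_ncone e intro: ncone_scale)
qed

text \<open>\<open>k\<close> is the codimension of the face: the dimension
  \<open>card (face C) - 1\<close> is subtracted from \<open>d^2 - 1\<close>.\<close>

lemma measure_normal_region_UNIV:
  assumes C: "C \<in> adm" and k: "card (face C) + k = d\<^sup>2" and ne: "face C \<noteq> {}"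
  shows "measure lebesgue (normal_region C UNIV 1) = sqrt (detsq C) * unit_ball_vol k / fact (d\<^sup>2 - 1 - k)"
proof -
  obtain w :: "'n::_ \<Rightarrow> real^'n::_" and S x0 where
    cS: "card S = CARD('n) + 1 - card (face C)" and Sne: "S \<noteq> {}"
    and on: "\<And>i j. i \<in> S \<Longrightarrow> j \<in> S \<Longrightarrow> w i \<bullet> w j = (if i = j then 1 else 0)"
    and reg: "\<And>N \<epsilon>. normal_region C N \<epsilon> = simplex_cone w S x0 N \<epsilon>"
    and det: "\<bar>det (\<chi> i. w i)\<bar> = sqrt (detsq C)"
    by (rule frame_exists[OF C ne]) blast
  have "d\<^sup>2 \<ge> 1" using d2 by simp
  then have ck: "card S = k" using cS k cardn by linarith
  have "measure lebesgue (simplex_cone w S x0 UNIV 1)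
      = \<bar>det (\<chi> i. w i)\<bar> * unit_ball_vol (card S) / fact (CARD('n) - card S)"
    by (rule measure_simplex_ball) (auto simp: on Sne)
  then show ?thesis unfolding reg det ck by (simp add: cardn)
qed

text \<open>Centred at \<open>foot C\<close>, the orthogonal cylinder over the face is invariant under all isometries
  that fix the orthogonal complement of the normal space, so only the angle of the normal cone matters.\<close>

definition "body C = (\<lambda>x. x - foot C) ` normal_region C UNIV 1"

lemma lmeasurable_body: "C \<in> adm \<Longrightarrow> body C \<in> lmeasurable"
  unfolding body_def by (intro measurable_translation_subtract lmeasurable_normal_region) auto

lemma measure_body: "C \<in> adm \<Longrightarrow> measure lebesgue (body C) = measure lebesgue (normal_region C UNIV 1)"
  unfolding body_def by (rule measure_translation_subtract)

text \<open>A point is \<open>u + n\<close> with \<open>u\<close> in the face directions, orthogonal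
  to the normal space. The map moves it by a normal vector, so \<open>u\<close> stays the same, and
  preservation of the norm gives the new normal part the old length by Pythagoras.\<close>

lemma rot_invariant_body:
  assumes C: "C \<in> adm" and ne: "face C \<noteq> {}"
  shows "rot_invariant (nspace C) (body C)"
  unfolding rot_invariant_def
proof (intro allI impI subsetI)
  fix f y assume f: "orthogonal_transformation f" "\<forall>x. f x - x \<in> nspace C" and "y \<in> f ` body C"
  then obtain p n where y: "y = f (p + n - foot C)" and p: "p \<in> open_face C"
    and n: "n \<in> nspace C" "n \<noteq> 0" "norm n \<le> 1"
    unfolding body_def normal_region_def by blast
  define u where "u = p - foot C"
  define n' where "n' = y - u"
  have uL: "u \<bullet> l = 0" if "l \<in> nspace C" for l
    using open_face_diff_nspace[OF p foot_open_face[OF C ne] that]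
    by (simp add: u_def inner_diff_right inner_commute[of "p - foot C" l])
  have yu: "y = f (u + n)" using y by (simp add: u_def algebra_simps)
  have n': "n' = n + (f (u + n) - (u + n))" by (simp add: n'_def yu)
  have n'L: "n' \<in> nspace C" unfolding n' using n(1) f(2) subspace_nspace by (intro subspace_add) auto
  have "norm y = norm (u + n)" unfolding yu using f(1) by (simp add: orthogonal_transformation)
  then have "y \<bullet> y = (u + n) \<bullet> (u + n)" by (simp add: norm_eq)
  moreover have "y = u + n'" by (simp add: n'_def)
  ultimately have "n' \<bullet> n' = n \<bullet> n"
    using uL[OF n(1)] uL[OF n'L] by (simp add: inner_add_left inner_add_right inner_commute)
  then have "norm n' = norm n" by (simp add: norm_eq)
  then have "n' \<noteq> 0" "norm n' \<le> 1" using n by auto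
  moreover have "y = p + n' - foot C" by (simp add: n'_def u_def)
  ultimately show "y \<in> body C"
    unfolding body_def normal_region_def using p n'L by blast
qed

text \<open>Vectors of the normal space have the same inner product with all points of the face, so
  after the shift by \<open>foot C\<close> a half-space condition tests the normal part
  only.\<close>

lemma normal_region_halfspaces:
  assumes C: "C \<in> adm" and ne: "face C \<noteq> {}" and H: "H \<subseteq> nspace C"
    and N: "\<And>n. n \<in> nspace C \<Longrightarrow> n \<in> N \<longleftrightarrow> (\<forall>h\<in>H. 0 \<le> n \<bullet> h)"
  shows "(\<lambda>x. x - foot C) ` normal_region C N 1 = body C \<inter> {x. \<forall>h\<in>H. 0 \<le> x \<bullet> h}"
proof -
  have eq: "(p + n - foot C) \<bullet> h = n \<bullet> h" if "p \<in> open_face C" "h \<in> H" for p n h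
  proof -
    have "h \<bullet> p = h \<bullet> foot C"
      by (rule open_face_diff_nspace[OF that(1) foot_open_face[OF C ne]]) (use H that in auto)
    then show ?thesis
      by (simp add: inner_commute[of _ h] inner_diff_right inner_add_right)
  qed
  show ?thesis
  proof (intro equalityI subsetI)
    fix y assume "y \<in> (\<lambda>x. x - foot C) ` normal_region C N 1"
    then obtain p n where y: "y = p + n - foot C" "p \<in> open_face C" "n \<in> nspace C" "n \<in> N" "n \<noteq> 0" "norm n \<le> 1"
      unfolding normal_region_def by blast
    then have "y \<in> body C" unfolding body_def normal_region_def by blast
    moreover have "\<forall>h\<in>H. 0 \<le> y \<bullet> h" using N y eq by simp
    ultimately show "y \<in> body C \<inter> {x. \<forall>h\<in>H. 0 \<le> x \<bullet> h}" by blast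
  next
    fix y assume a: "y \<in> body C \<inter> {x. \<forall>h\<in>H. 0 \<le> x \<bullet> h}"
    then obtain p n where y: "y = p + n - foot C" "p \<in> open_face C" "n \<in> nspace C" "n \<noteq> 0" "norm n \<le> 1"
      unfolding body_def normal_region_def by blast
    then have "n \<in> N" using N a eq by simp
    then show "y \<in> (\<lambda>x. x - foot C) ` normal_region C N 1" unfolding normal_region_def using y by blast
  qed
qed

lemma measure_normal_region_shift: "measure lebesgue (normal_region C N 1)
    = measure lebesgue ((\<lambda>x. x - foot C) ` normal_region C N 1)"
  by (rule measure_translation_subtract[symmetric])

text \<open>\<open>selv f\<close> is an outer normal of the facet omitting the vertices \<open>v r (f r)\<close>.\<close>

definition "selv f = - (\<Sum>r\<in>cols. V (r, f r))"

lemma selv_inner: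
  assumes f: "\<And>r. r \<in> cols \<Longrightarrow> f r \<in> {1..d}" and r: "r \<in> cols" "j \<in> {1..d}"
  shows "selv f \<bullet> V (r, j) = 1 / real d - (if f r = j then 1 else 0)"
proof -
  have "selv f \<bullet> V (r, j) = - (\<Sum>s\<in>cols. V (s, f s) \<bullet> V (r, j))"
    by (simp add: selv_def inner_sum_left)
  also have "(\<Sum>s\<in>cols. V (s, f s) \<bullet> V (r, j)) = (\<Sum>s\<in>cols. if s = r then (if f r = j then 1 else 0) - 1 / real d else 0)"
    by (intro sum.cong refl) (use f r in \<open>auto simp: gramV idx_def\<close>)
  also have "\<dots> = (if f r = j then 1 else 0) - 1 / real d" using r by simp
  finally show ?thesis by simp
qed

text \<open>Each of the \<open>d + 1\<close> columns contributes \<open>1 - 1 / d\<close> where the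
  selections agree, and 1 less where they differ.\<close>

lemma selv_selv:
  assumes f: "\<And>r. r \<in> cols \<Longrightarrow> f r \<in> {1..d}" and g: "\<And>r. r \<in> cols \<Longrightarrow> g r \<in> {1..d}"
  shows "selv f \<bullet> selv g = ((real d)\<^sup>2 - 1) / real d - real (card {r\<in>cols. f r \<noteq> g r})"
proof -
  have "selv f \<bullet> selv g = - (\<Sum>r\<in>cols. selv f \<bullet> V (r, g r))"
    by (simp add: selv_def[of g] inner_sum_right)
  also have "(\<Sum>r\<in>cols. selv f \<bullet> V (r, g r)) = (\<Sum>r\<in>cols. (1 / real d - 1) + (if f r \<noteq> g r then 1 else 0))"
    using selv_inner[OF f] g by (intro sum.cong refl) auto
  also have "\<dots> = (real d + 1) * (1 / real d - 1) + real (card {r\<in>cols. f r \<noteq> g r})"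
    by (simp add: sum.distrib card_cols sum.If_cases Int_def)
  also have "(real d + 1) * (1 / real d - 1) = - (((real d)\<^sup>2 - 1) / real d)"
    using d2 by (simp add: field_simps power2_eq_square)
  finally show ?thesis by simp
qed

lemma selv_norm_pos: "0 < sqrt (((real d)\<^sup>2 - 1) / real d)"
proof -
  have "1 < (real d)\<^sup>2" using d2 by (intro one_less_power) auto
  then show ?thesis using d2 by simp
qed

lemma unit_selv_inner:
  fixes f g :: "nat \<Rightarrow> nat"
  assumes "\<And>r. r \<in> cols \<Longrightarrow> f r \<in> {1..d}" "\<And>r. r \<in> cols \<Longrightarrow> g r \<in> {1..d}"
  defines "R \<equiv> sqrt (((real d)\<^sup>2 - 1) / real d)"
  shows "((1 / R) *\<^sub>R selv f) \<bullet> ((1 / R) *\<^sub>R selv g) = 1 - real (card {r\<in>cols. f r \<noteq> g r}) * real d / ((real d)\<^sup>2 - 1)"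
proof -
  have "1 < (real d)\<^sup>2" using d2 by (intro one_less_power) auto
  then have R2: "R * R = ((real d)\<^sup>2 - 1) / real d" using d2 by (simp add: R_def)
  have gen: "(q / x - m) / (q / x) = 1 - m * x / q" if "q \<noteq> 0" "x \<noteq> 0" for q x m :: real
    using that by (simp add: field_simps)
  have "((1 / R) *\<^sub>R selv f) \<bullet> ((1 / R) *\<^sub>R selv g) = (((real d)\<^sup>2 - 1) / real d - real (card {r\<in>cols. f r \<noteq> g r})) / (R * R)"
    using selv_selv[OF assms(1,2)] by simp
  also have "\<dots> = 1 - real (card {r\<in>cols. f r \<noteq> g r}) * real d / ((real d)\<^sup>2 - 1)"
    unfolding R2 by (rule gen) (use d2 \<open>1 < (real d)\<^sup>2\<close> in linarith)+
  finally show ?thesis .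
qed

lemma selv_nspace:
  assumes C: "C \<in> adm" and f: "\<And>r. r \<in> cols \<Longrightarrow> f r \<in> C r"
  shows "selv f \<in> nspace C"
proof -
  have f': "f r \<in> {1..d}" if "r \<in> cols" for r using admD[OF C that] f[OF that] by blast
  have "selv f \<bullet> V \<sigma> = 1 / real d" if \<sigma>: "\<sigma> \<in> face C" for \<sigma>
  proof -
    obtain r j where rj: "\<sigma> = (r, j)" "r \<in> cols" "j \<in> {1..d}" "j \<notin> C r"
      using \<sigma> by (cases \<sigma>) (auto simp: face_def)
    then show ?thesis using selv_inner[OF f' rj(2,3)] f[OF rj(2)] by auto
  qed
  then show ?thesis by (simp add: nspace_def)
qed

text \<open>For \<open>n\<close> in the normal space, \<open>n \<bullet> V \<sigma>\<close> has a constant value \<open>height C n\<close> on the face; the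
  gaps at the remaining vertices are the coordinates of \<open>n\<close> with respect to the facet normals.\<close>

definition "height C n = n \<bullet> V (SOME \<rho>. \<rho> \<in> face C)"
definition "gap C n r c = height C n - n \<bullet> V (r, c)"

lemma height: "n \<in> nspace C \<Longrightarrow> \<rho> \<in> face C \<Longrightarrow> n \<bullet> V \<rho> = height C n"
  unfolding height_def by (rule nspaceD) (auto intro: someI)

text \<open>The values of \<open>n\<close> on a column sum to 0, so the gaps add up to
  \<open>d\<close> times the height, the same total for every column. On face vertices the gap is
  0.\<close>

lemma sum_gap:
  assumes C: "C \<in> adm" and n: "n \<in> nspace C" and r: "r \<in> cols"
  shows "(\<Sum>c\<in>C r. gap C n r c) = real d * height C n"
proof -
  note c = admD[OF C r] card_compl[OF C r]
  have "0 = (\<Sum>j\<in>{1..d} - C r. n \<bullet> V (r, j)) + (\<Sum>j\<in>C r. n \<bullet> V (r, j))"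
    using inner_sum_column_zero[OF r, of n] c sum.subset_diff[of "C r" "{1..d}" "\<lambda>j. n \<bullet> V (r, j)"] by simp
  also have "(\<Sum>j\<in>{1..d} - C r. n \<bullet> V (r, j)) = (\<Sum>j\<in>{1..d} - C r. height C n)"
    using r n by (intro sum.cong refl height) (auto simp: face_def)
  also have "\<dots> = (real d - real (card (C r))) * height C n" using c by (simp add: of_nat_diff)
  finally have "(\<Sum>j\<in>C r. n \<bullet> V (r, j)) = - ((real d - real (card (C r))) * height C n)" by linarith
  then show ?thesis by (simp add: gap_def sum_subtractf algebra_simps)
qed

lemma ncone_iff:
  assumes C: "C \<in> adm" and ne: "face C \<noteq> {}" and n: "n \<in> nspace C"
  shows "n \<in> ncone C \<longleftrightarrow> (\<forall>r\<in>cols. \<forall>c\<in>C r. 0 \<le> gap C n r c)"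
proof -
  have "n \<in> ncone C \<longleftrightarrow> (\<forall>\<sigma>\<in>idx. n \<bullet> V \<sigma> \<le> height C n)"
    using height[OF n] ne unfolding ncone_def by auto
  also have "\<dots> \<longleftrightarrow> (\<forall>r\<in>cols. \<forall>c\<in>C r. 0 \<le> gap C n r c)"
  proof
    assume "\<forall>\<sigma>\<in>idx. n \<bullet> V \<sigma> \<le> height C n"
    then show "\<forall>r\<in>cols. \<forall>c\<in>C r. 0 \<le> gap C n r c" using admD[OF C] unfolding idx_def gap_def by fastforce
  next
    assume a: "\<forall>r\<in>cols. \<forall>c\<in>C r. 0 \<le> gap C n r c"
    show "\<forall>\<sigma>\<in>idx. n \<bullet> V \<sigma> \<le> height C n"
    proof
      fix \<sigma> assume "\<sigma> \<in> idx"
      then obtain r j where rj: "\<sigma> = (r, j)" "r \<in> cols" "j \<in> {1..d}" by (auto simp: idx_def)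
      show "n \<bullet> V \<sigma> \<le> height C n"
      proof (cases "j \<in> C r")
        case True then show ?thesis using a rj by (auto simp: gap_def)
      next
        case False
        then have "\<sigma> \<in> face C" using rj by (auto simp: face_def)
        then show ?thesis using height[OF n] by simp
      qed
    qed
  qed
  finally show ?thesis .
qed

text \<open>Only the gaps matter: each coefficient \<open>t\<close> must supply the gap at the
  vertices its selection picks, and their total is then \<open>d\<close> times the height. Both
  sides then agree on every vertex.\<close>

lemma nspace_expand:
  assumes C: "C \<in> adm" and n: "n \<in> nspace C"
    and f: "\<And>r. r \<in> cols \<Longrightarrow> f1 r \<in> C r" "\<And>r. r \<in> cols \<Longrightarrow> f2 r \<in> C r" "\<And>r. r \<in> cols \<Longrightarrow> f3 r \<in> C r"
    and t: "\<And>r c. r \<in> cols \<Longrightarrow> c \<in> C r \<Longrightarrow>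
        (if f1 r = c then t1 else 0) + (if f2 r = c then t2 else 0) + (if f3 r = c then t3 else 0) = gap C n r c"
  shows "n = t1 *\<^sub>R selv f1 + t2 *\<^sub>R selv f2 + t3 *\<^sub>R selv f3"
proof -
  have f': "f1 r \<in> {1..d}" "f2 r \<in> {1..d}" "f3 r \<in> {1..d}" if "r \<in> cols" for r
    using admD[OF C that] f[OF that] by blast+
  have tot: "t1 + t2 + t3 = real d * height C n"
  proof -
    obtain r where r: "r \<in> cols" by (auto simp: cols_def)
    note fin = admD[OF C r]
    have "real d * height C n = (\<Sum>c\<in>C r. (if f1 r = c then t1 else 0) + (if f2 r = c then t2 else 0) + (if f3 r = c then t3 else 0))"
      unfolding sum_gap[OF C n r, symmetric] by (intro sum.cong refl t[symmetric] r)
    also have "\<dots> = t1 + t2 + t3"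
      using fin f[OF r] by (simp add: sum.distrib)
    finally show ?thesis by simp
  qed
  have "n - (t1 *\<^sub>R selv f1 + t2 *\<^sub>R selv f2 + t3 *\<^sub>R selv f3) = 0"
  proof (rule eq_0_if_inner_V_0)
    fix \<sigma> assume "\<sigma> \<in> idx"
    then obtain r j where rj: "\<sigma> = (r, j)" "r \<in> cols" "j \<in> {1..d}" by (auto simp: idx_def)
    let ?s = "(if f1 r = j then t1 else 0) + (if f2 r = j then t2 else 0) + (if f3 r = j then t3 else 0)"
    have "(t1 *\<^sub>R selv f1 + t2 *\<^sub>R selv f2 + t3 *\<^sub>R selv f3) \<bullet> V \<sigma> = (t1 + t2 + t3) / real d - ?s"
      unfolding rj inner_add_left inner_scaleR_left
      by (simp add: selv_inner[OF f'(1) rj(2,3)] selv_inner[OF f'(2) rj(2,3)] selv_inner[OF f'(3) rj(2,3)]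
          add_divide_distrib right_diff_distrib)
    also have "\<dots> = height C n - ?s" using tot d2 by simp
    also have "\<dots> = n \<bullet> V \<sigma>"
    proof (cases "j \<in> C r")
      case True then show ?thesis using t[OF rj(2) True] by (simp add: gap_def rj(1))
    next
      case False
      then have "?s = 0" using f[OF rj(2)] by auto
      moreover have "\<sigma> \<in> face C" using False rj by (auto simp: face_def)
      ultimately show ?thesis using height[OF n] by simp
    qed
    finally show "(n - (t1 *\<^sub>R selv f1 + t2 *\<^sub>R selv f2 + t3 *\<^sub>R selv f3)) \<bullet> V \<sigma> = 0"
      by (simp add: inner_diff_left)
  qed
  then show ?thesis by simp
qed

section \<open>The angles between facet normals, and the cones spanned by them\<close>

definition "alpha = arccos (1 - real d / ((real d)\<^sup>2 - 1))"
definition "beta = arccos (1 - 2 * real d / ((real d)\<^sup>2 - 1))"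

text \<open>With \<open>x = d / (d^2 - 1) \<le> 2 / 3\<close>, the cosine \<open>1 - x\<close> of
  \<open>alpha\<close> is positive, and \<open>cos (2 * alpha) = 1 - 4 * x + 2 * x^2\<close> is
  below \<open>cos beta = 1 - 2 * x\<close>.\<close>

lemma angles:
  "cos alpha = 1 - real d / ((real d)\<^sup>2 - 1)" "cos beta = 1 - 2 * real d / ((real d)\<^sup>2 - 1)"
  "0 < alpha" "alpha < pi" "0 < beta" "beta < pi" "beta < 2 * alpha" "beta + 2 * alpha < 2 * pi" "3 * alpha < 2 * pi"
proof -
  define x where "x = real d / ((real d)\<^sup>2 - 1)"
  \<comment> \<open>Equality holds for \<open>d = 2\<close>, which explains the factorisation with
    \<open>d - 2\<close>.\<close>
  have D: "(real d)\<^sup>2 - 1 \<ge> 3 / 2 * real d"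
  proof -
    have "(real d - 2) * (2 * real d + 1) \<ge> 0" using d2 by (intro mult_nonneg_nonneg) auto
    then show ?thesis by (simp add: algebra_simps power2_eq_square)
  qed
  have D0: "(real d)\<^sup>2 - 1 > 0" using D d2 by linarith
  have x: "0 < x" "x \<le> 2 / 3" using D D0 d2 by (auto simp: x_def divide_le_eq)
  have x2: "2 * real d / ((real d)\<^sup>2 - 1) = 2 * x" by (simp add: x_def)
  have alpha: "alpha = arccos (1 - x)" and beta: "beta = arccos (1 - 2 * x)" by (simp_all add: alpha_def beta_def x_def)
  show c: "cos alpha = 1 - real d / ((real d)\<^sup>2 - 1)" "cos beta = 1 - 2 * real d / ((real d)\<^sup>2 - 1)"
    unfolding x2 alpha beta x_def[symmetric] using x by (simp_all add: cos_arccos)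
  have ca: "cos alpha = 1 - x" and cb: "cos beta = 1 - 2 * x" using c by (simp_all add: x_def)
  have rng: "0 \<le> alpha" "alpha \<le> pi" "0 \<le> beta" "beta \<le> pi" unfolding alpha beta using x by (auto intro!: arccos_lbound arccos_ubound)
  show "0 < alpha" "0 < beta" using rng ca cb x by (auto simp: order.order_iff_strict)
  show "alpha < pi" "beta < pi" using rng ca cb x by (auto simp: order.order_iff_strict)
  have alp: "alpha < pi / 2"
  proof (rule ccontr)
    assume "\<not> alpha < pi / 2"
    then have "cos alpha \<le> cos (pi / 2)" using rng by (intro cos_monotone_0_pi_le) auto
    then show False using ca x by simp
  qed
  show "beta + 2 * alpha < 2 * pi" "3 * alpha < 2 * pi" using alp rng \<open>beta < pi\<close> by auto
  have "cos (2 * alpha) < cos beta"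
    unfolding cos_double_cos ca cb using x by (simp add: power2_eq_square algebra_simps)
  then show "beta < 2 * alpha"
    using cos_monotone_0_pi_le[of "2 * alpha" beta] alp rng by (metis linorder_not_less mult_2 add_nonneg_nonneg)
qed

text \<open>The base \<open>b\<close> is left open: it is \<open>alpha\<close> for three deletions
  in one column and \<open>beta\<close> for half of the square. The factors \<open>R\<close> only
  normalise the facet normals and leave signs of coefficients unchanged.\<close>

lemma facet_normals_isosceles_cone:
  assumes C: "C \<in> adm" and ne: "face C \<noteq> {}"
    and f: "\<And>r. r \<in> cols \<Longrightarrow> f1 r \<in> C r" "\<And>r. r \<in> cols \<Longrightarrow> f2 r \<in> C r" "\<And>r. r \<in> cols \<Longrightarrow> f3 r \<in> C r"
    and m: "card {r\<in>cols. f1 r \<noteq> f2 r} = 1" "card {r\<in>cols. f2 r \<noteq> f3 r} = 1"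
    and b: "cos b = 1 - real (card {r\<in>cols. f1 r \<noteq> f3 r}) * real d / ((real d)\<^sup>2 - 1)"
      "0 < b" "b < pi" "b < 2 * alpha" "b + 2 * alpha < 2 * pi"
  obtains n1 n2 n3 where "n1 \<in> nspace C" "n2 \<in> nspace C" "n3 \<in> nspace C"
    "\<And>t1 t2 t3. 0 \<le> (t1 *\<^sub>R selv f1 + t2 *\<^sub>R selv f2 + t3 *\<^sub>R selv f3) \<bullet> n1 \<longleftrightarrow> 0 \<le> t1"
    "\<And>t1 t2 t3. 0 \<le> (t1 *\<^sub>R selv f1 + t2 *\<^sub>R selv f2 + t3 *\<^sub>R selv f3) \<bullet> n2 \<longleftrightarrow> 0 \<le> t2"
    "\<And>t1 t2 t3. 0 \<le> (t1 *\<^sub>R selv f1 + t2 *\<^sub>R selv f2 + t3 *\<^sub>R selv f3) \<bullet> n3 \<longleftrightarrow> 0 \<le> t3"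
    "measure lebesgue (body C \<inter> {x. 0 \<le> x \<bullet> n1} \<inter> {x. 0 \<le> x \<bullet> n2} \<inter> {x. 0 \<le> x \<bullet> n3})
      = arctan (sqrt (tan (alpha / 2 + b / 4) * tan (alpha / 2 - b / 4) * tan (b / 4) ^ 2)) / pi * measure lebesgue (body C)"
proof -
  define R where "R = sqrt (((real d)\<^sup>2 - 1) / real d)"
  note inn = unit_selv_inner[folded R_def] and R0 = selv_norm_pos[folded R_def]
  have f': "f1 r \<in> {1..d}" "f2 r \<in> {1..d}" "f3 r \<in> {1..d}" if "r \<in> cols" for r
    using admD[OF C that] f[OF that] by blast+
  obtain n1 n2 n3 where n: "n1 \<in> nspace C" "n2 \<in> nspace C" "n3 \<in> nspace C"
    and t: "\<And>t1 t2 t3. 0 \<le> (t1 *\<^sub>R (1 / R) *\<^sub>R selv f1 + t2 *\<^sub>R (1 / R) *\<^sub>R selv f2 + t3 *\<^sub>R (1 / R) *\<^sub>R selv f3) \<bullet> n1 \<longleftrightarrow> 0 \<le> t1"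
      "\<And>t1 t2 t3. 0 \<le> (t1 *\<^sub>R (1 / R) *\<^sub>R selv f1 + t2 *\<^sub>R (1 / R) *\<^sub>R selv f2 + t3 *\<^sub>R (1 / R) *\<^sub>R selv f3) \<bullet> n2 \<longleftrightarrow> 0 \<le> t2"
      "\<And>t1 t2 t3. 0 \<le> (t1 *\<^sub>R (1 / R) *\<^sub>R selv f1 + t2 *\<^sub>R (1 / R) *\<^sub>R selv f2 + t3 *\<^sub>R (1 / R) *\<^sub>R selv f3) \<bullet> n3 \<longleftrightarrow> 0 \<le> t3"
    and meas: "measure lebesgue (body C \<inter> {x. 0 \<le> x \<bullet> n1} \<inter> {x. 0 \<le> x \<bullet> n2} \<inter> {x. 0 \<le> x \<bullet> n3})
      = arctan (sqrt (tan (alpha / 2 + b / 4) * tan (alpha / 2 - b / 4) * tan (b / 4) ^ 2)) / pi * measure lebesgue (body C)"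
  proof (rule measure_isosceles_cone[OF subspace_nspace[of C] lmeasurable_body[OF C] rot_invariant_body[OF C ne] angles(3,4) b(2-5),
        of "(1 / R) *\<^sub>R selv f1" "(1 / R) *\<^sub>R selv f2" "(1 / R) *\<^sub>R selv f3"])
    show "(1 / R) *\<^sub>R selv f1 \<in> nspace C" "(1 / R) *\<^sub>R selv f2 \<in> nspace C" "(1 / R) *\<^sub>R selv f3 \<in> nspace C"
      by (intro subspace_scale subspace_nspace selv_nspace[OF C] f; assumption)+
    show "((1 / R) *\<^sub>R selv f1) \<bullet> ((1 / R) *\<^sub>R selv f1) = 1" "((1 / R) *\<^sub>R selv f2) \<bullet> ((1 / R) *\<^sub>R selv f2) = 1"
       "((1 / R) *\<^sub>R selv f3) \<bullet> ((1 / R) *\<^sub>R selv f3) = 1"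
      using inn[OF f'(1) f'(1)] inn[OF f'(2) f'(2)] inn[OF f'(3) f'(3)]
      by (simp_all del: inner_scaleR_left inner_scaleR_right)
    show "((1 / R) *\<^sub>R selv f1) \<bullet> ((1 / R) *\<^sub>R selv f2) = cos alpha" "((1 / R) *\<^sub>R selv f2) \<bullet> ((1 / R) *\<^sub>R selv f3) = cos alpha"
      using inn[OF f'(1) f'(2)] inn[OF f'(2) f'(3)] m angles(1)
      by (simp_all del: inner_scaleR_left inner_scaleR_right)
    show "((1 / R) *\<^sub>R selv f1) \<bullet> ((1 / R) *\<^sub>R selv f3) = cos b"
      using inn[OF f'(1) f'(3)] b(1) by (simp del: inner_scaleR_left inner_scaleR_right)
  qed (rule that)
  have sc: "t1 *\<^sub>R selv f1 + t2 *\<^sub>R selv f2 + t3 *\<^sub>R selv f3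
    = (t1 * R) *\<^sub>R (1 / R) *\<^sub>R selv f1 + (t2 * R) *\<^sub>R (1 / R) *\<^sub>R selv f2 + (t3 * R) *\<^sub>R (1 / R) *\<^sub>R selv f3" for t1 t2 t3
    using R0 by simp
  show thesis
    by (rule that[OF n _ _ _ meas]) (simp_all only: sc t, use R0 in \<open>auto simp: zero_le_mult_iff\<close>)
qed

lemma facet_normals_planar_cone:
  assumes C: "C \<in> adm" and ne: "face C \<noteq> {}"
    and f: "\<And>r. r \<in> cols \<Longrightarrow> f1 r \<in> C r" "\<And>r. r \<in> cols \<Longrightarrow> f2 r \<in> C r"
    and m: "card {r\<in>cols. f1 r \<noteq> f2 r} = 1"
  obtains n1 n2 where "n1 \<in> nspace C" "n2 \<in> nspace C"
    "\<And>t1 t2. 0 \<le> (t1 *\<^sub>R selv f1 + t2 *\<^sub>R selv f2) \<bullet> n1 \<longleftrightarrow> 0 \<le> t1"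
    "\<And>t1 t2. 0 \<le> (t1 *\<^sub>R selv f1 + t2 *\<^sub>R selv f2) \<bullet> n2 \<longleftrightarrow> 0 \<le> t2"
    "measure lebesgue (body C \<inter> {x. 0 \<le> x \<bullet> n1} \<inter> {x. 0 \<le> x \<bullet> n2}) = alpha / (2 * pi) * measure lebesgue (body C)"
proof -
  define R where "R = sqrt (((real d)\<^sup>2 - 1) / real d)"
  note inn = unit_selv_inner[folded R_def] and R0 = selv_norm_pos[folded R_def]
  have f': "f1 r \<in> {1..d}" "f2 r \<in> {1..d}" if "r \<in> cols" for r
    using admD[OF C that] f[OF that] by blast+
  obtain n1 n2 where n: "n1 \<in> nspace C" "n2 \<in> nspace C"
    and t: "\<And>t1 t2. 0 \<le> (t1 *\<^sub>R (1 / R) *\<^sub>R selv f1 + t2 *\<^sub>R (1 / R) *\<^sub>R selv f2) \<bullet> n1 \<longleftrightarrow> 0 \<le> t1"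
      "\<And>t1 t2. 0 \<le> (t1 *\<^sub>R (1 / R) *\<^sub>R selv f1 + t2 *\<^sub>R (1 / R) *\<^sub>R selv f2) \<bullet> n2 \<longleftrightarrow> 0 \<le> t2"
    and meas: "measure lebesgue (body C \<inter> {x. 0 \<le> x \<bullet> n1} \<inter> {x. 0 \<le> x \<bullet> n2}) = alpha / (2 * pi) * measure lebesgue (body C)"
  proof (rule measure_planar_cone[OF subspace_nspace[of C] lmeasurable_body[OF C] rot_invariant_body[OF C ne] angles(3,4),
        of "(1 / R) *\<^sub>R selv f1" "(1 / R) *\<^sub>R selv f2"])
    show "(1 / R) *\<^sub>R selv f1 \<in> nspace C" "(1 / R) *\<^sub>R selv f2 \<in> nspace C"
      by (intro subspace_scale subspace_nspace selv_nspace[OF C] f; assumption)+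
    show "((1 / R) *\<^sub>R selv f1) \<bullet> ((1 / R) *\<^sub>R selv f1) = 1" "((1 / R) *\<^sub>R selv f2) \<bullet> ((1 / R) *\<^sub>R selv f2) = 1"
      using inn[OF f'(1) f'(1)] inn[OF f'(2) f'(2)] by (simp_all del: inner_scaleR_left inner_scaleR_right)
    show "((1 / R) *\<^sub>R selv f1) \<bullet> ((1 / R) *\<^sub>R selv f2) = cos alpha"
      using inn[OF f'(1) f'(2)] m angles(1) by (simp del: inner_scaleR_left inner_scaleR_right)
  qed (rule that)
  have sc: "t1 *\<^sub>R selv f1 + t2 *\<^sub>R selv f2
    = (t1 * R) *\<^sub>R (1 / R) *\<^sub>R selv f1 + (t2 * R) *\<^sub>R (1 / R) *\<^sub>R selv f2" for t1 t2
    using R0 by simp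
  show thesis
    by (rule that[OF n _ _ meas]) (simp_all only: sc t, use R0 in \<open>auto simp: zero_le_mult_iff\<close>)
qed


text \<open>The coordinates with respect to the two facet normals are the two gaps in column
  \<open>r0\<close>; the single gap of any other column is their sum and adds no condition.\<close>

lemma measure_normal_region_codim2:
  assumes C: "C \<in> adm" and ne: "face C \<noteq> {}" and r0: "r0 \<in> cols" and C0: "C r0 = {c1, c2}" "c1 \<noteq> c2"
    and g: "\<And>r. r \<in> cols \<Longrightarrow> r \<noteq> r0 \<Longrightarrow> C r = {g r}"
  shows "measure lebesgue (normal_region C (ncone C) 1) = alpha / (2 * pi) * measure lebesgue (body C)"
proof -
  define f1 where "f1 = g(r0 := c1)"
  define f2 where "f2 = g(r0 := c2)"
  have f: "\<And>r. r \<in> cols \<Longrightarrow> f1 r \<in> C r" "\<And>r. r \<in> cols \<Longrightarrow> f2 r \<in> C r"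
    using g C0 by (auto simp: f1_def f2_def)
  have "{r\<in>cols. f1 r \<noteq> f2 r} = {r0}" using r0 C0 by (auto simp: f1_def f2_def)
  then have m: "card {r\<in>cols. f1 r \<noteq> f2 r} = 1" by simp
  obtain n1 n2 where nL: "n1 \<in> nspace C" "n2 \<in> nspace C"
    and t: "\<And>t1 t2. 0 \<le> (t1 *\<^sub>R selv f1 + t2 *\<^sub>R selv f2) \<bullet> n1 \<longleftrightarrow> 0 \<le> t1"
      "\<And>t1 t2. 0 \<le> (t1 *\<^sub>R selv f1 + t2 *\<^sub>R selv f2) \<bullet> n2 \<longleftrightarrow> 0 \<le> t2"
    and meas: "measure lebesgue (body C \<inter> {x. 0 \<le> x \<bullet> n1} \<inter> {x. 0 \<le> x \<bullet> n2}) = alpha / (2 * pi) * measure lebesgue (body C)"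
    using facet_normals_planar_cone[OF C ne f m] by blast
  have "n \<in> ncone C \<longleftrightarrow> (\<forall>h\<in>{n1, n2}. 0 \<le> n \<bullet> h)" if n: "n \<in> nspace C" for n
  proof -
    let ?t1 = "gap C n r0 c1" let ?t2 = "gap C n r0 c2"
    have s0: "?t1 + ?t2 = real d * height C n" using sum_gap[OF C n r0] C0 by simp
    have s: "gap C n r (g r) = ?t1 + ?t2" if "r \<in> cols" "r \<noteq> r0" for r
      using sum_gap[OF C n that(1)] g[OF that] s0 by simp
    have ex: "n = ?t1 *\<^sub>R selv f1 + ?t2 *\<^sub>R selv f2 + 0 *\<^sub>R selv f2"
    proof (rule nspace_expand[OF C n f(1) f(2) f(2)])
      fix r c assume r: "r \<in> cols" "c \<in> C r"
      show "(if f1 r = c then ?t1 else 0) + (if f2 r = c then ?t2 else 0) + (if f2 r = c then 0 else 0) = gap C n r c"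
      proof (cases "r = r0")
        case True then show ?thesis using r C0 by (auto simp: f1_def f2_def)
      next
        case False
        then have "c = g r" using g r by auto
        then show ?thesis using False s[OF r(1) False] by (simp add: f1_def f2_def)
      qed
    qed
    have "n \<in> ncone C \<longleftrightarrow> (\<forall>r\<in>cols. \<forall>c\<in>C r. 0 \<le> gap C n r c)" by (rule ncone_iff[OF C ne n])
    also have "\<dots> \<longleftrightarrow> 0 \<le> ?t1 \<and> 0 \<le> ?t2"
    proof
      assume a: "0 \<le> ?t1 \<and> 0 \<le> ?t2"
      show "\<forall>r\<in>cols. \<forall>c\<in>C r. 0 \<le> gap C n r c"
      proof (intro ballI)
        fix r c assume r: "r \<in> cols" "c \<in> C r"
        show "0 \<le> gap C n r c"
        proof (cases "r = r0")
          case True then show ?thesis using r C0 a by auto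
        next
          case False then show ?thesis using g[OF r(1) False] s[OF r(1) False] r a by auto
        qed
      qed
    qed (use r0 C0 in auto)
    also have "\<dots> \<longleftrightarrow> (\<forall>h\<in>{n1, n2}. 0 \<le> n \<bullet> h)"
      using t[of ?t1 ?t2] ex by simp
    finally show ?thesis .
  qed
  then have "(\<lambda>x. x - foot C) ` normal_region C (ncone C) 1 = body C \<inter> {x. \<forall>h\<in>{n1, n2}. 0 \<le> x \<bullet> h}"
    using nL by (intro normal_region_halfspaces[OF C ne]) auto
  also have "\<dots> = body C \<inter> {x. 0 \<le> x \<bullet> n1} \<inter> {x. 0 \<le> x \<bullet> n2}" by auto
  finally show ?thesis unfolding measure_normal_region_shift[of C "ncone C"] using meas by simp
qed

lemma measure_normal_region_triangle:
  assumes C: "C \<in> adm" and ne: "face C \<noteq> {}" and r0: "r0 \<in> cols"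
    and C0: "C r0 = {c1, c2, c3}" "c1 \<noteq> c2" "c2 \<noteq> c3" "c1 \<noteq> c3"
    and g: "\<And>r. r \<in> cols \<Longrightarrow> r \<noteq> r0 \<Longrightarrow> C r = {g r}"
  shows "measure lebesgue (normal_region C (ncone C) 1)
    = arctan (sqrt (tan (3 * alpha / 4) * tan (alpha / 4) ^ 3)) / pi * measure lebesgue (body C)"
proof -
  define f1 where "f1 = g(r0 := c1)"
  define f2 where "f2 = g(r0 := c2)"
  define f3 where "f3 = g(r0 := c3)"
  have f: "\<And>r. r \<in> cols \<Longrightarrow> f1 r \<in> C r" "\<And>r. r \<in> cols \<Longrightarrow> f2 r \<in> C r" "\<And>r. r \<in> cols \<Longrightarrow> f3 r \<in> C r"
    using g C0 by (auto simp: f1_def f2_def f3_def)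
  have "{r\<in>cols. f1 r \<noteq> f2 r} = {r0}" "{r\<in>cols. f2 r \<noteq> f3 r} = {r0}" "{r\<in>cols. f1 r \<noteq> f3 r} = {r0}"
    using r0 C0 by (auto simp: f1_def f2_def f3_def)
  then have m: "card {r\<in>cols. f1 r \<noteq> f2 r} = 1" "card {r\<in>cols. f2 r \<noteq> f3 r} = 1" "card {r\<in>cols. f1 r \<noteq> f3 r} = 1" by simp_all
  \<comment> \<open>The equilateral triangle is the isosceles one with base \<open>alpha\<close>;
    the conditions become \<open>alpha > 0\<close> and \<open>3 * alpha < 2 * pi\<close>.\<close>
  have al2: "alpha < 2 * alpha" "alpha + 2 * alpha < 2 * pi" using angles by auto
  have ca: "cos alpha = 1 - real (card {r\<in>cols. f1 r \<noteq> f3 r}) * real d / ((real d)\<^sup>2 - 1)"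
    using angles(1) m(3) by simp
  obtain n1 n2 n3 where nL: "n1 \<in> nspace C" "n2 \<in> nspace C" "n3 \<in> nspace C"
    and t: "\<And>t1 t2 t3. 0 \<le> (t1 *\<^sub>R selv f1 + t2 *\<^sub>R selv f2 + t3 *\<^sub>R selv f3) \<bullet> n1 \<longleftrightarrow> 0 \<le> t1"
      "\<And>t1 t2 t3. 0 \<le> (t1 *\<^sub>R selv f1 + t2 *\<^sub>R selv f2 + t3 *\<^sub>R selv f3) \<bullet> n2 \<longleftrightarrow> 0 \<le> t2"
      "\<And>t1 t2 t3. 0 \<le> (t1 *\<^sub>R selv f1 + t2 *\<^sub>R selv f2 + t3 *\<^sub>R selv f3) \<bullet> n3 \<longleftrightarrow> 0 \<le> t3"
    and meas: "measure lebesgue (body C \<inter> {x. 0 \<le> x \<bullet> n1} \<inter> {x. 0 \<le> x \<bullet> n2} \<inter> {x. 0 \<le> x \<bullet> n3})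
      = arctan (sqrt (tan (alpha / 2 + alpha / 4) * tan (alpha / 2 - alpha / 4) * tan (alpha / 4) ^ 2)) / pi * measure lebesgue (body C)"
    using facet_normals_isosceles_cone[OF C ne f m(1,2) ca angles(3,4) al2] by blast
  have "n \<in> ncone C \<longleftrightarrow> (\<forall>h\<in>{n1, n2, n3}. 0 \<le> n \<bullet> h)" if n: "n \<in> nspace C" for n
  proof -
    let ?t1 = "gap C n r0 c1" let ?t2 = "gap C n r0 c2" let ?t3 = "gap C n r0 c3"
    have s0: "?t1 + ?t2 + ?t3 = real d * height C n" using sum_gap[OF C n r0] C0 by simp
    have s: "gap C n r (g r) = ?t1 + ?t2 + ?t3" if "r \<in> cols" "r \<noteq> r0" for r
      using sum_gap[OF C n that(1)] g[OF that] s0 by simp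
    have ex: "n = ?t1 *\<^sub>R selv f1 + ?t2 *\<^sub>R selv f2 + ?t3 *\<^sub>R selv f3"
    proof (rule nspace_expand[OF C n f])
      fix r c assume r: "r \<in> cols" "c \<in> C r"
      show "(if f1 r = c then ?t1 else 0) + (if f2 r = c then ?t2 else 0) + (if f3 r = c then ?t3 else 0) = gap C n r c"
      proof (cases "r = r0")
        case True then show ?thesis using r C0 by (auto simp: f1_def f2_def f3_def)
      next
        case False
        then have "c = g r" using g r by auto
        then show ?thesis using False s[OF r(1) False] by (simp add: f1_def f2_def f3_def)
      qed
    qed
    have "n \<in> ncone C \<longleftrightarrow> (\<forall>r\<in>cols. \<forall>c\<in>C r. 0 \<le> gap C n r c)" by (rule ncone_iff[OF C ne n])
    also have "\<dots> \<longleftrightarrow> 0 \<le> ?t1 \<and> 0 \<le> ?t2 \<and> 0 \<le> ?t3"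
    proof
      assume a: "0 \<le> ?t1 \<and> 0 \<le> ?t2 \<and> 0 \<le> ?t3"
      show "\<forall>r\<in>cols. \<forall>c\<in>C r. 0 \<le> gap C n r c"
      proof (intro ballI)
        fix r c assume r: "r \<in> cols" "c \<in> C r"
        show "0 \<le> gap C n r c"
        proof (cases "r = r0")
          case True then show ?thesis using r C0 a by auto
        next
          case False then show ?thesis using g[OF r(1) False] s[OF r(1) False] r a by auto
        qed
      qed
    qed (use r0 C0 in auto)
    also have "\<dots> \<longleftrightarrow> (\<forall>h\<in>{n1, n2, n3}. 0 \<le> n \<bullet> h)"
      using t[of ?t1 ?t2 ?t3] unfolding ex[symmetric] by simp
    finally show ?thesis .
  qed
  then have "(\<lambda>x. x - foot C) ` normal_region C (ncone C) 1 = body C \<inter> {x. \<forall>h\<in>{n1, n2, n3}. 0 \<le> x \<bullet> h}"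
    using nL by (intro normal_region_halfspaces[OF C ne]) auto
  also have "\<dots> = body C \<inter> {x. 0 \<le> x \<bullet> n1} \<inter> {x. 0 \<le> x \<bullet> n2} \<inter> {x. 0 \<le> x \<bullet> n3}" by auto
  finally have "measure lebesgue (normal_region C (ncone C) 1)
    = arctan (sqrt (tan (alpha / 2 + alpha / 4) * tan (alpha / 2 - alpha / 4) * tan (alpha / 4) ^ 2)) / pi * measure lebesgue (body C)"
    unfolding measure_normal_region_shift[of C "ncone C"] using meas by simp
  moreover have "tan (alpha / 2 + alpha / 4) * tan (alpha / 2 - alpha / 4) * tan (alpha / 4) ^ 2 = tan (3 * alpha / 4) * tan (alpha / 4) ^ 3"
  proof -
    have "alpha / 2 + alpha / 4 = 3 * alpha / 4" "alpha / 2 - alpha / 4 = alpha / 4" by (simp_all add: field_simps)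
    then show ?thesis by (simp add: power3_eq_cube power2_eq_square)
  qed
  ultimately show ?thesis by (simp only:)
qed

text \<open>The normal cone is spanned by four facet normals with \<open>u\<^sub>1\<^sub>1 + u\<^sub>2\<^sub>2 = u\<^sub>1\<^sub>2 + u\<^sub>2\<^sub>1\<close>; it is cut
  along the plane through \<open>u\<^sub>1\<^sub>1\<close> and \<open>u\<^sub>2\<^sub>2\<close> into two cones over isosceles triangles.\<close>

lemma measure_normal_region_square:
  assumes C: "C \<in> adm" and ne: "face C \<noteq> {}" and r0: "r0 \<in> cols" "r1 \<in> cols" "r0 \<noteq> r1"
    and C0: "C r0 = {c1, c2}" "c1 \<noteq> c2" and C1: "C r1 = {e1, e2}" "e1 \<noteq> e2"
    and g: "\<And>r. r \<in> cols \<Longrightarrow> r \<noteq> r0 \<Longrightarrow> r \<noteq> r1 \<Longrightarrow> C r = {g r}"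
  shows "measure lebesgue (normal_region C (ncone C) 1)
    = 2 * (arctan (sqrt (tan (alpha / 2 + beta / 4) * tan (alpha / 2 - beta / 4) * tan (beta / 4) ^ 2)) / pi * measure lebesgue (body C))"
proof -
  define f11 where "f11 = g(r0 := c1, r1 := e1)"
  define f12 where "f12 = g(r0 := c1, r1 := e2)"
  define f21 where "f21 = g(r0 := c2, r1 := e1)"
  define f22 where "f22 = g(r0 := c2, r1 := e2)"
  note fdefs = f11_def f12_def f21_def f22_def
  have f: "f11 r \<in> C r" "f12 r \<in> C r" "f21 r \<in> C r" "f22 r \<in> C r" if "r \<in> cols" for r
    using g[OF that] C0 C1 r0 by (auto simp: fdefs)
  have "{r\<in>cols. f11 r \<noteq> f12 r} = {r1}" "{r\<in>cols. f12 r \<noteq> f22 r} = {r0}" "{r\<in>cols. f11 r \<noteq> f22 r} = {r0, r1}"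
    "{r\<in>cols. f11 r \<noteq> f21 r} = {r0}" "{r\<in>cols. f21 r \<noteq> f22 r} = {r1}"
    using r0 C0 C1 by (auto simp: fdefs)
  then have m: "card {r\<in>cols. f11 r \<noteq> f12 r} = 1" "card {r\<in>cols. f12 r \<noteq> f22 r} = 1" "card {r\<in>cols. f11 r \<noteq> f22 r} = 2"
    "card {r\<in>cols. f11 r \<noteq> f21 r} = 1" "card {r\<in>cols. f21 r \<noteq> f22 r} = 1" using r0 by simp_all
  let ?T = "arctan (sqrt (tan (alpha / 2 + beta / 4) * tan (alpha / 2 - beta / 4) * tan (beta / 4) ^ 2)) / pi * measure lebesgue (body C)"
  have cb: "cos beta = 1 - real (card {r\<in>cols. f11 r \<noteq> f22 r}) * real d / ((real d)\<^sup>2 - 1)"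
    using angles(2) m(3) by simp
  obtain n1 n2 n3 where nL: "n1 \<in> nspace C" "n2 \<in> nspace C" "n3 \<in> nspace C"
    and t: "\<And>t1 t2 t3. 0 \<le> (t1 *\<^sub>R selv f11 + t2 *\<^sub>R selv f12 + t3 *\<^sub>R selv f22) \<bullet> n1 \<longleftrightarrow> 0 \<le> t1"
      "\<And>t1 t2 t3. 0 \<le> (t1 *\<^sub>R selv f11 + t2 *\<^sub>R selv f12 + t3 *\<^sub>R selv f22) \<bullet> n2 \<longleftrightarrow> 0 \<le> t2"
      "\<And>t1 t2 t3. 0 \<le> (t1 *\<^sub>R selv f11 + t2 *\<^sub>R selv f12 + t3 *\<^sub>R selv f22) \<bullet> n3 \<longleftrightarrow> 0 \<le> t3"
    and meas: "measure lebesgue (body C \<inter> {x. 0 \<le> x \<bullet> n1} \<inter> {x. 0 \<le> x \<bullet> n2} \<inter> {x. 0 \<le> x \<bullet> n3}) = ?T"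
    using facet_normals_isosceles_cone[OF C ne f(1) f(2) f(4) m(1,2) cb angles(5,6,7,8)] by blast
  obtain n1' n2' n3' where nL': "n1' \<in> nspace C" "n2' \<in> nspace C" "n3' \<in> nspace C"
    and t': "\<And>t1 t2 t3. 0 \<le> (t1 *\<^sub>R selv f11 + t2 *\<^sub>R selv f21 + t3 *\<^sub>R selv f22) \<bullet> n1' \<longleftrightarrow> 0 \<le> t1"
      "\<And>t1 t2 t3. 0 \<le> (t1 *\<^sub>R selv f11 + t2 *\<^sub>R selv f21 + t3 *\<^sub>R selv f22) \<bullet> n2' \<longleftrightarrow> 0 \<le> t2"
      "\<And>t1 t2 t3. 0 \<le> (t1 *\<^sub>R selv f11 + t2 *\<^sub>R selv f21 + t3 *\<^sub>R selv f22) \<bullet> n3' \<longleftrightarrow> 0 \<le> t3"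
    and meas': "measure lebesgue (body C \<inter> {x. 0 \<le> x \<bullet> n1'} \<inter> {x. 0 \<le> x \<bullet> n2'} \<inter> {x. 0 \<le> x \<bullet> n3'}) = ?T"
    using facet_normals_isosceles_cone[OF C ne f(1) f(3) f(4) m(4,5) cb angles(5,6,7,8)] by blast
  let ?A1 = "\<lambda>n. gap C n r0 c1" let ?A2 = "\<lambda>n. gap C n r0 c2"
  let ?B1 = "\<lambda>n. gap C n r1 e1" let ?B2 = "\<lambda>n. gap C n r1 e2"
  have A: "?A1 n + ?A2 n = real d * height C n" and B: "?B1 n + ?B2 n = real d * height C n" if "n \<in> nspace C" for n
    using sum_gap[OF C that r0(1)] sum_gap[OF C that r0(2)] C0 C1 by simp_all
  have s: "gap C n r (g r) = ?A1 n + ?A2 n" if "n \<in> nspace C" "r \<in> cols" "r \<noteq> r0" "r \<noteq> r1" for n r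
    using sum_gap[OF C that(1,2)] g[OF that(2-4)] A[OF that(1)] by simp
  \<comment> \<open>Coefficients of the four normals form a 2 by 2 array whose row sums are the gaps
    in \<open>r0\<close> and whose column sums are the gaps in \<open>r1\<close>. Setting the entry
    of \<open>f21\<close> to 0 determines the rest; \<open>ex'\<close> does the same with the entry
    of \<open>f12\<close>.\<close>
  have ex: "n = ?B1 n *\<^sub>R selv f11 + (?A1 n - ?B1 n) *\<^sub>R selv f12 + ?A2 n *\<^sub>R selv f22" if n: "n \<in> nspace C" for n
  proof (rule nspace_expand[OF C n f(1) f(2) f(4)])
    fix r c assume r: "r \<in> cols" "c \<in> C r"
    show "(if f11 r = c then ?B1 n else 0) + (if f12 r = c then ?A1 n - ?B1 n else 0) + (if f22 r = c then ?A2 n else 0) = gap C n r c"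
    proof (cases "r = r0 \<or> r = r1")
      case True then show ?thesis using r r0 C0 C1 A[OF n] B[OF n] by (auto simp: fdefs)
    next
      case False
      then have "c = g r" using g r by auto
      then show ?thesis using False s[OF n r(1)] by (simp add: fdefs)
    qed
  qed
  have ex': "n = ?A1 n *\<^sub>R selv f11 + (?B1 n - ?A1 n) *\<^sub>R selv f21 + ?B2 n *\<^sub>R selv f22" if n: "n \<in> nspace C" for n
  proof (rule nspace_expand[OF C n f(1) f(3) f(4)])
    fix r c assume r: "r \<in> cols" "c \<in> C r"
    show "(if f11 r = c then ?A1 n else 0) + (if f21 r = c then ?B1 n - ?A1 n else 0) + (if f22 r = c then ?B2 n else 0) = gap C n r c"
    proof (cases "r = r0 \<or> r = r1")
      case True then show ?thesis using r r0 C0 C1 A[OF n] B[OF n] by (auto simp: fdefs)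
    next
      case False
      then have "c = g r" using g r by auto
      then show ?thesis using False s[OF n r(1)] A[OF n] B[OF n] by (simp add: fdefs)
    qed
  qed
  have h: "0 \<le> n \<bullet> n1 \<longleftrightarrow> 0 \<le> ?B1 n" "0 \<le> n \<bullet> n2 \<longleftrightarrow> ?B1 n \<le> ?A1 n" "0 \<le> n \<bullet> n3 \<longleftrightarrow> 0 \<le> ?A2 n"
    if n: "n \<in> nspace C" for n
    using t[of "?B1 n" "?A1 n - ?B1 n" "?A2 n"] unfolding ex[OF n, symmetric] by simp_all
  have h': "0 \<le> n \<bullet> n1' \<longleftrightarrow> 0 \<le> ?A1 n" "0 \<le> n \<bullet> n2' \<longleftrightarrow> ?A1 n \<le> ?B1 n" "0 \<le> n \<bullet> n3' \<longleftrightarrow> 0 \<le> ?B2 n"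
    if n: "n \<in> nspace C" for n
    using t'[of "?A1 n" "?B1 n - ?A1 n" "?B2 n"] unfolding ex'[OF n, symmetric] by simp_all
  define N1 where "N1 = {n. \<forall>h\<in>{n1, n2, n3}. 0 \<le> n \<bullet> h}"
  define N2 where "N2 = {n. \<forall>h\<in>{n1', n2', n3'}. 0 \<le> n \<bullet> h}"
  have nc: "n \<in> ncone C \<longleftrightarrow> n \<in> N1 \<or> n \<in> N2" if n: "n \<in> nspace C" for n
  proof -
    have "n \<in> ncone C \<longleftrightarrow> (\<forall>r\<in>cols. \<forall>c\<in>C r. 0 \<le> gap C n r c)" by (rule ncone_iff[OF C ne n])
    also have "\<dots> \<longleftrightarrow> 0 \<le> ?A1 n \<and> 0 \<le> ?A2 n \<and> 0 \<le> ?B1 n \<and> 0 \<le> ?B2 n"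
    proof
      assume a: "0 \<le> ?A1 n \<and> 0 \<le> ?A2 n \<and> 0 \<le> ?B1 n \<and> 0 \<le> ?B2 n"
      show "\<forall>r\<in>cols. \<forall>c\<in>C r. 0 \<le> gap C n r c"
      proof (intro ballI)
        fix r c assume r: "r \<in> cols" "c \<in> C r"
        show "0 \<le> gap C n r c"
        proof (cases "r = r0 \<or> r = r1")
          case True then show ?thesis using r C0 C1 a by auto
        next
          case False then show ?thesis using g[of r] s[OF n r(1)] r a by auto
        qed
      qed
    qed (use r0 C0 C1 in auto)
    also have "\<dots> \<longleftrightarrow> n \<in> N1 \<or> n \<in> N2"
      using A[OF n] B[OF n] h[OF n] h'[OF n] unfolding N1_def N2_def by auto
    finally show ?thesis .
  qed
  \<comment> \<open>Half-space \<open>n2\<close> rejects a negative coefficient of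
    \<open>f12\<close>, so its normal is not 0.\<close>
  have n2: "n2 \<noteq> 0" using t(2)[of 0 "-1" 0] by auto
  let ?X1 = "body C \<inter> {x. 0 \<le> x \<bullet> n1} \<inter> {x. 0 \<le> x \<bullet> n2} \<inter> {x. 0 \<le> x \<bullet> n3}"
  let ?X2 = "body C \<inter> {x. 0 \<le> x \<bullet> n1'} \<inter> {x. 0 \<le> x \<bullet> n2'} \<inter> {x. 0 \<le> x \<bullet> n3'}"
  have X1: "(\<lambda>x. x - foot C) ` normal_region C N1 1 = ?X1"
  proof -
    have "(\<lambda>x. x - foot C) ` normal_region C N1 1 = body C \<inter> {x. \<forall>h\<in>{n1, n2, n3}. 0 \<le> x \<bullet> h}"
      using nL by (intro normal_region_halfspaces[OF C ne]) (auto simp: N1_def)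
    then show ?thesis by auto
  qed
  have X2: "(\<lambda>x. x - foot C) ` normal_region C N2 1 = ?X2"
  proof -
    have "(\<lambda>x. x - foot C) ` normal_region C N2 1 = body C \<inter> {x. \<forall>h\<in>{n1', n2', n3'}. 0 \<le> x \<bullet> h}"
      using nL' by (intro normal_region_halfspaces[OF C ne]) (auto simp: N2_def)
    then show ?thesis by auto
  qed
  \<comment> \<open>Both dividing planes compare the gaps at \<open>c1\<close> and
    \<open>e1\<close>, in opposite directions; hence the two parts overlap only within a
    hyperplane.\<close>
  have X2': "?X2 \<subseteq> {x. x \<bullet> n2 \<le> 0}"
  proof -
    have "(\<lambda>x. x - foot C) ` normal_region C N2 1 \<subseteq> (\<lambda>x. x - foot C) ` normal_region C {n. \<forall>h\<in>{- n2}. 0 \<le> n \<bullet> h} 1"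
    proof (rule image_mono)
      have "n \<in> {n. \<forall>h\<in>{- n2}. 0 \<le> n \<bullet> h}" if n: "n \<in> nspace C" "n \<in> N2" for n
      proof -
        have "?A1 n \<le> ?B1 n" using h'(2)[OF n(1)] n(2) by (simp add: N2_def)
        \<comment> \<open>The sign test is an equivalence for \<open>0 \<le>\<close> only; applied
          to \<open>- n\<close> it gives the reverse inequality.\<close>
        moreover have "0 \<le> (- n) \<bullet> n2 \<longleftrightarrow> ?B1 (- n) \<le> ?A1 (- n)"
          by (rule h(2)) (use n(1) subspace_nspace subspace_neg in blast)
        ultimately show ?thesis by (simp add: gap_def height_def)
      qed
      then show "normal_region C N2 1 \<subseteq> normal_region C {n. \<forall>h\<in>{- n2}. 0 \<le> n \<bullet> h} 1"
        unfolding normal_region_def by blast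
    qed
    also have "\<dots> = body C \<inter> {x. \<forall>h\<in>{- n2}. 0 \<le> x \<bullet> h}"
      by (rule normal_region_halfspaces[OF C ne]) (use nL subspace_nspace subspace_neg in auto)
    finally show ?thesis unfolding X2 by auto
  qed
  have "(\<lambda>x. x - foot C) ` normal_region C (ncone C) 1 = ?X1 \<union> ?X2"
  proof -
    have "normal_region C (ncone C) 1 = normal_region C N1 1 \<union> normal_region C N2 1"
      unfolding normal_region_def using nc by blast
    then show ?thesis unfolding X1[symmetric] X2[symmetric] by (simp add: image_Un)
  qed
  moreover have "measure lebesgue (?X1 \<union> ?X2) = measure lebesgue ?X1 + measure lebesgue ?X2"
  proof (rule measure_Un_negligible)
    show "negligible (?X1 \<inter> ?X2)"
      by (rule negligible_subset[OF negligible_inner_eq_0[OF n2]]) (use X2' in auto)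
  qed (use lmeasurable_body[OF C] in \<open>auto intro!: fmeasurable_Int_fmeasurable\<close>)
  ultimately show ?thesis
    unfolding measure_normal_region_shift[of C "ncone C"] using meas meas' by simp
qed


section \<open>Counting faces\<close>

text \<open>\<open>p r\<close> is the number of vertices of column \<open>r\<close> that are not in the face.\<close>

definition "profile_faces p = (\<Pi>\<^sub>E r\<in>cols. {X. X \<subseteq> {1..d} \<and> card X = p r})"

lemma profile_facesD: "C \<in> profile_faces p \<Longrightarrow> r \<in> cols \<Longrightarrow> card (C r) = p r"
  by (auto simp: profile_faces_def PiE_iff)

lemma profile_faces_adm:
  assumes "\<And>r. r \<in> cols \<Longrightarrow> 1 \<le> p r" "C \<in> profile_faces p"
  shows "C \<in> adm"
  using assms unfolding profile_faces_def adm_def by (fastforce simp: PiE_iff)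

lemma adm_profile_faces: "C \<in> adm \<Longrightarrow> (\<And>r. r \<in> cols \<Longrightarrow> card (C r) = p r) \<Longrightarrow> C \<in> profile_faces p"
  unfolding profile_faces_def adm_def by (auto simp: PiE_iff)

lemma finite_profile_faces: "finite (profile_faces p)"
  unfolding profile_faces_def by (intro finite_PiE) auto

lemma card_profile_faces: "card (profile_faces p) = (\<Prod>r\<in>cols. d choose p r)"
  unfolding profile_faces_def by (subst card_PiE) (auto simp: n_subsets)

text \<open>The bracket is the codimension. A facet, with one deletion per column, accounts for the
  summand 1; every further deletion adds one.\<close>

lemma card_face_sum:
  assumes C: "C \<in> adm"
  shows "card (face C) + (1 + (\<Sum>r\<in>cols. card (C r) - 1)) = d\<^sup>2"
proof -
  have "card (face C) + (\<Sum>r\<in>cols. card (C r) - 1) = (\<Sum>r\<in>cols. (d - card (C r)) + (card (C r) - 1))"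
    by (simp add: card_face[OF C] sum.distrib)
  also have "\<dots> = (\<Sum>r\<in>cols. d - 1)"
    by (intro sum.cong refl) (use card_compl[OF C] in force)
  also have "\<dots> = (d + 1) * (d - 1)" by (simp add: card_cols)
  also have "\<dots> + 1 = d\<^sup>2" using d2 by (simp add: power2_eq_square algebra_simps)
  finally show ?thesis by simp
qed

lemma sum_cols_one:
  assumes "r0 \<in> cols"
  shows "(\<Sum>r\<in>cols. if r = r0 then x else y) = x + real d * y"
proof -
  have "(\<Sum>r\<in>cols. if r = r0 then x else y) = x + (\<Sum>r\<in>cols - {r0}. y)"
    using assms by (subst sum.remove[of _ r0]) (auto intro!: sum.cong)
  then show ?thesis using assms by (simp add: card_cols)
qed

lemma prod_cols_one:
  assumes "r0 \<in> cols"
  shows "(\<Prod>r\<in>cols. if r = r0 then x else y) = x * y ^ d"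
proof -
  have "(\<Prod>r\<in>cols. if r = r0 then x else y) = x * (\<Prod>r\<in>cols - {r0}. y)"
    using assms by (subst prod.remove[of _ r0]) (auto intro!: prod.cong)
  then show ?thesis using assms by (simp add: card_cols)
qed

lemma card_cols_minus2:
  assumes "Z \<subseteq> cols" "card Z = 2"
  shows "card (cols - Z) = d - 1"
  using assms finite_subset[OF assms(1)] by (simp add: card_Diff_subset card_cols)

lemma sum_cols_two:
  assumes "Z \<subseteq> cols" "card Z = 2"
  shows "(\<Sum>r\<in>cols. if r \<in> Z then x else y) = 2 * x + (real d - 1) * y"
proof -
  have "(\<Sum>r\<in>cols. if r \<in> Z then x else y) = (\<Sum>r\<in>cols - Z. y) + (\<Sum>r\<in>Z. x)"
    using sum.subset_diff[OF assms(1), of "\<lambda>r. if r \<in> Z then x else y"] by simp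
  then show ?thesis using card_cols_minus2[OF assms] assms(2) d2 by (simp add: of_nat_diff)
qed

lemma prod_cols_two:
  assumes "Z \<subseteq> cols" "card Z = 2"
  shows "(\<Prod>r\<in>cols. if r \<in> Z then x else y) = y ^ (d - 1) * x ^ 2"
proof -
  have "(\<Prod>r\<in>cols. if r \<in> Z then x else y) = (\<Prod>r\<in>cols - Z. y) * (\<Prod>r\<in>Z. x)"
    using prod.subset_diff[OF assms(1), of "\<lambda>r. if r \<in> Z then x else y"] by simp
  then show ?thesis using card_cols_minus2[OF assms] assms(2) by simp
qed

lemma detsq_profile:
  assumes "C \<in> profile_faces p"
  shows "detsq C = (\<Sum>r\<in>cols. (real d - real (p r)) / real (p r)) * real d * (\<Prod>r\<in>cols. real (p r) / real d)"
  unfolding detsq_def inv_ratio_sum_def using profile_facesD[OF assms] by (simp cong: sum.cong prod.cong)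

text \<open>These two profiles cover codimension two (\<open>c = 2\<close>) and codimension three
  (\<open>c = 3\<close>, or two columns with two deletions each).\<close>

definition "one_column c r0 = (\<lambda>r::nat. if r = r0 then c else (1::nat))"
definition "two_columns Z = (\<lambda>r::nat. if r \<in> Z then 2 else (1::nat))"

lemma detsq_one:
  assumes C: "C \<in> profile_faces (one_column c r0)" and r0: "r0 \<in> cols" and c: "0 < c"
  shows "detsq C = (real d - real c + real c * real d * (real d - 1)) / real d ^ d"
proof -
  have s: "(\<Sum>r\<in>cols. (real d - real (one_column c r0 r)) / real (one_column c r0 r)) = (real d - real c) / real c + real d * (real d - 1)"
    unfolding sum_cols_one[OF r0, symmetric] by (intro sum.cong) (auto simp: one_column_def)
  have p: "(\<Prod>r\<in>cols. real (one_column c r0 r) / real d) = (real c / real d) * (1 / real d) ^ d"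
    unfolding prod_cols_one[OF r0, symmetric] by (intro prod.cong) (auto simp: one_column_def)
  have "detsq C = ((real d - real c) / real c + real d * (real d - 1)) * real d * ((real c / real d) * (1 / real d) ^ d)"
    unfolding detsq_profile[OF C] s p ..
  also have "\<dots> = (real d - real c + real c * real d * (real d - 1)) / real d ^ d"
    using c d2 by (simp add: power_one_over field_simps)
  finally show ?thesis .
qed

lemma detsq_two:
  assumes C: "C \<in> profile_faces (two_columns Z)" and Z: "Z \<subseteq> cols" "card Z = 2"
  shows "detsq C = 4 * ((real d)\<^sup>2 - real d - 1) / real d ^ d"
proof -
  have s: "(\<Sum>r\<in>cols. (real d - real (two_columns Z r)) / real (two_columns Z r)) = 2 * ((real d - 2) / 2) + (real d - 1) * (real d - 1)"
    unfolding sum_cols_two[OF Z, symmetric] by (intro sum.cong) (auto simp: two_columns_def)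
  have p: "(\<Prod>r\<in>cols. real (two_columns Z r) / real d) = (1 / real d) ^ (d - 1) * (2 / real d) ^ 2"
    unfolding prod_cols_two[OF Z, symmetric] by (intro prod.cong) (auto simp: two_columns_def)
  have dd: "real d ^ d = real d * real d ^ (d - 1)" using d2 by (simp add: power_eq_if)
  have "detsq C = (2 * ((real d - 2) / 2) + (real d - 1) * (real d - 1)) * real d * ((1 / real d) ^ (d - 1) * (2 / real d) ^ 2)"
    unfolding detsq_profile[OF C] s p ..
  also have "\<dots> = 4 * ((real d)\<^sup>2 - real d - 1) / real d ^ d"
    unfolding dd using d2 by (simp add: power_one_over power2_eq_square field_simps)
  finally show ?thesis .
qed

abbreviation "region_volume C \<equiv> measure lebesgue (normal_region C (ncone C) 1)"

lemma singleton_choice: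
  assumes "card X = 1"
  shows "X = {the_elem X}"
  using assms by (metis card_1_singletonE the_elem_eq)

lemma one_column_faces:
  assumes C: "C \<in> profile_faces (one_column c r0)" and r0: "r0 \<in> cols" and c: "2 \<le> c" "c \<le> 3"
  shows "C \<in> adm" "card (face C) + c = d\<^sup>2" "face C \<noteq> {}"
    "measure lebesgue (body C) = sqrt (real d - real c + real c * real d * (real d - 1)) / sqrt (real d ^ d) * unit_ball_vol (real c) / fact (d\<^sup>2 - 1 - c)"
proof -
  show a: "C \<in> adm" by (rule profile_faces_adm[OF _ C]) (use c in \<open>auto simp: one_column_def\<close>)
  have "(\<Sum>r\<in>cols. card (C r) - 1) = (\<Sum>r\<in>cols. if r = r0 then c - 1 else 0)"
    by (intro sum.cong refl) (auto simp: profile_facesD[OF C] one_column_def)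
  then have "(\<Sum>r\<in>cols. card (C r) - 1) = c - 1" using r0 by simp
  then show k: "card (face C) + c = d\<^sup>2" using card_face_sum[OF a] c by simp
  \<comment> \<open>A face of codimension at most 3 keeps at least one of its vertices, even for
    \<open>d = 2\<close>.\<close>
  have "2\<^sup>2 \<le> d\<^sup>2" using d2 by (intro power_mono) auto
  then show ne: "face C \<noteq> {}" using k c by auto
  show "measure lebesgue (body C) = sqrt (real d - real c + real c * real d * (real d - 1)) / sqrt (real d ^ d) * unit_ball_vol (real c) / fact (d\<^sup>2 - 1 - c)"
    unfolding measure_body[OF a] measure_normal_region_UNIV[OF a k ne]
    using detsq_one[OF C r0] c by (simp add: real_sqrt_divide)
qed

lemma two_columns_faces:
  assumes C: "C \<in> profile_faces (two_columns Z)" and Z: "Z \<subseteq> cols" "card Z = 2"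
  shows "C \<in> adm" "card (face C) + 3 = d\<^sup>2" "face C \<noteq> {}"
    "measure lebesgue (body C) = 2 * sqrt ((real d)\<^sup>2 - real d - 1) / sqrt (real d ^ d) * unit_ball_vol 3 / fact (d\<^sup>2 - 4)"
proof -
  show a: "C \<in> adm" by (rule profile_faces_adm[OF _ C]) (auto simp: two_columns_def)
  have "(\<Sum>r\<in>cols. card (C r) - 1) = (\<Sum>r\<in>cols. if r \<in> Z then 1 else 0)"
    by (intro sum.cong refl) (auto simp: profile_facesD[OF C] two_columns_def)
  also have "\<dots> = card (cols \<inter> Z)" by (simp add: sum.If_cases)
  also have "cols \<inter> Z = Z" using Z by auto
  finally have "(\<Sum>r\<in>cols. card (C r) - 1) = 2" using Z by simp
  then show k: "card (face C) + 3 = d\<^sup>2" using card_face_sum[OF a] by simp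
  have "2\<^sup>2 \<le> d\<^sup>2" using d2 by (intro power_mono) auto
  then show ne: "face C \<noteq> {}" using k by auto
  have "sqrt (detsq C) = 2 * sqrt ((real d)\<^sup>2 - real d - 1) / sqrt (real d ^ d)"
    unfolding detsq_two[OF C Z] real_sqrt_divide real_sqrt_mult by simp
  then show "measure lebesgue (body C) = 2 * sqrt ((real d)\<^sup>2 - real d - 1) / sqrt (real d ^ d) * unit_ball_vol 3 / fact (d\<^sup>2 - 4)"
    unfolding measure_body[OF a] measure_normal_region_UNIV[OF a k ne] by simp
qed

text \<open>Each volume is an angle fraction of a ball times a face. The constants 1/2, 4/3 and 16/3
  collect \<open>unit_ball_vol 2 = pi\<close> and \<open>unit_ball_vol 3 = 4 / 3 * pi\<close>; the
  square also has two triangles and a factor 2 from the face determinant.\<close>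

definition "ridge_volume = alpha / 2 * sqrt (2 * (real d)\<^sup>2 - real d - 2) / sqrt (real d ^ d) / fact (d\<^sup>2 - 3)"
definition "triangle_volume = 4 / 3 * arctan (sqrt (tan (3 * alpha / 4) * tan (alpha / 4) ^ 3)) * sqrt (3 * (real d)\<^sup>2 - 2 * real d - 3) / sqrt (real d ^ d) / fact (d\<^sup>2 - 4)"
definition "square_volume = 16 / 3 * arctan (sqrt (tan (alpha / 2 + beta / 4) * tan (alpha / 2 - beta / 4) * tan (beta / 4) ^ 2)) * sqrt ((real d)\<^sup>2 - real d - 1) / sqrt (real d ^ d) / fact (d\<^sup>2 - 4)"

lemma region_volume_ridge:
  assumes C: "C \<in> profile_faces (one_column 2 r0)" and r0: "r0 \<in> cols"
  shows "region_volume C = ridge_volume"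
proof -
  note mo = one_column_faces[OF C r0, simplified]
  obtain c1 c2 where c: "C r0 = {c1, c2}" "c1 \<noteq> c2"
    using profile_facesD[OF C r0] by (auto simp: one_column_def card_2_iff)
  have g: "C r = {the_elem (C r)}" if "r \<in> cols" "r \<noteq> r0" for r
    by (rule singleton_choice) (use profile_facesD[OF C that(1)] that(2) in \<open>simp add: one_column_def\<close>)
  have "region_volume C = alpha / (2 * pi) * measure lebesgue (body C)"
    by (rule measure_normal_region_codim2[OF mo(1,3) r0 c g])
  also have "\<dots> = ridge_volume"
  proof -
    have e: "real d - 2 + 2 * real d * (real d - 1) = 2 * (real d)\<^sup>2 - real d - 2" by (simp add: power2_eq_square algebra_simps)
    have e': "d\<^sup>2 - Suc (Suc (Suc 0)) = d\<^sup>2 - 3" by simp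
    show ?thesis unfolding mo(4) ridge_volume_def by (simp add: e e' unit_ball_vol_2 eval_nat_numeral)
  qed
  finally show ?thesis .
qed

lemma region_volume_triangle:
  assumes C: "C \<in> profile_faces (one_column 3 r0)" and r0: "r0 \<in> cols"
  shows "region_volume C = triangle_volume"
proof -
  note mo = one_column_faces[OF C r0, simplified]
  obtain c1 c2 c3 where c: "C r0 = {c1, c2, c3}" "c1 \<noteq> c2" "c2 \<noteq> c3" "c1 \<noteq> c3"
    using profile_facesD[OF C r0] by (auto simp: one_column_def card_3_iff)
  have g: "C r = {the_elem (C r)}" if "r \<in> cols" "r \<noteq> r0" for r
    by (rule singleton_choice) (use profile_facesD[OF C that(1)] that(2) in \<open>simp add: one_column_def\<close>)
  have "region_volume C = arctan (sqrt (tan (3 * alpha / 4) * tan (alpha / 4) ^ 3)) / pi * measure lebesgue (body C)"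
    by (rule measure_normal_region_triangle[OF mo(1,3) r0 c g])
  also have "\<dots> = triangle_volume"
  proof -
    have e: "real d - 3 + 3 * real d * (real d - 1) = 3 * (real d)\<^sup>2 - 2 * real d - 3" by (simp add: power2_eq_square algebra_simps)
    have f: "d\<^sup>2 - 1 - 3 = d\<^sup>2 - 4" by simp
    have "measure lebesgue (body C) = sqrt (3 * (real d)\<^sup>2 - 2 * real d - 3) / sqrt (real d ^ d) * (4 / 3 * pi) / fact (d\<^sup>2 - 4)"
      using one_column_faces(4)[OF C r0] e f by (simp add: unit_ball_vol_3)
    then show ?thesis unfolding triangle_volume_def by simp
  qed
  finally show ?thesis .
qed

lemma region_volume_square:
  assumes C: "C \<in> profile_faces (two_columns Z)" and Z: "Z \<subseteq> cols" "card Z = 2"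
  shows "region_volume C = square_volume"
proof -
  note mo = two_columns_faces[OF C Z]
  obtain r0 r1 where r: "Z = {r0, r1}" "r0 \<noteq> r1" using Z(2) by (auto simp: card_2_iff)
  then have rc: "r0 \<in> cols" "r1 \<in> cols" using Z by auto
  obtain c1 c2 where c: "C r0 = {c1, c2}" "c1 \<noteq> c2"
    using profile_facesD[OF C rc(1)] r by (auto simp: two_columns_def card_2_iff)
  obtain e1 e2 where e: "C r1 = {e1, e2}" "e1 \<noteq> e2"
    using profile_facesD[OF C rc(2)] r by (auto simp: two_columns_def card_2_iff)
  have g: "C r = {the_elem (C r)}" if "r \<in> cols" "r \<noteq> r0" "r \<noteq> r1" for r
    by (rule singleton_choice) (use profile_facesD[OF C that(1)] that(2,3) r in \<open>simp add: two_columns_def\<close>)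
  have "region_volume C = 2 * (arctan (sqrt (tan (alpha / 2 + beta / 4) * tan (alpha / 2 - beta / 4) * tan (beta / 4) ^ 2)) / pi * measure lebesgue (body C))"
    by (rule measure_normal_region_square[OF mo(1,3) rc r(2) c e g])
  also have "\<dots> = square_volume" unfolding mo(4) square_volume_def by (simp add: unit_ball_vol_3)
  finally show ?thesis .
qed

text \<open>Faces of codimension \<open>k\<close>. Level 0 is empty, as admissible sets give proper
  faces only, so the volume of the polytope enters the Steiner polynomial separately.\<close>

definition "level k = {C \<in> adm. face C \<noteq> {} \<and> card (face C) + k = d\<^sup>2}"

lemma level_2: "level 2 = (\<Union>r0\<in>cols. profile_faces (one_column 2 r0))"
proof (intro equalityI subsetI)
  fix C assume "C \<in> level 2"
  then have C: "C \<in> adm" and k: "card (face C) + 2 = d\<^sup>2" by (auto simp: level_def)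
  have "(\<Sum>r\<in>cols. card (C r) - 1) = 1" using card_face_sum[OF C] k by linarith
  then obtain r0 where r0: "r0 \<in> cols" "card (C r0) - 1 = 1" "\<And>r. r \<in> cols \<Longrightarrow> r0 \<noteq> r \<Longrightarrow> card (C r) - 1 = 0"
    by (subst (asm) sum_eq_1_iff) auto
  have "card (C r) = one_column 2 r0 r" if "r \<in> cols" for r
    using r0(2) r0(3)[OF that] card_compl(3)[OF C that] by (auto simp: one_column_def)
  then have "C \<in> profile_faces (one_column 2 r0)" using C by (intro adm_profile_faces)
  then show "C \<in> (\<Union>r0\<in>cols. profile_faces (one_column 2 r0))" using r0(1) by blast
next
  fix C assume "C \<in> (\<Union>r0\<in>cols. profile_faces (one_column 2 r0))"
  then show "C \<in> level 2" using one_column_faces(1-3)[of C 2] unfolding level_def by auto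
qed

text \<open>The excess deletions sum to 2: either both fall into one column, or one falls into each
  of two columns.\<close>

lemma level_3: "level 3 = (\<Union>r0\<in>cols. profile_faces (one_column 3 r0)) \<union> (\<Union>Z\<in>{Z. Z \<subseteq> cols \<and> card Z = 2}. profile_faces (two_columns Z))"
proof (intro equalityI subsetI)
  fix C assume "C \<in> level 3"
  then have C: "C \<in> adm" and k: "card (face C) + 3 = d\<^sup>2" by (auto simp: level_def)
  have s: "(\<Sum>r\<in>cols. card (C r) - 1) = 2" using card_face_sum[OF C] k by linarith
  show "C \<in> (\<Union>r0\<in>cols. profile_faces (one_column 3 r0)) \<union> (\<Union>Z\<in>{Z. Z \<subseteq> cols \<and> card Z = 2}. profile_faces (two_columns Z))"
  proof (cases "\<exists>r0\<in>cols. 2 \<le> card (C r0) - 1")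
    case True
    then obtain r0 where r0: "r0 \<in> cols" "2 \<le> card (C r0) - 1" by auto
    have "(\<Sum>r\<in>cols. card (C r) - 1) = (card (C r0) - 1) + (\<Sum>r\<in>cols - {r0}. card (C r) - 1)"
      using r0(1) by (simp add: sum.remove)
    then have "card (C r0) - 1 = 2" "(\<Sum>r\<in>cols - {r0}. card (C r) - 1) = 0" using s r0(2) by linarith+
    then have e: "card (C r0) - 1 = 2" "\<And>r. r \<in> cols \<Longrightarrow> r \<noteq> r0 \<Longrightarrow> card (C r) - 1 = 0" by auto
    have "card (C r) = one_column 3 r0 r" if "r \<in> cols" for r
      using e(1) e(2)[OF that] card_compl(3)[OF C that] by (auto simp: one_column_def)
    then have "C \<in> profile_faces (one_column 3 r0)" using C by (intro adm_profile_faces)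
    then show ?thesis using r0(1) by blast
  next
    case False
    define Z where "Z = {r\<in>cols. card (C r) - 1 = 1}"
    have c: "card (C r) = two_columns Z r" if "r \<in> cols" for r
      using False that card_compl(3)[OF C that] by (fastforce simp: two_columns_def Z_def)
    have "(\<Sum>r\<in>cols. card (C r) - 1) = (\<Sum>r\<in>cols. if r \<in> Z then 1 else 0)"
      by (intro sum.cong refl) (auto simp: c two_columns_def)
    also have "\<dots> = card (cols \<inter> Z)" by (simp add: sum.If_cases)
    also have "cols \<inter> Z = Z" by (auto simp: Z_def)
    finally have "card Z = 2" using s by simp
    moreover have "C \<in> profile_faces (two_columns Z)" using C c by (intro adm_profile_faces)
    ultimately show ?thesis by (auto simp: Z_def)
  qed
next
  fix C assume "C \<in> (\<Union>r0\<in>cols. profile_faces (one_column 3 r0)) \<union> (\<Union>Z\<in>{Z. Z \<subseteq> cols \<and> card Z = 2}. profile_faces (two_columns Z))"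
  then show "C \<in> level 3" using one_column_faces(1-3)[of C 3] two_columns_faces(1-3)[of C] unfolding level_def by auto
qed

lemma profile_faces_disjoint:
  assumes "r \<in> cols" "p r \<noteq> q r"
  shows "profile_faces p \<inter> profile_faces q = {}"
  using profile_facesD[of _ p r] profile_facesD[of _ q r] assms by (metis disjoint_iff)

text \<open>There are \<open>d choose c\<close> deletions in the distinguished column and
  \<open>d\<close> in each of the \<open>d\<close> others.\<close>

lemma card_profile_faces_one:
  assumes "r0 \<in> cols"
  shows "real (card (profile_faces (one_column c r0))) = real (d choose c) * real d ^ d"
proof -
  have "(\<Prod>r\<in>cols. real (d choose one_column c r0 r)) = (\<Prod>r\<in>cols. if r = r0 then real (d choose c) else real d)"
    by (intro prod.cong) (auto simp: one_column_def)
  then show ?thesis using prod_cols_one[OF assms] by (simp add: card_profile_faces)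
qed

lemma card_profile_faces_two:
  assumes "Z \<subseteq> cols" "card Z = 2"
  shows "real (card (profile_faces (two_columns Z))) = real d ^ (d - 1) * (real (d choose 2))\<^sup>2"
proof -
  have "(\<Prod>r\<in>cols. real (d choose two_columns Z r)) = (\<Prod>r\<in>cols. if r \<in> Z then real (d choose 2) else real d)"
    by (intro prod.cong) (auto simp: two_columns_def)
  then show ?thesis using prod_cols_two[OF assms] by (simp add: card_profile_faces)
qed

lemma sum_level_2: "(\<Sum>C\<in>level 2. region_volume C) = (real d + 1) * (real (d choose 2) * real d ^ d * ridge_volume)"
proof -
  have "(\<Sum>C\<in>level 2. region_volume C) = (\<Sum>r0\<in>cols. \<Sum>C\<in>profile_faces (one_column 2 r0). region_volume C)"
    unfolding level_2
    by (rule sum.UNION_disjoint)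
       (auto simp: finite_profile_faces simp del: Int_iff intro!: profile_faces_disjoint simp: one_column_def)
  also have "\<dots> = (\<Sum>r0\<in>cols. \<Sum>C\<in>profile_faces (one_column 2 r0). ridge_volume)"
    by (intro sum.cong refl region_volume_ridge)
  also have "\<dots> = (\<Sum>r0\<in>cols. real (d choose 2) * real d ^ d * ridge_volume)"
    by (intro sum.cong refl) (simp add: card_profile_faces_one)
  finally show ?thesis by (simp add: card_cols)
qed

lemma sum_level_3: "(\<Sum>C\<in>level 3. region_volume C) = (real d + 1) * (real (d choose 3) * real d ^ d * triangle_volume)
   + real ((d + 1) choose 2) * (real d ^ (d - 1) * (real (d choose 2))\<^sup>2 * square_volume)"
proof -
  let ?Zs = "{Z. Z \<subseteq> cols \<and> card Z = 2}"
  have fZ: "finite ?Zs" by simp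
  have dis: "profile_faces (one_column 3 r0) \<inter> profile_faces q = {}" if "r0 \<in> cols" "q r0 \<noteq> 3" for r0 q
    using that by (intro profile_faces_disjoint[of r0]) (auto simp: one_column_def)
  have "(\<Sum>C\<in>level 3. region_volume C) = (\<Sum>C\<in>(\<Union>r0\<in>cols. profile_faces (one_column 3 r0)). region_volume C) + (\<Sum>C\<in>(\<Union>Z\<in>?Zs. profile_faces (two_columns Z)). region_volume C)"
    unfolding level_3
  proof (rule sum.union_disjoint)
    show "(\<Union>r0\<in>cols. profile_faces (one_column 3 r0)) \<inter> (\<Union>Z\<in>?Zs. profile_faces (two_columns Z)) = {}"
    proof -
      have "profile_faces (one_column 3 r0) \<inter> profile_faces (two_columns Z) = {}" if "r0 \<in> cols" for r0 Z
        by (rule dis[OF that]) (simp add: two_columns_def)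
      then show ?thesis by blast
    qed
  qed (auto simp: finite_profile_faces fZ)
  also have "(\<Sum>C\<in>(\<Union>r0\<in>cols. profile_faces (one_column 3 r0)). region_volume C) = (\<Sum>r0\<in>cols. \<Sum>C\<in>profile_faces (one_column 3 r0). region_volume C)"
  proof (rule sum.UNION_disjoint)
    show "\<forall>i\<in>cols. \<forall>j\<in>cols. i \<noteq> j \<longrightarrow> profile_faces (one_column 3 i) \<inter> profile_faces (one_column 3 j) = {}"
      by (intro ballI impI dis) (auto simp: one_column_def)
  qed (auto simp: finite_profile_faces)
  also have "\<dots> = (\<Sum>r0\<in>cols. \<Sum>C\<in>profile_faces (one_column 3 r0). triangle_volume)"
    by (intro sum.cong refl region_volume_triangle)
  also have "\<dots> = (\<Sum>r0\<in>cols. real (d choose 3) * real d ^ d * triangle_volume)"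
    by (intro sum.cong refl) (simp add: card_profile_faces_one)
  also have "\<dots> = (real d + 1) * (real (d choose 3) * real d ^ d * triangle_volume)" by (simp add: card_cols)
  also have "(\<Sum>C\<in>(\<Union>Z\<in>?Zs. profile_faces (two_columns Z)). region_volume C) = (\<Sum>Z\<in>?Zs. \<Sum>C\<in>profile_faces (two_columns Z). region_volume C)"
  proof (rule sum.UNION_disjoint)
    show "\<forall>i\<in>?Zs. \<forall>j\<in>?Zs. i \<noteq> j \<longrightarrow> profile_faces (two_columns i) \<inter> profile_faces (two_columns j) = {}"
    proof (intro ballI impI)
      fix i j assume ij: "i \<in> ?Zs" "j \<in> ?Zs" "i \<noteq> j"
      then obtain r where "r \<in> cols" "r \<in> i \<longleftrightarrow> r \<notin> j" by blast
      then show "profile_faces (two_columns i) \<inter> profile_faces (two_columns j) = {}"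
        by (intro profile_faces_disjoint[of r]) (auto simp: two_columns_def)
    qed
  qed (auto simp: finite_profile_faces)
  also have "\<dots> = (\<Sum>Z\<in>?Zs. \<Sum>C\<in>profile_faces (two_columns Z). square_volume)"
    by (intro sum.cong refl region_volume_square) auto
  also have "\<dots> = (\<Sum>Z\<in>?Zs. real d ^ (d - 1) * (real (d choose 2))\<^sup>2 * square_volume)"
    by (intro sum.cong refl) (simp add: card_profile_faces_two)
  also have "\<dots> = real ((d + 1) choose 2) * (real d ^ (d - 1) * (real (d choose 2))\<^sup>2 * square_volume)"
    by (simp add: n_subsets card_cols)
  finally show ?thesis .
qed

text \<open>Pieces of equal codimension scale with the same power of \<epsilon>, so grouping the
  admissible sets by level yields the coefficients.\<close>

lemma steiner_polynomial:
  assumes e: "0 \<le> \<epsilon>"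
  shows "measure lebesgue (parallel_body P \<epsilon>)
    = (\<Sum>k\<le>d\<^sup>2 - 1. ((if k = 0 then measure lebesgue P else 0) + (\<Sum>C\<in>level k. region_volume C)) * \<epsilon> ^ k)"
proof -
  let ?R = "\<lambda>C. normal_region C (ncone C) \<epsilon>"
  have mR: "?R C \<in> lmeasurable" if "C \<in> adm" for C by (rule lmeasurable_normal_region[OF that closed_ncone])
  have mP: "P \<in> lmeasurable" using compact_P by (rule lmeasurable_compact)
  have U: "measure lebesgue (\<Union>(?R ` adm)) = (\<Sum>C\<in>adm. measure lebesgue (?R C))"
  proof (rule measure_negligible_finite_Union_image[OF finite_adm mR])
    show "pairwise (\<lambda>C C'. negligible (?R C \<inter> ?R C')) adm"
      using normal_region_disjoint by (auto simp: pairwise_def)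
  qed
  have "parallel_body P \<epsilon> = P \<union> \<Union>(?R ` adm)"
    using parallel_body_decomposition[of \<epsilon>] e by simp
  moreover have "measure lebesgue (P \<union> \<Union>(?R ` adm)) = measure lebesgue P + measure lebesgue (\<Union>(?R ` adm))"
  proof (rule measure_Un_negligible)
    have "P \<inter> \<Union>(?R ` adm) = {}" using normal_region_disjoint_P by blast
    then show "negligible (P \<inter> \<Union>(?R ` adm))" by simp
    show "\<Union>(?R ` adm) \<in> lmeasurable" using finite_adm mR by (intro fmeasurable.finite_Union) auto
  qed (rule mP)
  ultimately have "measure lebesgue (parallel_body P \<epsilon>) = measure lebesgue P + (\<Sum>C\<in>adm. measure lebesgue (?R C))"
    using U by simp
  also have "(\<Sum>C\<in>adm. measure lebesgue (?R C)) = (\<Sum>C\<in>{C\<in>adm. face C \<noteq> {}}. measure lebesgue (?R C))"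
    by (rule sum.mono_neutral_right) (use finite_adm in \<open>auto simp: normal_region_empty\<close>)
  also have "\<dots> = (\<Sum>C\<in>{C\<in>adm. face C \<noteq> {}}. \<epsilon> ^ (d\<^sup>2 - card (face C)) * region_volume C)"
  proof (intro sum.cong refl)
    fix C assume "C \<in> {C\<in>adm. face C \<noteq> {}}"
    then have C: "C \<in> adm" by auto
    have k: "d\<^sup>2 - card (face C) \<noteq> 0" using card_face_sum[OF C] by simp
    show "measure lebesgue (?R C) = \<epsilon> ^ (d\<^sup>2 - card (face C)) * region_volume C"
    \<comment> \<open>At radius 0 a region is empty, since its normal part is not 0; the power also
      vanishes, because proper faces have positive codimension.\<close>
    proof (cases "\<epsilon> = 0")
      case True
      then have "?R C = {}" unfolding normal_region_def by auto
      then show ?thesis using True k by (simp add: zero_power)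
    next
      case False
      have "1 \<le> d\<^sup>2" using d2 by simp
      then have "CARD('n) + 1 - card (face C) = d\<^sup>2 - card (face C)" using cardn by simp
      then show ?thesis using measure_normal_region_scale[OF C, of \<epsilon>] False e by simp
    qed
  qed
  also have "\<dots> = (\<Sum>k\<le>d\<^sup>2 - 1. \<Sum>C\<in>{C\<in>{C\<in>adm. face C \<noteq> {}}. d\<^sup>2 - card (face C) = k}. \<epsilon> ^ (d\<^sup>2 - card (face C)) * region_volume C)"
  proof (rule sum.group[symmetric])
    show "(\<lambda>C. d\<^sup>2 - card (face C)) ` {C \<in> adm. face C \<noteq> {}} \<subseteq> {..d\<^sup>2 - 1}"
    proof (clarsimp)
      fix C assume "C \<in> adm" "face C \<noteq> {}"
      then have "0 < card (face C)" by (simp add: card_gt_0_iff)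
      then show "d\<^sup>2 - card (face C) \<le> d\<^sup>2 - Suc 0" by simp
    qed
  qed (use finite_adm in auto)
  also have "\<dots> = (\<Sum>k\<le>d\<^sup>2 - 1. (\<Sum>C\<in>level k. region_volume C) * \<epsilon> ^ k)"
  proof (rule sum.cong[OF refl])
    fix k
    have "{C\<in>{C\<in>adm. face C \<noteq> {}}. d\<^sup>2 - card (face C) = k} = level k"
    proof -
      have "d\<^sup>2 - card (face C) = k \<longleftrightarrow> card (face C) + k = d\<^sup>2" if "C \<in> adm" for C
        using card_face_sum[OF that] by auto
      then show ?thesis by (auto simp: level_def)
    qed
    moreover have "(\<Sum>C\<in>level k. \<epsilon> ^ (d\<^sup>2 - card (face C)) * region_volume C) = (\<Sum>C\<in>level k. region_volume C * \<epsilon> ^ k)"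
    proof (intro sum.cong refl)
      fix C assume "C \<in> level k"
      then have "card (face C) + k = d\<^sup>2" by (simp add: level_def)
      then have "d\<^sup>2 - card (face C) = k" by linarith
      then show "\<epsilon> ^ (d\<^sup>2 - card (face C)) * region_volume C = region_volume C * \<epsilon> ^ k" by simp
    qed
    ultimately show "(\<Sum>C\<in>{C\<in>{C\<in>adm. face C \<noteq> {}}. d\<^sup>2 - card (face C) = k}. \<epsilon> ^ (d\<^sup>2 - card (face C)) * region_volume C)
        = (\<Sum>C\<in>level k. region_volume C) * \<epsilon> ^ k"
      by (simp add: sum_distrib_right)
  qed
  also have "measure lebesgue P + \<dots> = (\<Sum>k\<le>d\<^sup>2 - 1. ((if k = 0 then measure lebesgue P else 0) + (\<Sum>C\<in>level k. region_volume C)) * \<epsilon> ^ k)"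
  proof -
    have "(\<Sum>k\<le>d\<^sup>2 - 1. (if k = 0 then measure lebesgue P else 0) * \<epsilon> ^ k) = (\<Sum>k\<le>d\<^sup>2 - 1. if k = 0 then measure lebesgue P else 0)"
      by (intro sum.cong) auto
    then show ?thesis by (simp add: distrib_right sum.distrib)
  qed
  finally show ?thesis .
qed

section \<open>Closed forms of the second and third Steiner coefficients\<close>

lemma powr_half: "real d powr (real d / 2) = sqrt (real d ^ d)"
proof -
  have "real d ^ d = real d powr real d" using d2 by (simp add: powr_realpow)
  then show ?thesis using d2 by (simp add: powr_powr flip: powr_half_sqrt)
qed

lemma steiner_coefficient_2:
  "(\<Sum>C\<in>level 2. region_volume C) = sqrt (2 * real d ^ 2 - real d - 2) * (real d ^ 2 - 1) * real d powr (real d / 2 + 1)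
                 / (4 * fact (d^2 - 3)) * alpha"
proof -
  \<comment> \<open>The number of faces contributes \<open>d ^ d = q * q\<close> and the face volume
    \<open>1 / q\<close>; the surviving \<open>q\<close> is the power \<open>d / 2\<close> in the
    formula.\<close>
  define q where "q = sqrt (real d ^ d)"
  have q0: "q > 0" and qq: "real d ^ d = q * q" using d2 by (auto simp: q_def)
  have pw: "real d powr (real d / 2 + 1) = q * real d"
    using d2 by (simp add: powr_add powr_half q_def)
  show ?thesis
    unfolding sum_level_2 ridge_volume_def real_choose_2 pw q_def[symmetric] qq
    using q0 by (simp add: field_simps power2_eq_square)
qed

lemma steiner_coefficient_3:
  "(\<Sum>C\<in>level 3. region_volume C) = 2 * sqrt (3 * real d ^ 2 - 2 * real d - 3) * (real d ^ 2 - 1) * (real d - 2)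
                   * real d powr (real d / 2 + 1) / (9 * fact (d^2 - 4))
                   * arctan (sqrt (tan (3 * alpha / 4) * tan (alpha / 4) ^ 3))
               + 2 * sqrt (real d ^ 2 - real d - 1) * (real d ^ 2 - 1) * (real d - 1)
                   * real d powr (real d / 2 + 2) / (3 * fact (d^2 - 4))
                   * arctan (sqrt (tan (alpha / 2 + beta / 4) * tan (alpha / 2 - beta / 4) * tan (beta / 4) ^ 2))"
proof -
  define q where "q = sqrt (real d ^ d)"
  have q0: "q > 0" and qq: "real d ^ d = q * q" using d2 by (auto simp: q_def)
  \<comment> \<open>In the square case only \<open>d - 1\<close> columns have a single deletion,
    hence this power.\<close>
  have qd: "real d ^ (d - 1) = q * q / real d" using d2 qq by (simp add: power_eq_if field_simps)
  have pw: "real d powr (real d / 2 + 1) = q * real d" "real d powr (real d / 2 + 2) = q * (real d)\<^sup>2"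
    using d2 by (simp_all add: powr_add powr_half q_def powr_realpow flip: powr_numeral)
  define X where "X = arctan (sqrt (tan (3 * alpha / 4) * tan (alpha / 4) ^ 3))"
  define Y where "Y = arctan (sqrt (tan (alpha / 2 + beta / 4) * tan (alpha / 2 - beta / 4) * tan (beta / 4) ^ 2))"
  define s1 where "s1 = sqrt (3 * real d ^ 2 - 2 * real d - 3)"
  define s2 where "s2 = sqrt (real d ^ 2 - real d - 1)"
  define F where "F = (fact (d\<^sup>2 - 4) :: real)"
  have F0: "F > 0" by (simp add: F_def)
  have "(real d + 1) * (real (d choose 3) * real d ^ d * triangle_volume) = 2 * s1 * (real d ^ 2 - 1) * (real d - 2) * (q * real d) / (9 * F) * X"
    unfolding triangle_volume_def real_choose_3 X_def[symmetric] s1_def[symmetric] F_def[symmetric] q_def[symmetric] qq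
    using q0 F0 by (simp add: field_simps power2_eq_square)
  moreover have "real ((d + 1) choose 2) * (real d ^ (d - 1) * (real (d choose 2))\<^sup>2 * square_volume)
      = 2 * s2 * (real d ^ 2 - 1) * (real d - 1) * (q * (real d)\<^sup>2) / (3 * F) * Y"
    unfolding square_volume_def real_choose_2 Y_def[symmetric] s2_def[symmetric] F_def[symmetric] q_def[symmetric] qd
    using q0 F0 d2 by (simp add: field_simps power2_eq_square)
  ultimately show ?thesis
    unfolding sum_level_3 pw X_def[symmetric] Y_def[symmetric] s1_def[symmetric] s2_def[symmetric] F_def[symmetric] by simp
qed

end

text \<open>The linear-image formula for Lebesgue measure is available for \<open>real^'n\<close> with a well-ordered
  index type only, so a general Euclidean space is identified with such a space.\<close>

typedef (overloaded) 'a basis_index = "{..<DIM('a::euclidean_space)}"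
  by (rule exI[of _ 0]) simp

instantiation basis_index :: (euclidean_space) linorder
begin

definition less_eq_basis_index :: "'a basis_index \<Rightarrow> 'a basis_index \<Rightarrow> bool" where
  "less_eq_basis_index i j \<longleftrightarrow> Rep_basis_index i \<le> Rep_basis_index j"

definition less_basis_index :: "'a basis_index \<Rightarrow> 'a basis_index \<Rightarrow> bool" where
  "less_basis_index i j \<longleftrightarrow> Rep_basis_index i < Rep_basis_index j"

instance
  by standard (auto simp: less_eq_basis_index_def less_basis_index_def Rep_basis_index_inject)

end

instance basis_index :: (euclidean_space) wellorder
proof
  fix P :: "'a basis_index \<Rightarrow> bool" and a
  assume step: "\<And>x. (\<And>y. y < x \<Longrightarrow> P y) \<Longrightarrow> P x"
  show "P a"
  proof (induction a rule: measure_induct_rule[where f = Rep_basis_index])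
    case (less x)
    show ?case by (rule step, rule less.IH) (simp add: less_basis_index_def)
  qed
qed

instance basis_index :: (euclidean_space) finite
proof
  have "(UNIV :: 'a basis_index set) = Abs_basis_index ` {..<DIM('a)}"
    by (simp only: type_definition.Abs_image[OF type_definition_basis_index])
  then show "finite (UNIV :: 'a basis_index set)" by (metis finite_imageI finite_lessThan)
qed

lemma card_basis_index: "CARD('a::euclidean_space basis_index) = DIM('a)"
  using type_definition.card[OF type_definition_basis_index] by simp

text \<open>The coordinate map for an enumeration of the basis. Measure preservation is stated for
  closed sets, whose images are closed and hence Borel; parallel bodies are closed.\<close>

lemma isometric_coordinates:
  obtains \<phi> :: "'a::euclidean_space \<Rightarrow> real^('a basis_index)" where
    "linear \<phi>" "surj \<phi>" "\<And>x y. \<phi> x \<bullet> \<phi> y = x \<bullet> y"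
    "\<And>S. closed S \<Longrightarrow> measure lebesgue (\<phi> ` S) = measure lebesgue S"
proof -
  obtain \<beta> :: "'a basis_index \<Rightarrow> 'a" where \<beta>: "bij_betw \<beta> UNIV Basis"
    using finite_same_card_bij[of "UNIV :: 'a basis_index set" "Basis :: 'a set"] by (auto simp: card_basis_index)
  define \<phi> :: "'a \<Rightarrow> real^('a basis_index)" where "\<phi> = (\<lambda>x. \<chi> i. x \<bullet> \<beta> i)"
  define \<psi> :: "real^('a basis_index) \<Rightarrow> 'a" where "\<psi> = (\<lambda>y. \<Sum>i\<in>UNIV. y$i *\<^sub>R \<beta> i)"
  have \<beta>B: "\<beta> i \<in> Basis" for i using \<beta> by (auto simp: bij_betw_def)
  have \<beta>inj: "\<beta> i = \<beta> j \<longleftrightarrow> i = j" for i j using \<beta> by (auto simp: bij_betw_def inj_on_def)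
  have \<psi>\<beta>: "\<psi> y \<bullet> \<beta> i = y$i" for y i
  proof -
    have "\<psi> y \<bullet> \<beta> i = (\<Sum>j\<in>UNIV. if j = i then y$j else 0)"
      unfolding \<psi>_def inner_sum_left by (intro sum.cong refl) (simp add: inner_Basis \<beta>B \<beta>inj)
    then show ?thesis by simp
  qed
  have \<phi>\<psi>: "\<phi> (\<psi> y) = y" for y by (simp add: \<phi>_def \<psi>\<beta> vec_eq_iff)
  have lin: "linear \<phi>" by (rule linearI) (simp_all add: \<phi>_def vec_eq_iff inner_add_left)
  have inn: "\<phi> x \<bullet> \<phi> y = x \<bullet> y" for x y
  proof -
    have "\<phi> x \<bullet> \<phi> y = (\<Sum>i\<in>UNIV. (x \<bullet> \<beta> i) * (y \<bullet> \<beta> i))" by (simp add: \<phi>_def inner_vec_def)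
    also have "\<dots> = (\<Sum>b\<in>Basis. (x \<bullet> b) * (y \<bullet> b))" by (rule sum.reindex_bij_betw[OF \<beta>])
    finally show ?thesis by (simp add: euclidean_inner[of x y])
  qed
  have nrm: "norm (\<phi> x) = norm x" for x by (simp add: norm_eq_sqrt_inner inn)
  have inj: "inj \<phi>"
  proof (rule injI)
    fix x y assume "\<phi> x = \<phi> y"
    then have "norm (\<phi> (x - y)) = 0" using lin by (simp add: linear_diff)
    then show "x = y" by (simp add: nrm)
  qed
  have surj: "surj \<phi>" using \<phi>\<psi> by (metis surjI)
  have meas: "\<phi> \<in> borel_measurable borel"
    using lin linear_continuous_on_compose borel_measurable_continuous_onI linear_continuous_on linear_conv_bounded_linear by blast
  \<comment> \<open>Preimages of boxes are boxes with the same side lengths, and values on boxes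
    determine Lebesgue measure.\<close>
  have lb: "lborel = distr lborel borel \<phi>"
  proof (rule lborel_eqI)
    fix l u :: "real^('a basis_index)" assume lu: "\<And>b. b \<in> Basis \<Longrightarrow> l \<bullet> b \<le> u \<bullet> b"
    have lu': "l$i \<le> u$i" for i using lu[of "axis i 1"] by (simp add: inner_axis)
    have "\<phi> -` box l u = box (\<psi> l) (\<psi> u)"
    proof -
      have "(\<forall>b\<in>Basis. \<psi> l \<bullet> b < x \<bullet> b \<and> x \<bullet> b < \<psi> u \<bullet> b) \<longleftrightarrow> (\<forall>i. \<psi> l \<bullet> \<beta> i < x \<bullet> \<beta> i \<and> x \<bullet> \<beta> i < \<psi> u \<bullet> \<beta> i)" for x
        using \<beta> \<beta>B unfolding bij_betw_def by (metis imageE)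
      then show ?thesis by (auto simp: mem_box_cart mem_box \<psi>\<beta> \<phi>_def)
    qed
    then have "emeasure (distr lborel borel \<phi>) (box l u) = emeasure lborel (box (\<psi> l) (\<psi> u))"
      using meas by (subst emeasure_distr) auto
    also have "\<dots> = (\<Prod>b\<in>Basis. (\<psi> u - \<psi> l) \<bullet> b)"
    proof -
      have "\<psi> l \<bullet> b \<le> \<psi> u \<bullet> b" if b: "b \<in> Basis" for b
      proof -
        obtain i where "b = \<beta> i" using b \<beta> unfolding bij_betw_def by (metis imageE)
        then show ?thesis using lu' by (simp add: \<psi>\<beta>)
      qed
      then show ?thesis by (simp add: emeasure_lborel_box)
    qed
    also have "(\<Prod>b\<in>Basis. (\<psi> u - \<psi> l) \<bullet> b) = (\<Prod>i\<in>UNIV. (\<psi> u - \<psi> l) \<bullet> \<beta> i)"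
      by (rule prod.reindex_bij_betw[OF \<beta>, symmetric])
    also have "\<dots> = (\<Prod>i\<in>UNIV. (u - l) \<bullet> axis i 1)" by (simp add: inner_diff_left \<psi>\<beta> inner_axis)
    also have "\<dots> = (\<Prod>b\<in>Basis. (u - l) \<bullet> b)"
    proof -
      have "bij_betw (\<lambda>i. axis i (1::real)) UNIV (Basis :: (real^('a basis_index)) set)"
        by (auto simp: bij_betw_def inj_on_def axis_eq_axis Basis_vec_def)
      then show ?thesis by (rule prod.reindex_bij_betw)
    qed
    finally show "emeasure (distr lborel borel \<phi>) (box l u) = (\<Prod>b\<in>Basis. (u - l) \<bullet> b)" .
  qed simp
  have "measure lebesgue (\<phi> ` S) = measure lebesgue S" if S: "closed S" for S
  proof -
    have cl: "closed (\<phi> ` S)" by (rule closed_injective_linear_image[OF S lin inj])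
    have "measure lebesgue (\<phi> ` S) = measure lborel (\<phi> ` S)" using cl by (intro measure_completion) auto
    also have "\<dots> = measure (distr lborel borel \<phi>) (\<phi> ` S)" by (subst lb) simp
    also have "\<dots> = measure lborel (\<phi> -` \<phi> ` S)"
      using meas cl by (subst measure_distr) auto
    also have "\<phi> -` \<phi> ` S = S" using inj by (rule inj_vimage_image_eq)
    also have "measure lborel S = measure lebesgue S" using S by (intro measure_completion[symmetric]) auto
    finally show ?thesis .
  qed
  then show thesis using that[OF lin surj inn] by blast
qed

section \<open>The theorem for an arbitrary Euclidean space\<close>

lemma (in mub_vertices) compl_polytope_eq_P: "compl_polytope d v = P"
proof -
  have "{v r j | r j. r \<in> {1..d+1} \<and> j \<in> {1..d}} = V ` idx"
    by (force simp: V_def idx_def cols_def)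
  then show ?thesis by (simp add: compl_polytope_def P_def)
qed

text \<open>Surjectivity gives every point near the image a preimage, which lies at the same
  distance from \<open>P\<close>.\<close>

lemma parallel_body_image:
  fixes \<phi> :: "'a::euclidean_space \<Rightarrow> 'b::euclidean_space"
  assumes "surj \<phi>" and d: "\<And>x y. dist (\<phi> x) (\<phi> y) = dist x y"
  shows "parallel_body (\<phi> ` P) \<epsilon> = \<phi> ` parallel_body P \<epsilon>"
proof -
  have i: "infdist (\<phi> x) (\<phi> ` P) = infdist x P" for x
    by (simp add: infdist_def image_image d)
  show ?thesis
  proof (intro equalityI subsetI)
    fix y assume y: "y \<in> parallel_body (\<phi> ` P) \<epsilon>"
    obtain x where "y = \<phi> x" using \<open>surj \<phi>\<close> by auto
    then show "y \<in> \<phi> ` parallel_body P \<epsilon>" using y i by (auto simp: parallel_body_def)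
  qed (auto simp: parallel_body_def i)
qed

text \<open>A polynomial is determined by its values at \<open>eps \<ge> 0\<close>, so the identity
  fixes \<open>a\<close> up to index \<open>d^2 - 1\<close>, which is at least 3. The existential
  statement therefore does identify the intrinsic volumes.\<close>

theorem theorem2:
  fixes d :: nat
    and W :: "nat \<Rightarrow> 'a::euclidean_space set"
    and v :: "nat \<Rightarrow> nat \<Rightarrow> 'a"
  assumes d2: "d \<ge> 2"
    and dimE: "DIM('a) = d^2 - 1"
    and W_sub: "\<And>r. r \<in> {1..d+1} \<Longrightarrow> subspace (W r)"
    and W_dim: "\<And>r. r \<in> {1..d+1} \<Longrightarrow> dim (W r) = d - 1"
    and W_orth: "\<And>r s x y. r \<in> {1..d+1} \<Longrightarrow> s \<in> {1..d+1} \<Longrightarrow> r \<noteq> s \<Longrightarrow>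
                   x \<in> W r \<Longrightarrow> y \<in> W s \<Longrightarrow> inner x y = 0"
    and W_span: "span (\<Union>r\<in>{1..d+1}. W r) = UNIV"
    and v_in: "\<And>r j. r \<in> {1..d+1} \<Longrightarrow> j \<in> {1..d} \<Longrightarrow> v r j \<in> W r"
    and v_off: "\<And>r j k. r \<in> {1..d+1} \<Longrightarrow> j \<in> {1..d} \<Longrightarrow> k \<in> {1..d} \<Longrightarrow> j \<noteq> k \<Longrightarrow>
                   inner (v r j) (v r k) = - 1 / real d"
    and v_norm: "\<And>r j. r \<in> {1..d+1} \<Longrightarrow> j \<in> {1..d} \<Longrightarrow> (norm (v r j))^2 = 1 - 1 / real d"
  shows "\<exists>a :: nat \<Rightarrow> real.
     (\<forall>eps \<ge> 0. measure lebesgue (parallel_body (compl_polytope d v) eps)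
                  = (\<Sum>k\<le>d^2 - 1. a k * eps ^ k))
   \<and> (let \<alpha> = arccos (1 - real d / (real d ^ 2 - 1));
          \<beta> = arccos (1 - 2 * real d / (real d ^ 2 - 1))
      in a 2 = sqrt (2 * real d ^ 2 - real d - 2) * (real d ^ 2 - 1) * real d powr (real d / 2 + 1)
                 / (4 * fact (d^2 - 3)) * \<alpha>
       \<and> a 3 = 2 * sqrt (3 * real d ^ 2 - 2 * real d - 3) * (real d ^ 2 - 1) * (real d - 2)
                   * real d powr (real d / 2 + 1) / (9 * fact (d^2 - 4))
                   * arctan (sqrt (tan (3 * \<alpha> / 4) * tan (\<alpha> / 4) ^ 3))
               + 2 * sqrt (real d ^ 2 - real d - 1) * (real d ^ 2 - 1) * (real d - 1)
                   * real d powr (real d / 2 + 2) / (3 * fact (d^2 - 4))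
                   * arctan (sqrt (tan (\<alpha> / 2 + \<beta> / 4) * tan (\<alpha> / 2 - \<beta> / 4) * tan (\<beta> / 4) ^ 2)))"
proof -
  obtain \<phi> :: "'a \<Rightarrow> real^('a basis_index)" where \<phi>: "linear \<phi>" "surj \<phi>" "\<And>x y. \<phi> x \<bullet> \<phi> y = x \<bullet> y"
    "\<And>S. closed S \<Longrightarrow> measure lebesgue (\<phi> ` S) = measure lebesgue S"
    by (rule isometric_coordinates[where 'a = 'a]) (rule that)
  define u where "u = (\<lambda>r j. \<phi> (v r j))"
  \<comment> \<open>The isometry preserves the Gram matrix, so the image points satisfy the locale
    assumptions.\<close>
  interpret mub_vertices d u
  proof
    fix r s j k assume rs: "r \<in> {1..d+1}" "s \<in> {1..d+1}" "j \<in> {1..d}" "k \<in> {1..d}"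
    have "v r j \<bullet> v s k = 0" if "r \<noteq> s" using W_orth[OF rs(1,2) that] v_in rs by simp
    moreover have "v r j \<bullet> v r j = 1 - 1 / real d" using v_norm[OF rs(1,3)] by (simp add: power2_norm_eq_inner)
    moreover have "v r j \<bullet> v r k = - 1 / real d" if "j \<noteq> k" using v_off[OF rs(1,3,4) that] .
    ultimately show "u r j \<bullet> u s k = (if r = s then (if j = k then 1 else 0) - 1 / real d else 0)"
      by (auto simp: u_def \<phi>(3))
  qed (use d2 dimE in \<open>auto simp: card_basis_index\<close>)
  have dist: "dist (\<phi> x) (\<phi> y) = dist x y" for x y
    using \<phi>(1,3) by (simp add: dist_norm norm_eq_sqrt_inner flip: linear_diff)
  have P: "P = \<phi> ` compl_polytope d v"
  proof -
    have "{u r j | r j. r \<in> {1..d+1} \<and> j \<in> {1..d}} = \<phi> ` {v r j | r j. r \<in> {1..d+1} \<and> j \<in> {1..d}}"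
      by (auto simp: u_def)
    then show ?thesis
      unfolding compl_polytope_eq_P[symmetric] compl_polytope_def by (simp add: convex_hull_linear_image[OF \<phi>(1)])
  qed
  have cl: "closed (parallel_body (compl_polytope d v) eps)" for eps
    unfolding parallel_body_def by (intro closed_Collect_le continuous_intros)
  have meas: "measure lebesgue (parallel_body (compl_polytope d v) eps) = measure lebesgue (parallel_body P eps)" for eps
    unfolding P parallel_body_image[OF \<phi>(2) dist] \<phi>(4)[OF cl] ..
  define a where "a = (\<lambda>k. (if k = 0 then measure lebesgue P else 0) + (\<Sum>C\<in>level k. region_volume C))"
  have "\<forall>eps \<ge> 0. measure lebesgue (parallel_body (compl_polytope d v) eps) = (\<Sum>k\<le>d^2 - 1. a k * eps ^ k)"
    unfolding meas a_def using steiner_polynomial by blast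
  moreover have "a 2 = (\<Sum>C\<in>level 2. region_volume C)" "a 3 = (\<Sum>C\<in>level 3. region_volume C)" by (simp_all add: a_def)
  ultimately show ?thesis
    unfolding Let_def using steiner_coefficient_2 steiner_coefficient_3
    unfolding alpha_def beta_def by (intro exI[of _ a] conjI) simp_all
qed

end
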